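(* Let $(M,L,\psi)$ be a weighted Finsler spacetime of dimension $n+1$, let $\mathsf{J}$ be a nonsingular Lagrange tensor field along a future-directed timelike geodesic $\eta:I\to M$ of unit speed, and let $\epsilon\in\mathbb{R}$. Then the following hold on $I$. For $N=0$, the $\epsilon$-expansion $\theta_\epsilon$ satisfies $$\theta_\epsilon^*+\frac{2\epsilon}{n}\psi_\eta^*\theta_\epsilon+\frac{\theta_\epsilon^2}{n}+\mathrm{trace}(\sigma_\epsilon^2)+\mathrm{Ric}_0(\eta^* )=0.$$ For $N\in(-\infty,+\infty)\setminus\{0,n\}$, $$\theta_\epsilon^*+\Big(1-\epsilon^2\frac{N-n}{N}\Big)\frac{\theta_\epsilon^2}{n}+\frac{N(N-n)}{n}\Big(\frac{\epsilon\theta_\epsilon}{N}+\frac{\psi_\eta^*}{N-n}\Big)^2+\mathrm{trace}(\sigma_\epsilon^2)+\mathrm{Ric}_N(\eta^* )=0.$$ For $N=+\infty$, $$\theta_\epsilon^*+(1-\epsilon^2)\frac{\theta_\epsilon^2}{n}+\frac1n(\epsilon\theta_\epsilon+\psi_\eta^* )^2+\mathrm{trace}(\sigma_\epsilon^2)+\mathrm{Ric}_\infty(\eta^* )=0.$$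
   Context: **Lorentz–Finsler setting.** $M$ is a connected $C^\infty$-manifold without boundary of dimension $n+1\ge2$. A Lorentz–Finsler structure is a function $L:TM\to\mathbb{R}$ such that $L\in C^\infty(TM\setminus\{0\})$; $L(cv)=c^2L(v)$ for all $v\in TM$, $c>0$; and for every $v\in TM\setminus\{0\}$ the matrix $g_{\alpha\beta}(v)=\frac{\partial^2 L}{\partial v^\alpha\partial v^\beta}(v)$, $\alpha,\beta=0,\dots,n$, is non-degenerate of signature $(-,+,\dots,+)$. It defines a Lorentzian inner product $g_v$ on $T_xM$ (for $v\in T_xM\setminus\{0\}$), with $g_v(v,v)=2L(v)$. A vector $v$ is timelike if $L(v)<0$, lightlike if $L(v)=0$ and $v\ne 0$, causal if timelike or lightlike. A Finsler spacetime is such an $(M,L)$ time-oriented by a smooth vector field $X$ with $L(X(x))<0$ for all $x$. A causal $v\in T_xM$ is future-directed if it lies in the same connected component of $\overline{\Omega'_x}\setminus\{0\}$ as $X(x)$, where $\Omega'_x=\{v\in T_xM: L(v)<0\}$. $\Omega_x$ is the set of future-directed timelike vectors, $\overline\Omega=\bigcup_x\overline\Omega_x$. $F(v)=\sqrt{-2L(v)}$ on causal vectors; a timelike geodesic has unit speed if $F(\dot\eta)\equiv1$. All causal curves and geodesics are future-directed. **Connection and curvature.** With $(g^{\alpha\beta}(v))$ the inverse matrix, set $\widetilde\Gamma^\alpha_{\beta\gamma}(v)=\frac12\sum_\delta g^{\alpha\delta}(v)\big(\frac{\partial g_{\delta\gamma}}{\partial x^\beta}+\frac{\partial g_{\beta\delta}}{\partial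 x^\gamma}-\frac{\partial g_{\beta\gamma}}{\partial x^\delta}\big)(v)$, $G^\alpha(v)=\frac12\sum_{\beta,\gamma}\widetilde\Gamma^\alpha_{\beta\gamma}(v)v^\beta v^\gamma$, $N^\alpha_\beta(v)=\frac{\partial G^\alpha}{\partial v^\beta}(v)$, and $\Gamma^\alpha_{\beta\gamma}(v)=\widetilde\Gamma^\alpha_{\beta\gamma}(v)-\frac12\sum_{\delta,\mu}g^{\alpha\delta}(v)\big(\frac{\partial g_{\delta\gamma}}{\partial v^\mu}N^\mu_\beta+\frac{\partial g_{\beta\delta}}{\partial v^\mu}N^\mu_\gamma-\frac{\partial g_{\beta\gamma}}{\partial v^\mu}N^\mu_\delta\big)(v)$. Along a curve $\eta$, the covariant derivative $Y'=D^{\dot\eta}_{\dot\eta}Y$ has components $\dot Y^\alpha+\sum\Gamma^\alpha_{\beta\gamma}(\dot\eta)\dot\eta^\beta Y^\gamma$; for endomorphism fields $E$, $E'(P)=E(P)'-E(P')$. A causal geodesic is a smooth causal curve with $\ddot\eta^\alpha+2G^\alpha(\dot\eta)=0$. Put $R^\alpha_\beta(v)=2\frac{\partial G^\alpha}{\partial x^\beta}-\sum_\gamma\big(\frac{\partial N^\alpha_\beta}{\partial x^\gamma}v^\gamma-2\frac{\partial N^\alpha_\beta}{\partial v^\gamma}G^\gamma\big)-\sum_\gamma N^\alpha_\gamma N^\gamma_\beta$ (all at $v$), $R_v(w)=\sum R^\alpha_\beta(v)w^\beta\frac{\partial}{\partial x^\alpha}$ and $\mathrm{Ric}(v)=\mathrm{trace}(R_v)$.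 **Weight.** $\psi:\overline\Omega\setminus\{0\}\to\mathbb{R}$ is $C^\infty$ with $\psi(cv)=\psi(v)$ for $c>0$. For a causal geodesic $\eta$, $\psi_\eta(t)=\psi(\dot\eta(t))$. For $v\in\overline\Omega\setminus\{0\}$ and the geodesic $\eta$ with $\dot\eta(0)=v$: $\mathrm{Ric}_N(v)=\mathrm{Ric}(v)+\psi_\eta''(0)-\frac{\psi_\eta'(0)^2}{N-n}$ for $N\in\mathbb{R}\setminus\{n\}$; $\mathrm{Ric}_\infty(v)=\mathrm{Ric}(v)+\psi_\eta''(0)$. **Lagrange tensors, $\epsilon$-quantities.** Let $\eta:I\to M$ be a unit-speed timelike geodesic, $N_\eta(t)\subset T_{\eta(t)}M$ the $n$-dimensional $g_{\dot\eta(t)}$-orthogonal complement of $\dot\eta(t)$, $\mathsf{R}(t)=R_{\dot\eta(t)}:N_\eta(t)\to N_\eta(t)$, $I_n$ the identity of $N_\eta(t)$. A Jacobi tensor field is a smooth field of endomorphisms $\mathsf{J}(t)$ of $N_\eta(t)$ with $\mathsf{J}''+\mathsf{R}\mathsf{J}=0$ and $\ker\mathsf{J}(t)\cap\ker\mathsf{J}'(t)=\{0\}$ for all $t$; it is a Lagrange tensor field if moreover $(\mathsf{J}')^{\mathsf{T}}\mathsf{J}-\mathsf{J}^{\mathsf{T}}\mathsf{J}'=0$ ($\mathsf{T}$ = transpose with respect to $g_{\dot\eta}$). Nonsingular means invertible for all $t\in I$. The $\epsilon$-proper time is $\tau_\epsilon=\int e^{\frac{2(\epsilon-1)}{n}\psi_\eta(t)}dt$,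 and $*$ denotes the (covariant) derivative with respect to $\tau_\epsilon$, i.e. $(\cdot)^*=e^{\frac{2(1-\epsilon)}{n}\psi_\eta}(\cdot)'$; $\eta^*=e^{\frac{2(1-\epsilon)}{n}\psi_\eta}\dot\eta$. With $\mathsf{J}_\psi=e^{-\psi_\eta/n}\mathsf{J}$, put $\mathsf{B}_\epsilon=\mathsf{J}_\psi^*\mathsf{J}_\psi^{-1}$, $\epsilon$-expansion $\theta_\epsilon=\mathrm{trace}(\mathsf{B}_\epsilon)$, and $\epsilon$-shear tensor $\sigma_\epsilon=\mathsf{B}_\epsilon-\frac{\theta_\epsilon}{n}I_n$. *)

theory Defs
  imports "HOL-Analysis.Analysis"
begin

section \<open>Smooth maps\<close>

text \<open>On an open set, \<open>Ck_on k f S\<close> says that all iterated directional derivatives of \<open>f\<close> of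
  order at most \<open>k\<close> exist and are continuous.  On an arbitrary set, smoothness means existence of
  local smooth extensions; this gives the usual notion on manifolds with boundary, at end points of
  intervals and on the closed future cones.\<close>

primrec Ck_on :: "nat \<Rightarrow> ('a::euclidean_space \<Rightarrow> 'b::real_normed_vector) \<Rightarrow> 'a set \<Rightarrow> bool" where
  "Ck_on 0 = (\<lambda>f S. continuous_on S f)"
| "Ck_on (Suc k) = (\<lambda>f S. (\<forall>x\<in>S. f differentiable (at x)) \<and>
     (\<forall>v. Ck_on k (\<lambda>x. frechet_derivative f (at x) v) S))"

definition smooth_on :: "'a::euclidean_space set \<Rightarrow> ('a \<Rightarrow> 'b::real_normed_vector) \<Rightarrow> bool" where
  "smooth_on S f \<longleftrightarrow> (\<forall>x\<in>S. \<exists>U g. open U \<and> x \<in> U \<and> (\<forall>k. Ck_on k g U) \<and> (\<forall>y\<in>U \<inter> S. g y = f y))"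


section \<open>Manifolds and tangent vectors\<close>

type_synonym ('m, 'd) chart = "'m set \<times> ('m \<Rightarrow> real^'d)"

definition chart_inv :: "('m, 'd) chart \<Rightarrow> real^'d \<Rightarrow> 'm" where
  "chart_inv c = inv_into (fst c) (snd c)"

definition chart_image :: "('m, 'd) chart \<Rightarrow> (real^'d) set" where
  "chart_image c = snd c ` fst c"

definition is_chart :: "('m::topological_space, 'd::finite) chart \<Rightarrow> bool" where
  "is_chart c \<longleftrightarrow> open (fst c) \<and> open (chart_image c) \<and>
     homeomorphism (fst c) (chart_image c) (snd c) (chart_inv c)"

definition smooth_atlas :: "('m::topological_space, 'd::finite) chart set \<Rightarrow> bool" where
  "smooth_atlas A \<longleftrightarrow> (\<forall>c\<in>A. is_chart c) \<and> (\<Union>c\<in>A. fst c) = UNIV \<and>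
     (\<forall>c\<in>A. \<forall>c'\<in>A. smooth_on (snd c ` (fst c \<inter> fst c')) (snd c' \<circ> chart_inv c))"

text \<open>As in other formal libraries, the tangent space \<open>T\<^sub>pM\<close> is modelled by the coordinate space:
  a vector \<open>v :: real^'d\<close> in \<open>T\<^sub>pM\<close> is the tangent vector with components \<open>v\<close> in the chart
  \<open>chart_at A p\<close> (which is fixed once and for all for each point \<open>p\<close>).
  \<open>tcoord A c p\<close> gives its components in any other chart \<open>c\<close> around \<open>p\<close>, and \<open>tvec A c p\<close> is the
  inverse map.  Nothing is assumed about the dependence of \<open>chart_at A p\<close> on \<open>p\<close>: smoothness on
  \<open>TM\<close> is always expressed in the bundle charts induced by the charts of the atlas.\<close>

definition chart_at :: "('m, 'd) chart set \<Rightarrow> 'm \<Rightarrow> ('m, 'd) chart" where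
  "chart_at A p = (SOME c. c \<in> A \<and> p \<in> fst c)"

definition tcoord :: "('m, 'd::finite) chart set \<Rightarrow> ('m, 'd) chart \<Rightarrow> 'm \<Rightarrow> real^'d \<Rightarrow> real^'d" where
  "tcoord A c p v =
     frechet_derivative (snd c \<circ> chart_inv (chart_at A p)) (at (snd (chart_at A p) p)) v"

definition tvec :: "('m, 'd::finite) chart set \<Rightarrow> ('m, 'd) chart \<Rightarrow> 'm \<Rightarrow> real^'d \<Rightarrow> real^'d" where
  "tvec A c p y = frechet_derivative (snd (chart_at A p) \<circ> chart_inv c) (at (snd c p)) y"

text \<open>Functions on (subsets of) \<open>TM\<close> are curried; this is their expression in the bundle chart
  \<open>(x, y)\<close> of \<open>TM\<close> induced by the chart \<open>c\<close>.\<close>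

definition local_rep ::
  "('m, 'd::finite) chart set \<Rightarrow> ('m, 'd) chart \<Rightarrow> ('m \<Rightarrow> real^'d \<Rightarrow> real) \<Rightarrow> real^'d \<Rightarrow> real^'d \<Rightarrow> real"
where
  "local_rep A c f x y = f (chart_inv c x) (tvec A c (chart_inv c x) y)"


section \<open>Coordinate expressions\<close>

text \<open>Partial derivatives in base and fibre directions of a function of \<open>(x, v)\<close>.\<close>

definition dx :: "'d \<Rightarrow> (real^'d \<Rightarrow> real^'d \<Rightarrow> real) \<Rightarrow> real^'d::finite \<Rightarrow> real^'d \<Rightarrow> real" where
  "dx b f x v = frechet_derivative (\<lambda>x'. f x' v) (at x) (axis b 1)"

definition dv :: "'d \<Rightarrow> (real^'d \<Rightarrow> real^'d \<Rightarrow> real) \<Rightarrow> real^'d::finite \<Rightarrow> real^'d \<Rightarrow> real" where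
  "dv b f x v = frechet_derivative (\<lambda>v'. f x v') (at v) (axis b 1)"

text \<open>Here \<open>l\<close> is the coordinate expression of \<open>L\<close> in a chart; index positions are in the order
  of the usual notation, e.g. \<open>Chris l a b c\<close> stands for \<open>\<Gamma>\<close> with upper index \<open>a\<close> and lower
  indices \<open>b, c\<close>.\<close>

context
  fixes l :: "real^'d::finite \<Rightarrow> real^'d \<Rightarrow> real"
begin

definition metric :: "'d \<Rightarrow> 'd \<Rightarrow> real^'d \<Rightarrow> real^'d \<Rightarrow> real" where
  "metric a b x v = dv a (dv b l) x v"

definition metric_matrix :: "real^'d \<Rightarrow> real^'d \<Rightarrow> real^'d^'d" where
  "metric_matrix x v = (\<chi> a b. metric a b x v)"

definition metric_inv :: "'d \<Rightarrow> 'd \<Rightarrow> real^'d \<Rightarrow> real^'d \<Rightarrow> real" where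
  "metric_inv a b x v = matrix_inv (metric_matrix x v) $ a $ b"

definition Chris_tilde :: "'d \<Rightarrow> 'd \<Rightarrow> 'd \<Rightarrow> real^'d \<Rightarrow> real^'d \<Rightarrow> real" where
  "Chris_tilde a b c x v = 1/2 * (\<Sum>d\<in>UNIV. metric_inv a d x v *
     (dx b (metric d c) x v + dx c (metric b d) x v - dx d (metric b c) x v))"

definition spray :: "'d \<Rightarrow> real^'d \<Rightarrow> real^'d \<Rightarrow> real" where
  "spray a x v = 1/2 * (\<Sum>b\<in>UNIV. \<Sum>c\<in>UNIV. Chris_tilde a b c x v * v $ b * v $ c)"

definition Nconn :: "'d \<Rightarrow> 'd \<Rightarrow> real^'d \<Rightarrow> real^'d \<Rightarrow> real" where
  "Nconn a b x v = dv b (spray a) x v"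

definition Chris :: "'d \<Rightarrow> 'd \<Rightarrow> 'd \<Rightarrow> real^'d \<Rightarrow> real^'d \<Rightarrow> real" where
  "Chris a b c x v = Chris_tilde a b c x v -
     1/2 * (\<Sum>d\<in>UNIV. \<Sum>m\<in>UNIV. metric_inv a d x v *
       (dv m (metric d c) x v * Nconn m b x v + dv m (metric b d) x v * Nconn m c x v
        - dv m (metric b c) x v * Nconn m d x v))"

definition curv :: "'d \<Rightarrow> 'd \<Rightarrow> real^'d \<Rightarrow> real^'d \<Rightarrow> real" where
  "curv a b x v = 2 * dx b (spray a) x v
     - (\<Sum>c\<in>UNIV. dx c (Nconn a b) x v * v $ c - 2 * dv c (Nconn a b) x v * spray c x v)
     - (\<Sum>c\<in>UNIV. Nconn a c x v * Nconn c b x v)"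

end

text \<open>Signature \<open>(-,+,\<dots>,+)\<close> in the sense of Sylvester's law of inertia.\<close>

definition lorentz_signature :: "real^'d::finite^'d \<Rightarrow> bool" where
  "lorentz_signature g \<longleftrightarrow> transpose g = g \<and> (\<exists>(P :: real^'d^'d) k. invertible P \<and>
     transpose P ** g ** P = (\<chi> i j. if i \<noteq> j then 0 else if i = k then - 1 else 1))"


section \<open>Weighted Finsler spacetimes\<close>

definition lorentz_finsler ::
  "('m::topological_space, 'd::finite) chart set \<Rightarrow> ('m \<Rightarrow> real^'d \<Rightarrow> real) \<Rightarrow> bool" where
  "lorentz_finsler A L \<longleftrightarrow>
     (\<forall>c\<in>A. smooth_on (chart_image c \<times> (UNIV - {0})) (\<lambda>(x, v). local_rep A c L x v)) \<and>
     (\<forall>p v. \<forall>r>0. L p (r *\<^sub>R v) = r\<^sup>2 * L p v) \<and>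
     (\<forall>c\<in>A. \<forall>x\<in>chart_image c. \<forall>v. v \<noteq> 0 \<longrightarrow> lorentz_signature (metric_matrix (local_rep A c L) x v))"

definition smooth_vector_field ::
  "('m, 'd::finite) chart set \<Rightarrow> ('m \<Rightarrow> real^'d) \<Rightarrow> bool" where
  "smooth_vector_field A X \<longleftrightarrow>
     (\<forall>c\<in>A. smooth_on (chart_image c) (\<lambda>x. tcoord A c (chart_inv c x) (X (chart_inv c x))))"

definition timelike :: "('m \<Rightarrow> real^'d \<Rightarrow> real) \<Rightarrow> 'm \<Rightarrow> real^'d \<Rightarrow> bool" where
  "timelike L p v \<longleftrightarrow> L p v < 0"

definition causal :: "('m \<Rightarrow> real^'d \<Rightarrow> real) \<Rightarrow> 'm \<Rightarrow> real^'d \<Rightarrow> bool" where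
  "causal L p v \<longleftrightarrow> timelike L p v \<or> (L p v = 0 \<and> v \<noteq> 0)"

definition future_directed ::
  "('m \<Rightarrow> real^'d::finite \<Rightarrow> real) \<Rightarrow> ('m \<Rightarrow> real^'d) \<Rightarrow> 'm \<Rightarrow> real^'d \<Rightarrow> bool" where
  "future_directed L X p v \<longleftrightarrow> causal L p v \<and>
     v \<in> connected_component_set (closure {w. timelike L p w} - {0}) (X p)"

definition Omega ::
  "('m \<Rightarrow> real^'d::finite \<Rightarrow> real) \<Rightarrow> ('m \<Rightarrow> real^'d) \<Rightarrow> 'm \<Rightarrow> (real^'d) set" where
  "Omega L X p = {v. timelike L p v \<and> future_directed L X p v}"

definition finsler_spacetime ::
  "('m::topological_space, 'd::finite) chart set \<Rightarrow> ('m \<Rightarrow> real^'d \<Rightarrow> real) \<Rightarrow> ('m \<Rightarrow> real^'d) \<Rightarrow> bool"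
where
  "finsler_spacetime A L X \<longleftrightarrow> smooth_atlas A \<and> connected (UNIV :: 'm set) \<and>
     lorentz_finsler A L \<and> smooth_vector_field A X \<and> (\<forall>p. timelike L p (X p))"

text \<open>Only the values \<open>\<psi> p v\<close> with \<open>v \<noteq> 0\<close> in \<open>closure (Omega L X p)\<close> are relevant.\<close>

definition weight ::
  "('m::topological_space, 'd::finite) chart set \<Rightarrow> ('m \<Rightarrow> real^'d \<Rightarrow> real) \<Rightarrow> ('m \<Rightarrow> real^'d) \<Rightarrow>
   ('m \<Rightarrow> real^'d \<Rightarrow> real) \<Rightarrow> bool" where
  "weight A L X \<psi> \<longleftrightarrow>
     (\<forall>c\<in>A. smooth_on
        {(x, v). x \<in> chart_image c \<and> v \<noteq> 0 \<and>
                 tvec A c (chart_inv c x) v \<in> closure (Omega L X (chart_inv c x))}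
        (\<lambda>(x, v). local_rep A c \<psi> x v)) \<and>
     (\<forall>p. \<forall>v \<in> closure (Omega L X p) - {0}. \<forall>r>0. \<psi> p (r *\<^sub>R v) = \<psi> p v)"

definition weighted_finsler_spacetime ::
  "('m::topological_space, 'd::finite) chart set \<Rightarrow> ('m \<Rightarrow> real^'d \<Rightarrow> real) \<Rightarrow> ('m \<Rightarrow> real^'d) \<Rightarrow>
   ('m \<Rightarrow> real^'d \<Rightarrow> real) \<Rightarrow> bool" where
  "weighted_finsler_spacetime A L X \<psi> \<longleftrightarrow> finsler_spacetime A L X \<and> weight A L X \<psi>"


section \<open>Objects at a point, in components with respect to \<open>chart_at A p\<close>\<close>

definition gprod ::
  "('m, 'd::finite) chart set \<Rightarrow> ('m \<Rightarrow> real^'d \<Rightarrow> real) \<Rightarrow> 'm \<Rightarrow> real^'d \<Rightarrow> real^'d \<Rightarrow> real^'d \<Rightarrow> real"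
where
  "gprod A L p v u w =
     (let c = chart_at A p in
      \<Sum>a\<in>UNIV. \<Sum>b\<in>UNIV. metric (local_rep A c L) a b (snd c p) v * u $ a * w $ b)"

definition curv_matrix ::
  "('m, 'd::finite) chart set \<Rightarrow> ('m \<Rightarrow> real^'d \<Rightarrow> real) \<Rightarrow> 'm \<Rightarrow> real^'d \<Rightarrow> real^'d^'d" where
  "curv_matrix A L p v =
     (let c = chart_at A p in \<chi> a b. curv (local_rep A c L) a b (snd c p) v)"

definition Ric :: "('m, 'd::finite) chart set \<Rightarrow> ('m \<Rightarrow> real^'d \<Rightarrow> real) \<Rightarrow> 'm \<Rightarrow> real^'d \<Rightarrow> real" where
  "Ric A L p v = trace (curv_matrix A L p v)"


section \<open>Curves and geodesics\<close>

text \<open>Curves are defined on an arbitrary non-degenerate interval \<open>I\<close> (with or without its end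
  points); all derivatives along a curve are taken within \<open>I\<close>, i.e. they are one-sided at end
  points belonging to \<open>I\<close>.\<close>

definition proper_interval :: "real set \<Rightarrow> bool" where
  "proper_interval I \<longleftrightarrow> is_interval I \<and> (\<exists>a\<in>I. \<exists>b\<in>I. a < b)"

definition derivI :: "real set \<Rightarrow> (real \<Rightarrow> 'b::real_normed_vector) \<Rightarrow> real \<Rightarrow> 'b" where
  "derivI I f t = vector_derivative f (at t within I)"

definition smooth_curve ::
  "('m::topological_space, 'd::finite) chart set \<Rightarrow> real set \<Rightarrow> (real \<Rightarrow> 'm) \<Rightarrow> bool" where
  "smooth_curve A I \<eta> \<longleftrightarrow> continuous_on I \<eta> \<and>
     (\<forall>c\<in>A. smooth_on {t\<in>I. \<eta> t \<in> fst c} (snd c \<circ> \<eta>))"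

definition velocity ::
  "('m, 'd::finite) chart set \<Rightarrow> real set \<Rightarrow> (real \<Rightarrow> 'm) \<Rightarrow> real \<Rightarrow> real^'d" where
  "velocity A I \<eta> t = derivI I (snd (chart_at A (\<eta> t)) \<circ> \<eta>) t"

definition causal_geodesic ::
  "('m::topological_space, 'd::finite) chart set \<Rightarrow> ('m \<Rightarrow> real^'d \<Rightarrow> real) \<Rightarrow> ('m \<Rightarrow> real^'d) \<Rightarrow>
   real set \<Rightarrow> (real \<Rightarrow> 'm) \<Rightarrow> bool" where
  "causal_geodesic A L X I \<eta> \<longleftrightarrow> proper_interval I \<and> smooth_curve A I \<eta> \<and>
     (\<forall>t\<in>I. future_directed L X (\<eta> t) (velocity A I \<eta> t)) \<and>
     (\<forall>c\<in>A. \<forall>t\<in>I. \<eta> t \<in> fst c \<longrightarrow>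
        (\<forall>a. derivI I (derivI I (snd c \<circ> \<eta>)) t $ a
             + 2 * spray (local_rep A c L) a (snd c (\<eta> t)) (derivI I (snd c \<circ> \<eta>) t) = 0))"

definition Fnorm :: "('m \<Rightarrow> real^'d \<Rightarrow> real) \<Rightarrow> 'm \<Rightarrow> real^'d \<Rightarrow> real" where
  "Fnorm L p v = sqrt (- 2 * L p v)"

definition unit_timelike_geodesic ::
  "('m::topological_space, 'd::finite) chart set \<Rightarrow> ('m \<Rightarrow> real^'d \<Rightarrow> real) \<Rightarrow> ('m \<Rightarrow> real^'d) \<Rightarrow>
   real set \<Rightarrow> (real \<Rightarrow> 'm) \<Rightarrow> bool" where
  "unit_timelike_geodesic A L X I \<eta> \<longleftrightarrow> causal_geodesic A L X I \<eta> \<and>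
     (\<forall>t\<in>I. timelike L (\<eta> t) (velocity A I \<eta> t) \<and> Fnorm L (\<eta> t) (velocity A I \<eta> t) = 1)"

definition psi_along ::
  "('m, 'd::finite) chart set \<Rightarrow> ('m \<Rightarrow> real^'d \<Rightarrow> real) \<Rightarrow> real set \<Rightarrow> (real \<Rightarrow> 'm) \<Rightarrow> real \<Rightarrow> real" where
  "psi_along A \<psi> I \<eta> t = \<psi> (\<eta> t) (velocity A I \<eta> t)"


section \<open>Weighted Ricci curvature\<close>

text \<open>A geodesic with initial velocity \<open>v\<close>, together with its interval of definition.  The first two
  derivatives of \<open>\<psi>\<close> along it at \<open>0\<close> do not depend on the choice, since they are determined by the
  3-jet at \<open>0\<close>, and hence by \<open>v\<close> through the geodesic equation.\<close>

definition geodesic_from ::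
  "('m::topological_space, 'd::finite) chart set \<Rightarrow> ('m \<Rightarrow> real^'d \<Rightarrow> real) \<Rightarrow> ('m \<Rightarrow> real^'d) \<Rightarrow>
   'm \<Rightarrow> real^'d \<Rightarrow> real set \<times> (real \<Rightarrow> 'm)" where
  "geodesic_from A L X p v = (SOME (K, \<gamma>). 0 \<in> K \<and> causal_geodesic A L X K \<gamma> \<and>
     \<gamma> 0 = p \<and> velocity A K \<gamma> 0 = v)"

definition psi_d1 ::
  "('m::topological_space, 'd::finite) chart set \<Rightarrow> ('m \<Rightarrow> real^'d \<Rightarrow> real) \<Rightarrow> ('m \<Rightarrow> real^'d) \<Rightarrow>
   ('m \<Rightarrow> real^'d \<Rightarrow> real) \<Rightarrow> 'm \<Rightarrow> real^'d \<Rightarrow> real" where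
  "psi_d1 A L X \<psi> p v =
     (let (K, \<gamma>) = geodesic_from A L X p v in derivI K (psi_along A \<psi> K \<gamma>) 0)"

definition psi_d2 ::
  "('m::topological_space, 'd::finite) chart set \<Rightarrow> ('m \<Rightarrow> real^'d \<Rightarrow> real) \<Rightarrow> ('m \<Rightarrow> real^'d) \<Rightarrow>
   ('m \<Rightarrow> real^'d \<Rightarrow> real) \<Rightarrow> 'm \<Rightarrow> real^'d \<Rightarrow> real" where
  "psi_d2 A L X \<psi> p v =
     (let (K, \<gamma>) = geodesic_from A L X p v in derivI K (derivI K (psi_along A \<psi> K \<gamma>)) 0)"

text \<open>The parameter \<open>n\<close> is always such that the manifold has dimension \<open>n + 1\<close>.\<close>

definition Ric_N ::
  "('m::topological_space, 'd::finite) chart set \<Rightarrow> ('m \<Rightarrow> real^'d \<Rightarrow> real) \<Rightarrow> ('m \<Rightarrow> real^'d) \<Rightarrow>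
   ('m \<Rightarrow> real^'d \<Rightarrow> real) \<Rightarrow> nat \<Rightarrow> real \<Rightarrow> 'm \<Rightarrow> real^'d \<Rightarrow> real" where
  "Ric_N A L X \<psi> n N p v =
     Ric A L p v + psi_d2 A L X \<psi> p v - (psi_d1 A L X \<psi> p v)\<^sup>2 / (N - real n)"

definition Ric_infinity ::
  "('m::topological_space, 'd::finite) chart set \<Rightarrow> ('m \<Rightarrow> real^'d \<Rightarrow> real) \<Rightarrow> ('m \<Rightarrow> real^'d) \<Rightarrow>
   ('m \<Rightarrow> real^'d \<Rightarrow> real) \<Rightarrow> 'm \<Rightarrow> real^'d \<Rightarrow> real" where
  "Ric_infinity A L X \<psi> p v = Ric A L p v + psi_d2 A L X \<psi> p v"


section \<open>Covariant derivatives along a curve\<close>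

definition cov_deriv ::
  "('m, 'd::finite) chart set \<Rightarrow> ('m \<Rightarrow> real^'d \<Rightarrow> real) \<Rightarrow> real set \<Rightarrow> (real \<Rightarrow> 'm) \<Rightarrow>
   (real \<Rightarrow> real^'d) \<Rightarrow> real \<Rightarrow> real^'d" where
  "cov_deriv A L I \<eta> Y t =
     (let c = chart_at A (\<eta> t); v = velocity A I \<eta> t in
      derivI I (\<lambda>s. tcoord A c (\<eta> s) (Y s)) t
      + (\<chi> a. \<Sum>b\<in>UNIV. \<Sum>d\<in>UNIV.
            Chris (local_rep A c L) a b d (snd c (\<eta> t)) v * v $ b * Y t $ d))"

text \<open>Endomorphism fields: \<open>E'(P) = E(P)' - E(P')\<close>, evaluated at \<open>w\<close> by means of the vector field
  \<open>P\<close> with \<open>P t = w\<close> that has constant components near \<open>t\<close> in the chart \<open>chart_at A (\<eta> t)\<close> (the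
  value is independent of the choice of \<open>P\<close>).\<close>

definition cov_deriv_endo ::
  "('m, 'd::finite) chart set \<Rightarrow> ('m \<Rightarrow> real^'d \<Rightarrow> real) \<Rightarrow> real set \<Rightarrow> (real \<Rightarrow> 'm) \<Rightarrow>
   (real \<Rightarrow> real^'d \<Rightarrow> real^'d) \<Rightarrow> real \<Rightarrow> real^'d \<Rightarrow> real^'d" where
  "cov_deriv_endo A L I \<eta> E t w =
     (let P = (\<lambda>s. tvec A (chart_at A (\<eta> t)) (\<eta> s) w) in
      cov_deriv A L I \<eta> (\<lambda>s. E s (P s)) t - E t (cov_deriv A L I \<eta> P t))"


section \<open>Lagrange tensor fields\<close>

definition Nspace ::
  "('m, 'd::finite) chart set \<Rightarrow> ('m \<Rightarrow> real^'d \<Rightarrow> real) \<Rightarrow> real set \<Rightarrow> (real \<Rightarrow> 'm) \<Rightarrow> real \<Rightarrow> (real^'d) set"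
where
  "Nspace A L I \<eta> t = (let v = velocity A I \<eta> t in {w. gprod A L (\<eta> t) v v w = 0})"

text \<open>An endomorphism of \<open>Nspace A L I \<eta> t\<close> is represented by its unique linear extension to the whole
  tangent space that annihilates the velocity of \<open>\<eta>\<close>.  Along a geodesic the velocity is parallel and
  the spaces \<open>Nspace A L I \<eta> t\<close> are preserved by parallel transport, so that covariant
  differentiation commutes with this extension.\<close>

definition normal_endo_field ::
  "('m, 'd::finite) chart set \<Rightarrow> ('m \<Rightarrow> real^'d \<Rightarrow> real) \<Rightarrow> real set \<Rightarrow> (real \<Rightarrow> 'm) \<Rightarrow>
   (real \<Rightarrow> real^'d \<Rightarrow> real^'d) \<Rightarrow> bool" where
  "normal_endo_field A L I \<eta> E \<longleftrightarrow>
     (\<forall>t\<in>I. linear (E t) \<and> range (E t) \<subseteq> Nspace A L I \<eta> t \<and> E t (velocity A I \<eta> t) = 0) \<and>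
     (\<forall>c\<in>A. \<forall>w. smooth_on {t\<in>I. \<eta> t \<in> fst c}
                    (\<lambda>t. tcoord A c (\<eta> t) (E t (tvec A c (\<eta> t) w))))"

definition jacobi_tensor_field ::
  "('m, 'd::finite) chart set \<Rightarrow> ('m \<Rightarrow> real^'d \<Rightarrow> real) \<Rightarrow> real set \<Rightarrow> (real \<Rightarrow> 'm) \<Rightarrow>
   (real \<Rightarrow> real^'d \<Rightarrow> real^'d) \<Rightarrow> bool" where
  "jacobi_tensor_field A L I \<eta> J \<longleftrightarrow>
     (let D = cov_deriv_endo A L I \<eta> in
      normal_endo_field A L I \<eta> J \<and>
      (\<forall>t\<in>I. \<forall>w \<in> Nspace A L I \<eta> t.
         D (D J) t w + curv_matrix A L (\<eta> t) (velocity A I \<eta> t) *v J t w = 0) \<and>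
      (\<forall>t\<in>I. {w \<in> Nspace A L I \<eta> t. J t w = 0} \<inter> {w \<in> Nspace A L I \<eta> t. D J t w = 0} = {0}))"

definition transpose_on ::
  "'a set \<Rightarrow> ('a \<Rightarrow> 'a \<Rightarrow> real) \<Rightarrow> ('a \<Rightarrow> 'a) \<Rightarrow> 'a \<Rightarrow> 'a" where
  "transpose_on V g E = (SOME T. (\<forall>u\<in>V. T u \<in> V) \<and> (\<forall>u\<in>V. \<forall>w\<in>V. g (T u) w = g u (E w)))"

definition lagrange_tensor_field ::
  "('m, 'd::finite) chart set \<Rightarrow> ('m \<Rightarrow> real^'d \<Rightarrow> real) \<Rightarrow> real set \<Rightarrow> (real \<Rightarrow> 'm) \<Rightarrow>
   (real \<Rightarrow> real^'d \<Rightarrow> real^'d) \<Rightarrow> bool" where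
  "lagrange_tensor_field A L I \<eta> J \<longleftrightarrow> jacobi_tensor_field A L I \<eta> J \<and>
     (\<forall>t\<in>I. let V = Nspace A L I \<eta> t;
                g = gprod A L (\<eta> t) (velocity A I \<eta> t);
                J' = cov_deriv_endo A L I \<eta> J in
        \<forall>w\<in>V. transpose_on V g (J' t) (J t w) - transpose_on V g (J t) (J' t w) = 0)"

definition nonsingular ::
  "('m, 'd::finite) chart set \<Rightarrow> ('m \<Rightarrow> real^'d \<Rightarrow> real) \<Rightarrow> real set \<Rightarrow> (real \<Rightarrow> 'm) \<Rightarrow>
   (real \<Rightarrow> real^'d \<Rightarrow> real^'d) \<Rightarrow> bool" where
  "nonsingular A L I \<eta> J \<longleftrightarrow> (\<forall>t\<in>I. bij_betw (J t) (Nspace A L I \<eta> t) (Nspace A L I \<eta> t))"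


section \<open>The \<open>\<epsilon>\<close>-quantities\<close>

text \<open>Trace of an endomorphism of a finite-dimensional subspace \<open>V\<close>.\<close>

definition trace_on :: "'a::real_vector set \<Rightarrow> ('a \<Rightarrow> 'a) \<Rightarrow> real" where
  "trace_on V f = (let B = (SOME B. B \<subseteq> V \<and> independent B \<and> V \<subseteq> span B) in
     \<Sum>b\<in>B. representation B (f b) b)"

text \<open>The factor \<open>dt/d\<tau>\<close> turning \<open>t\<close>-derivatives into derivatives with respect to \<open>\<epsilon>\<close>-proper time.\<close>

definition tau_factor ::
  "('m, 'd::finite) chart set \<Rightarrow> ('m \<Rightarrow> real^'d \<Rightarrow> real) \<Rightarrow> nat \<Rightarrow> real \<Rightarrow> real set \<Rightarrow> (real \<Rightarrow> 'm) \<Rightarrow>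
   real \<Rightarrow> real" where
  "tau_factor A \<psi> n \<epsilon> I \<eta> t = exp (2 * (1 - \<epsilon>) / real n * psi_along A \<psi> I \<eta> t)"

definition star_deriv ::
  "('m, 'd::finite) chart set \<Rightarrow> ('m \<Rightarrow> real^'d \<Rightarrow> real) \<Rightarrow> nat \<Rightarrow> real \<Rightarrow> real set \<Rightarrow> (real \<Rightarrow> 'm) \<Rightarrow>
   (real \<Rightarrow> real) \<Rightarrow> real \<Rightarrow> real" where
  "star_deriv A \<psi> n \<epsilon> I \<eta> f t = tau_factor A \<psi> n \<epsilon> I \<eta> t * derivI I f t"

definition star_velocity ::
  "('m, 'd::finite) chart set \<Rightarrow> ('m \<Rightarrow> real^'d \<Rightarrow> real) \<Rightarrow> nat \<Rightarrow> real \<Rightarrow> real set \<Rightarrow> (real \<Rightarrow> 'm) \<Rightarrow>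
   real \<Rightarrow> real^'d" where
  "star_velocity A \<psi> n \<epsilon> I \<eta> t = tau_factor A \<psi> n \<epsilon> I \<eta> t *\<^sub>R velocity A I \<eta> t"

definition J_psi ::
  "('m, 'd::finite) chart set \<Rightarrow> ('m \<Rightarrow> real^'d \<Rightarrow> real) \<Rightarrow> nat \<Rightarrow> real set \<Rightarrow> (real \<Rightarrow> 'm) \<Rightarrow>
   (real \<Rightarrow> real^'d \<Rightarrow> real^'d) \<Rightarrow> real \<Rightarrow> real^'d \<Rightarrow> real^'d" where
  "J_psi A \<psi> n I \<eta> J t w = exp (- psi_along A \<psi> I \<eta> t / real n) *\<^sub>R J t w"

text \<open>The following two endomorphisms are only meaningful on \<open>Nspace A L I \<eta> t\<close>.\<close>

definition B_eps ::
  "('m, 'd::finite) chart set \<Rightarrow> ('m \<Rightarrow> real^'d \<Rightarrow> real) \<Rightarrow> ('m \<Rightarrow> real^'d \<Rightarrow> real) \<Rightarrow> nat \<Rightarrow> real \<Rightarrow>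
   real set \<Rightarrow> (real \<Rightarrow> 'm) \<Rightarrow> (real \<Rightarrow> real^'d \<Rightarrow> real^'d) \<Rightarrow> real \<Rightarrow> real^'d \<Rightarrow> real^'d" where
  "B_eps A L \<psi> n \<epsilon> I \<eta> J t w =
     tau_factor A \<psi> n \<epsilon> I \<eta> t *\<^sub>R
       cov_deriv_endo A L I \<eta> (J_psi A \<psi> n I \<eta> J) t
         (inv_into (Nspace A L I \<eta> t) (J_psi A \<psi> n I \<eta> J t) w)"

definition eps_expansion ::
  "('m, 'd::finite) chart set \<Rightarrow> ('m \<Rightarrow> real^'d \<Rightarrow> real) \<Rightarrow> ('m \<Rightarrow> real^'d \<Rightarrow> real) \<Rightarrow> nat \<Rightarrow> real \<Rightarrow>
   real set \<Rightarrow> (real \<Rightarrow> 'm) \<Rightarrow> (real \<Rightarrow> real^'d \<Rightarrow> real^'d) \<Rightarrow> real \<Rightarrow> real" where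
  "eps_expansion A L \<psi> n \<epsilon> I \<eta> J t = trace_on (Nspace A L I \<eta> t) (B_eps A L \<psi> n \<epsilon> I \<eta> J t)"

definition eps_shear ::
  "('m, 'd::finite) chart set \<Rightarrow> ('m \<Rightarrow> real^'d \<Rightarrow> real) \<Rightarrow> ('m \<Rightarrow> real^'d \<Rightarrow> real) \<Rightarrow> nat \<Rightarrow> real \<Rightarrow>
   real set \<Rightarrow> (real \<Rightarrow> 'm) \<Rightarrow> (real \<Rightarrow> real^'d \<Rightarrow> real^'d) \<Rightarrow> real \<Rightarrow> real^'d \<Rightarrow> real^'d" where
  "eps_shear A L \<psi> n \<epsilon> I \<eta> J t w =
     B_eps A L \<psi> n \<epsilon> I \<eta> J t w - (eps_expansion A L \<psi> n \<epsilon> I \<eta> J t / real n) *\<^sub>R w"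

end

(* Choose a chart near a point of eta and write J as a matrix M(t), the derivative covector of -L at
   the velocity v as a(t), and K = M' + N M - M N with the nonlinear connection N along v.  The
   velocity and a are parallel, a(v) = 1, and K is the matrix of the covariant derivative of J;
   hence M + v a is invertible with the same covariant derivative as M, and differentiating
   B = K (M + v a)^-1 and inserting the Jacobi equation gives the traced Riccati equation
   (tr B)' = - Ric - tr (B B).  The epsilon-quantities are
   theta = tau (tr B - psi') and tr (sigma sigma) = tau^2 (tr (B B) - (tr B)^2 / n), where tau is the
   factor dt/dtau_epsilon, and the three Raychaudhuri equations follow by algebra.

   As the chart used for components varies from point to point, K has to be compared in different
   charts: the contracted Chern connection equals N, and N is the fibre derivative of the spray G,
   whose transformation law follows from the Euler-Lagrange form of G.  The weighted curvature of
   eta* is evaluated along an arbitrarily chosen geodesic; the first two derivatives of psi along it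
   are iterated derivatives along the geodesic vector field, so they depend on the velocity only. *)
theory Submission
  imports Defs
begin

section \<open>Calculus of smooth maps\<close>

text \<open>The equations are proved at one instant \<open>t\<close> in the fixed chart
  \<open>chart_at A (\<eta> t)\<close>. The curvature is then read only in the chart in which it is
  defined, so it needs no transformation law. The first covariant derivative of \<open>J\<close>,
  however, gets differentiated, so it must be known at all instants near \<open>t\<close>, where
  \<open>cov_deriv\<close> may refer to other charts; this is the obstacle that forces the change of
  chart for the connection. The weight is smooth only in the sense of local extensions from the
  closed cone. Timelike vectors form an open set, so near a timelike velocity one extension agrees
  with \<psi> along every future-directed geodesic having that velocity, whichever geodesic the
  definition of the weighted curvature selects. At the instant \<open>t\<close> the vector eta* is a
  multiple \<open>r\<close> of the velocity, hence the initial velocity of the geodesic s \<mapsto>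
  \<eta>(t + r s). The factors r and \<open>r\<^sup>2\<close> in the derivatives of the weight and
  in the curvature come from this reparametrisation, from degree 0 of \<psi> and from degree 2 of
  the curvature.\<close>

abbreviation D :: "('a::euclidean_space \<Rightarrow> 'b::real_normed_vector) \<Rightarrow> 'a \<Rightarrow> 'a \<Rightarrow> 'b" where
  "D f p \<equiv> frechet_derivative f (at p)"

lemma D_has_derivative: "f differentiable (at p) \<Longrightarrow> (f has_derivative D f p) (at p)"
  by (simp add: frechet_derivative_works)

lemma D_eqI: "(f has_derivative f') (at p) \<Longrightarrow> D f p = f'"
  by (rule frechet_derivative_at[symmetric])

lemma D_cong_open:
  assumes "open S" "p \<in> S" "\<And>x. x \<in> S \<Longrightarrow> f x = g x"
  shows "D f p = D g p"
proof -
  have "(f has_derivative f') (at p) \<longleftrightarrow> (g has_derivative f') (at p)" for f'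
    using assms has_derivative_transform_within_open[of f f' p UNIV S g]
      has_derivative_transform_within_open[of g f' p UNIV S f] by auto
  then show ?thesis by (simp add: frechet_derivative_def)
qed

lemma linear_D: "f differentiable (at p) \<Longrightarrow> linear (D f p)"
  by (rule linear_frechet_derivative)

lemma Ck_on_cong:
  assumes "open S" "\<And>x. x \<in> S \<Longrightarrow> f x = g x" "Ck_on k f S"
  shows "Ck_on k g S"
  using assms
proof (induction k arbitrary: f g)
  case 0
  then show ?case by (simp cong: continuous_on_cong)
next
  case (Suc k)
  have "g differentiable (at x)" if "x \<in> S" for x
    using Suc.prems that
    by (metis Ck_on.simps(2) differentiable_def has_derivative_transform_within_open)
  moreover have "Ck_on k (\<lambda>x. D g x v) S" for v
    by (rule Suc.IH[of "\<lambda>x. D f x v"]) (use Suc.prems D_cong_open[of S _ f g] in auto)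
  ultimately show ?case by simp
qed

lemma Ck_on_subset: "Ck_on k f S \<Longrightarrow> T \<subseteq> S \<Longrightarrow> Ck_on k f T"
proof (induction k arbitrary: f)
  case 0
  then show ?case by (simp add: continuous_on_subset[of S f T])
next
  case (Suc k)
  then show ?case by (simp add: subset_iff)
qed

lemma Ck_on_Suc: "Ck_on (Suc k) f S \<Longrightarrow> Ck_on k f S"
proof (induction k arbitrary: f)
  case 0
  then show ?case
    by (simp add: continuous_at_imp_continuous_on differentiable_imp_continuous_within)
next
  case (Suc k)
  then show ?case by (metis Ck_on.simps(2))
qed

lemma Ck_on_local:
  assumes "\<And>x. x \<in> S \<Longrightarrow> \<exists>U. open U \<and> x \<in> U \<and> Ck_on k f U"
  shows "Ck_on k f S"
  using assms
proof (induction k arbitrary: f)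
  case 0
  then show ?case
    by (metis Ck_on.simps(1) continuous_at_imp_continuous_on continuous_on_eq_continuous_at)
next
  case (Suc k)
  then have "f differentiable (at x)" if "x \<in> S" for x
    using that by (metis Ck_on.simps(2))
  moreover have "Ck_on k (\<lambda>x. D f x v) S" for v
    by (rule Suc.IH) (metis Ck_on.simps(2) Suc.prems)
  ultimately show ?case by simp
qed

text \<open>Derivatives are taken in the full space, so this is meant for open sets;
  \<open>smooth_on\<close> is reduced to it through local extensions.\<close>

definition Cinf_on :: "('a::euclidean_space \<Rightarrow> 'b::real_normed_vector) \<Rightarrow> 'a set \<Rightarrow> bool" where
  "Cinf_on f S \<longleftrightarrow> (\<forall>k. Ck_on k f S)"

lemma Cinf_on_cong:
  "open S \<Longrightarrow> (\<And>x. x \<in> S \<Longrightarrow> f x = g x) \<Longrightarrow> Cinf_on f S \<Longrightarrow> Cinf_on g S"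
  unfolding Cinf_on_def using Ck_on_cong by blast

lemma Cinf_on_Suc: "Cinf_on f S \<Longrightarrow> Ck_on (Suc k) f S"
  unfolding Cinf_on_def by (rule spec)

lemma Cinf_on_D: "Cinf_on f S \<Longrightarrow> Cinf_on (\<lambda>x. D f x v) S"
  unfolding Cinf_on_def[of "\<lambda>x. D f x v"] using Cinf_on_Suc[of f S] by simp

lemma Cinf_on_differentiable: "Cinf_on f S \<Longrightarrow> x \<in> S \<Longrightarrow> f differentiable (at x)"
  using Cinf_on_Suc[of f S] by simp

lemma Cinf_on_has_derivative: "Cinf_on f S \<Longrightarrow> x \<in> S \<Longrightarrow> (f has_derivative D f x) (at x)"
  by (simp add: Cinf_on_differentiable D_has_derivative)

lemma Cinf_on_continuous: "Cinf_on f S \<Longrightarrow> continuous_on S f"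
  unfolding Cinf_on_def by (drule spec[of _ 0]) simp

lemma smooth_on_open_iff: "open S \<Longrightarrow> smooth_on S f \<longleftrightarrow> Cinf_on f S"
proof
  assume "open S" and f: "smooth_on S f"
  show "Cinf_on f S"
    unfolding Cinf_on_def
  proof (intro allI Ck_on_local)
    fix k x assume "x \<in> S"
    then obtain U g where U: "open U" "x \<in> U" "\<forall>k. Ck_on k g U" "\<forall>y\<in>U \<inter> S. g y = f y"
      using f unfolding smooth_on_def by blast
    then have "Ck_on k f (U \<inter> S)"
      using Ck_on_cong[of "U \<inter> S" g f k] Ck_on_subset[of k g U "U \<inter> S"] \<open>open S\<close> by auto
    then show "\<exists>U. open U \<and> x \<in> U \<and> Ck_on k f U"
      using U \<open>open S\<close> \<open>x \<in> S\<close> by blast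
  qed
next
  assume "open S" "Cinf_on f S"
  then show "smooth_on S f" unfolding smooth_on_def Cinf_on_def by blast
qed

section \<open>Sums, products, quotients and compositions of smooth maps\<close>

lemma Ck_on_const: "Ck_on k (\<lambda>x. c) S"
proof (induction k arbitrary: c)
  case (Suc k)
  then show ?case by simp
qed simp

lemma Ck_on_bounded_linear:
  assumes "bounded_linear f" shows "Ck_on k f S"
proof (cases k)
  case 0
  then show ?thesis using assms by (simp add: linear_continuous_on)
next
  case (Suc j)
  have d: "(f has_derivative f) (at x)" for x
    using assms by (rule bounded_linear_imp_has_derivative)
  then show ?thesis
    using Suc by (auto simp: differentiable_def D_eqI[OF d] Ck_on_const)
qed

lemma Ck_on_add:
  assumes "open S" "Ck_on k f S" "Ck_on k g S"
  shows "Ck_on k (\<lambda>x. f x + g x) S"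
  using assms
proof (induction k arbitrary: f g)
  case 0
  then show ?case by (simp add: continuous_on_add)
next
  case (Suc k)
  have "Ck_on k (\<lambda>x. D (\<lambda>x. f x + g x) x v) S" for v
  proof (rule Ck_on_cong[OF \<open>open S\<close>])
    show "Ck_on k (\<lambda>x. D f x v + D g x v) S"
      using Suc.prems by (intro Suc.IH) auto
    fix x assume "x \<in> S"
    then have "((\<lambda>x. f x + g x) has_derivative (\<lambda>v. D f x v + D g x v)) (at x)"
      using Suc.prems by (intro has_derivative_add D_has_derivative) auto
    then show "D f x v + D g x v = D (\<lambda>x. f x + g x) x v" by (simp add: D_eqI)
  qed
  then show ?case using Suc.prems by (auto intro: differentiable_add)
qed

lemma Ck_on_bounded_linear_compose:
  assumes "open S" "bounded_linear h" "Ck_on k f S"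
  shows "Ck_on k (\<lambda>x. h (f x)) S"
  using assms(3)
proof (induction k arbitrary: f)
  case 0
  then show ?case using bounded_linear.continuous_on[OF assms(2)] by simp
next
  case (Suc k)
  have d: "((\<lambda>x. h (f x)) has_derivative (\<lambda>v. h (D f x v))) (at x)" if "x \<in> S" for x
    using Suc.prems that by (intro bounded_linear.has_derivative[OF assms(2)] D_has_derivative) auto
  have "Ck_on k (\<lambda>x. D (\<lambda>x. h (f x)) x v) S" for v
  proof (rule Ck_on_cong[OF assms(1)])
    show "Ck_on k (\<lambda>x. h (D f x v)) S"
      using Suc.prems by (intro Suc.IH) simp
    show "h (D f x v) = D (\<lambda>x. h (f x)) x v" if "x \<in> S" for x
      by (simp only: D_eqI[OF d[OF that]])
  qed
  then show ?case using d unfolding Ck_on.simps differentiable_def by blast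
qed

lemma Ck_on_affine_compose:
  assumes "Ck_on k f T" "bounded_linear h" "\<And>x. x \<in> S \<Longrightarrow> h x + a \<in> T" "open S"
  shows "Ck_on k (\<lambda>x. f (h x + a)) S"
  using assms(1)
proof (induction k arbitrary: f)
  case 0
  have "continuous_on S (\<lambda>x. h x + a)"
    using assms(2) by (intro continuous_intros linear_continuous_on)
  then show ?case using 0 assms(3) by (auto intro!: continuous_on_compose2[of T f])
next
  case (Suc k)
  have d: "((\<lambda>x. f (h x + a)) has_derivative (\<lambda>v. D f (h x + a) (h v))) (at x)" if "x \<in> S" for x
  proof -
    have "((\<lambda>x. h x + a) has_derivative h) (at x)"
      using assms(2) by (auto intro!: derivative_eq_intros bounded_linear_imp_has_derivative)
    moreover have "(f has_derivative D f (h x + a)) (at (h x + a))"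
      using Suc.prems assms(3) that by (intro D_has_derivative) auto
    ultimately show ?thesis by (rule has_derivative_compose)
  qed
  have "Ck_on k (\<lambda>x. D (\<lambda>x. f (h x + a)) x v) S" for v
    by (rule Ck_on_cong[OF \<open>open S\<close>, where f = "\<lambda>x. D f (h x + a) (h v)"])
      (use Suc in \<open>auto simp: D_eqI[OF d]\<close>)
  then show ?case using d by (auto simp: differentiable_def)
qed

lemma Ck_on_mult:
  fixes f g :: "'a::euclidean_space \<Rightarrow> real"
  assumes "open S" "Ck_on k f S" "Ck_on k g S"
  shows "Ck_on k (\<lambda>x. f x * g x) S"
  using assms
proof (induction k arbitrary: f g)
  case 0
  then show ?case by (simp add: continuous_on_mult)
next
  case (Suc k)
  have d: "((\<lambda>x. f x * g x) has_derivative (\<lambda>v. f x * D g x v + D f x v * g x)) (at x)"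
    if "x \<in> S" for x
    using Suc.prems that by (intro has_derivative_mult D_has_derivative) auto
  have "Ck_on k (\<lambda>x. D (\<lambda>x. f x * g x) x v) S" for v
  proof (rule Ck_on_cong[OF \<open>open S\<close>])
    show "Ck_on k (\<lambda>x. f x * D g x v + D f x v * g x) S"
      using Suc.prems Suc.prems(2,3)[THEN Ck_on_Suc] by (intro Ck_on_add Suc.IH) auto
  qed (simp add: D_eqI[OF d])
  then show ?case using d by (auto simp: differentiable_def)
qed

lemma Ck_on_inverse:
  fixes f :: "'a::euclidean_space \<Rightarrow> real"
  assumes "open S" "Ck_on k f S" "\<And>x. x \<in> S \<Longrightarrow> f x \<noteq> 0"
  shows "Ck_on k (\<lambda>x. inverse (f x)) S"
  using assms(2)
proof (induction k)
  case 0
  then show ?case using assms by (auto intro: continuous_on_inverse)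
next
  case (Suc k)
  have d: "((\<lambda>x. inverse (f x)) has_derivative
      (\<lambda>v. - (inverse (f x) * D f x v * inverse (f x)))) (at x)" if "x \<in> S" for x
    using Suc.prems that assms(3) by (intro Deriv.has_derivative_inverse D_has_derivative) auto
  \<comment> \<open>The derivative contains the reciprocal again, but only to order
    \<open>k\<close>, where the induction hypothesis applies.\<close>
  have "Ck_on k (\<lambda>x. D (\<lambda>x. inverse (f x)) x v) S" for v
  proof (rule Ck_on_cong[OF \<open>open S\<close>])
    show "Ck_on k (\<lambda>x. (- 1) * (inverse (f x) * D f x v * inverse (f x))) S"
      using Suc assms(1) Ck_on_Suc[OF Suc.prems]
      by (intro Ck_on_mult Ck_on_const) auto
  qed (simp add: D_eqI[OF d])
  then show ?case using d by (auto simp: differentiable_def)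
qed

lemma Cinf_on_const: "Cinf_on (\<lambda>x. c) S"
  by (simp add: Cinf_on_def Ck_on_const)

lemma Cinf_on_bounded_linear: "bounded_linear f \<Longrightarrow> Cinf_on f S"
  by (simp add: Cinf_on_def Ck_on_bounded_linear)

lemma Cinf_on_bounded_linear_compose:
  "open S \<Longrightarrow> bounded_linear h \<Longrightarrow> Cinf_on f S \<Longrightarrow> Cinf_on (\<lambda>x. h (f x)) S"
  unfolding Cinf_on_def using Ck_on_bounded_linear_compose[of S h] by blast

lemma Cinf_on_add:
  "open S \<Longrightarrow> Cinf_on f S \<Longrightarrow> Cinf_on g S \<Longrightarrow> Cinf_on (\<lambda>x. f x + g x) S"
  by (simp add: Cinf_on_def Ck_on_add)

lemma Cinf_on_diff:
  assumes "open S" "Cinf_on f S" "Cinf_on g S" shows "Cinf_on (\<lambda>x. f x - g x) S"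
proof -
  have "Cinf_on (\<lambda>x. - g x) S"
    by (rule Cinf_on_bounded_linear_compose[OF assms(1) _ assms(3)])
      (rule bounded_linear_minus[OF bounded_linear_ident])
  then show ?thesis using Cinf_on_add[OF assms(1,2)] by fastforce
qed

lemma Cinf_on_mult:
  fixes f g :: "'a::euclidean_space \<Rightarrow> real"
  shows "open S \<Longrightarrow> Cinf_on f S \<Longrightarrow> Cinf_on g S \<Longrightarrow> Cinf_on (\<lambda>x. f x * g x) S"
  by (simp add: Cinf_on_def Ck_on_mult)

lemma Cinf_on_divide:
  fixes f g :: "'a::euclidean_space \<Rightarrow> real"
  assumes "open S" "Cinf_on f S" "Cinf_on g S" "\<And>x. x \<in> S \<Longrightarrow> g x \<noteq> 0"
  shows "Cinf_on (\<lambda>x. f x / g x) S"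
  unfolding divide_inverse using assms by (simp add: Cinf_on_def Ck_on_mult Ck_on_inverse)

lemma Cinf_on_sum:
  assumes "open S" "\<And>i. i \<in> K \<Longrightarrow> Cinf_on (f i) S"
  shows "Cinf_on (\<lambda>x. \<Sum>i\<in>K. f i x) S"
  using assms(2)
  by (induction K rule: infinite_finite_induct) (simp_all add: Cinf_on_const Cinf_on_add assms(1))

lemma Cinf_on_prod:
  fixes f :: "'i \<Rightarrow> 'a::euclidean_space \<Rightarrow> real"
  assumes "open S" "\<And>i. i \<in> K \<Longrightarrow> Cinf_on (f i) S"
  shows "Cinf_on (\<lambda>x. \<Prod>i\<in>K. f i x) S"
  using assms(2)
  by (induction K rule: infinite_finite_induct) (simp_all add: Cinf_on_const Cinf_on_mult assms(1))

lemma Cinf_on_det: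
  fixes M :: "'a::euclidean_space \<Rightarrow> real^'d^'d"
  assumes "open S" "\<And>i j. Cinf_on (\<lambda>x. M x $ i $ j) S"
  shows "Cinf_on (\<lambda>x. det (M x)) S"
  unfolding det_def by (intro Cinf_on_sum Cinf_on_mult Cinf_on_const Cinf_on_prod assms)

section \<open>Cramer's rule, smooth matrix inverses and symmetry of second derivatives\<close>

lemma matrix_inv_right_left:
  fixes M :: "real^'d^'d"
  assumes "invertible M"
  shows "M ** matrix_inv M = mat 1" "matrix_inv M ** M = mat 1"
  using someI_ex[OF assms[unfolded invertible_def]] unfolding matrix_inv_def by auto

text \<open>Quotients of determinants are smooth in the entries; this is how smoothness of the
  inverse metric is obtained.\<close>

lemma matrix_inv_cramer:
  fixes M :: "real^'d^'d"
  assumes "invertible M"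
  shows "matrix_inv M $ a $ b = det (\<chi> i j. if j = a then axis b 1 $ i else M $ i $ j) / det M"
proof -
  have "M *v (matrix_inv M *v axis b 1) = axis b 1"
    by (simp only: matrix_vector_mul_assoc matrix_inv_right_left(1)[OF assms] matrix_vector_mul_lid)
  then have "matrix_inv M *v axis b 1
      = (\<chi> k. det (\<chi> i j. if j = k then axis b 1 $ i else M $ i $ j) / det M)"
    using assms cramer invertible_det_nz by blast
  then have "(matrix_inv M *v axis b 1) $ a
      = det (\<chi> i j. if j = a then axis b 1 $ i else M $ i $ j) / det M"
    by simp
  then show ?thesis by (simp add: matrix_vector_mult_basis column_def)
qed

lemma Cinf_on_matrix_inv:
  fixes M :: "'a::euclidean_space \<Rightarrow> real^'d^'d"
  assumes "open S" "\<And>i j. Cinf_on (\<lambda>x. M x $ i $ j) S" "\<And>x. x \<in> S \<Longrightarrow> invertible (M x)"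
  shows "Cinf_on (\<lambda>x. matrix_inv (M x) $ a $ b) S"
proof (rule Cinf_on_cong[OF assms(1)])
  show "Cinf_on (\<lambda>x. det (\<chi> i j. if j = a then axis b 1 $ i else M x $ i $ j) / det (M x)) S"
  proof (intro Cinf_on_divide Cinf_on_det assms(1))
    fix i j
    show "Cinf_on (\<lambda>x. (\<chi> i j. if j = a then axis b 1 $ i else M x $ i $ j) $ i $ j) S"
      using assms(2) by (cases "j = a") (auto intro: Cinf_on_const)
  qed (use assms invertible_det_nz in auto)
qed (simp add: matrix_inv_cramer assms(3))

text \<open>Mean value theorem twice: along \<open>u\<close> for the difference across
  \<open>h w\<close>, then along \<open>w\<close>. The second difference is symmetric in
  \<open>u\<close> and \<open>w\<close>, while the right-hand side is one of the two mixed
  derivatives, so comparing both versions for small \<open>h\<close> proves that these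
  agree.\<close>

lemma second_difference:
  fixes f :: "'a::euclidean_space \<Rightarrow> real"
  assumes f: "Cinf_on f S" and "h > 0"
    and S: "\<And>s t. 0 \<le> s \<Longrightarrow> s \<le> h \<Longrightarrow> 0 \<le> t \<Longrightarrow> t \<le> h \<Longrightarrow> x + s *\<^sub>R u + t *\<^sub>R w \<in> S"
  shows "\<exists>s t. 0 \<le> s \<and> s \<le> h \<and> 0 \<le> t \<and> t \<le> h \<and>
    f (x + h *\<^sub>R u + h *\<^sub>R w) - f (x + h *\<^sub>R u) - f (x + h *\<^sub>R w) + f x
      = h * h * D (\<lambda>y. D f y u) (x + s *\<^sub>R u + t *\<^sub>R w) w"
proof -
  have d: "((\<lambda>s. f (x + s *\<^sub>R u + r *\<^sub>R w)) has_real_derivative D f (x + s *\<^sub>R u + r *\<^sub>R w) u) (at s)"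
    if "0 \<le> s" "s \<le> h" "0 \<le> r" "r \<le> h" for s r
  proof -
    have fd: "(f has_derivative D f (x + s *\<^sub>R u + r *\<^sub>R w)) (at (x + s *\<^sub>R u + r *\<^sub>R w))"
      using f S that by (intro Cinf_on_has_derivative) auto
    have "((\<lambda>s. x + s *\<^sub>R u + r *\<^sub>R w) has_derivative (\<lambda>k. k *\<^sub>R u)) (at s)"
      by (auto intro!: derivative_eq_intros)
    from has_derivative_compose[OF this fd]
    show ?thesis
      using linear_D[of f] f S that
      by (simp add: has_field_derivative_def linear_scale Cinf_on_differentiable mult_commute_abs)
  qed
  have 1: "((\<lambda>s. f (x + s *\<^sub>R u + h *\<^sub>R w) - f (x + s *\<^sub>R u)) has_real_derivative
      D f (x + s *\<^sub>R u + h *\<^sub>R w) u - D f (x + s *\<^sub>R u) u) (at s)" if "0 \<le> s" "s \<le> h" for s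
    using DERIV_diff[OF d[of s h] d[of s 0]] \<open>h > 0\<close> that by simp
  obtain s where s: "0 < s" "s < h" and
    eq1: "(f (x + h *\<^sub>R u + h *\<^sub>R w) - f (x + h *\<^sub>R u)) - (f (x + 0 *\<^sub>R u + h *\<^sub>R w) - f (x + 0 *\<^sub>R u))
      = (h - 0) * (D f (x + s *\<^sub>R u + h *\<^sub>R w) u - D f (x + s *\<^sub>R u) u)"
    using MVT2[OF \<open>h > 0\<close> 1] by auto
  have 2: "((\<lambda>t. D f (x + s *\<^sub>R u + t *\<^sub>R w) u) has_real_derivative
      D (\<lambda>y. D f y u) (x + s *\<^sub>R u + t *\<^sub>R w) w) (at t)" if "0 \<le> t" "t \<le> h" for t
  proof -
    have f': "Cinf_on (\<lambda>y. D f y u) S" using f by (rule Cinf_on_D)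
    have fd: "((\<lambda>y. D f y u) has_derivative D (\<lambda>y. D f y u) (x + s *\<^sub>R u + t *\<^sub>R w))
        (at (x + s *\<^sub>R u + t *\<^sub>R w))"
      using f' S that s by (intro Cinf_on_has_derivative) auto
    have "((\<lambda>t. x + s *\<^sub>R u + t *\<^sub>R w) has_derivative (\<lambda>k. k *\<^sub>R w)) (at t)"
      by (auto intro!: derivative_eq_intros)
    from has_derivative_compose[OF this fd]
    show ?thesis
      using linear_D[of "\<lambda>y. D f y u"] f' S that s
      by (simp add: has_field_derivative_def linear_scale Cinf_on_differentiable mult_commute_abs)
  qed
  obtain t where t: "0 < t" "t < h" and
    eq2: "D f (x + s *\<^sub>R u + h *\<^sub>R w) u - D f (x + s *\<^sub>R u + 0 *\<^sub>R w) u
      = (h - 0) * D (\<lambda>y. D f y u) (x + s *\<^sub>R u + t *\<^sub>R w) w"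
    using MVT2[OF \<open>h > 0\<close> 2] by auto
  have "f (x + h *\<^sub>R u + h *\<^sub>R w) - f (x + h *\<^sub>R u) - f (x + h *\<^sub>R w) + f x
      = h * h * D (\<lambda>y. D f y u) (x + s *\<^sub>R u + t *\<^sub>R w) w"
    using eq1 eq2 by simp
  then show ?thesis using s t by (meson less_imp_le)
qed

lemma D_D_commute_real:
  fixes f :: "'a::euclidean_space \<Rightarrow> real"
  assumes "open S" "Cinf_on f S" "x \<in> S"
  shows "D (\<lambda>y. D f y u) x w = D (\<lambda>y. D f y w) x u"
proof -
  define P where "P = (\<lambda>y. D (\<lambda>y. D f y u) y w)"
  define Q where "Q = (\<lambda>y. D (\<lambda>y. D f y w) y u)"
  have "continuous (at x) P" "continuous (at x) Q"
    using assms unfolding P_def Q_def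
    using continuous_on_eq_continuous_at[OF assms(1)] Cinf_on_continuous[OF Cinf_on_D[OF Cinf_on_D]]
    by blast+
  have "\<bar>P x - Q x\<bar> \<le> e" if e: "e > 0" for e
  proof -
    obtain d1 where d1: "d1 > 0" "\<And>y. dist y x < d1 \<Longrightarrow> dist (P y) (P x) < e / 2"
      using \<open>continuous (at x) P\<close> half_gt_zero[OF e] unfolding continuous_at_eps_delta
      by blast
    obtain d2 where d2: "d2 > 0" "\<And>y. dist y x < d2 \<Longrightarrow> dist (Q y) (Q x) < e / 2"
      using \<open>continuous (at x) Q\<close> half_gt_zero[OF e] unfolding continuous_at_eps_delta
      by blast
    obtain d3 where d3: "d3 > 0" "ball x d3 \<subseteq> S"
      using assms openE by blast
    define d where "d = Min {d1, d2, d3}"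
    have d: "d > 0" "d \<le> d1" "d \<le> d2" "d \<le> d3" using d1 d2 d3 by (auto simp: d_def)
    \<comment> \<open>All points \<open>x + s u + t w\<close> with \<open>s\<close> and
      \<open>t\<close> in \<open>[0, h]\<close> then lie within \<open>d\<close> of
      \<open>x\<close>; the summand 1 covers \<open>u = w = 0\<close>.\<close>
    define h where "h = d / (norm u + norm w + 1)"
    have np: "norm u + norm w + 1 > 0" by (smt (verit) norm_ge_zero)
    have "h > 0" using d np by (simp add: h_def)
    have near: "dist (x + s *\<^sub>R a + t *\<^sub>R b) x < d"
      if "0 \<le> s" "s \<le> h" "0 \<le> t" "t \<le> h" "norm a + norm b = norm u + norm w" for s t a b
    proof -
      have "dist (x + s *\<^sub>R a + t *\<^sub>R b) x = norm (s *\<^sub>R a + t *\<^sub>R b)"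
        by (simp add: dist_norm algebra_simps)
      also have "\<dots> \<le> s * norm a + t * norm b"
        using norm_triangle_ineq[of "s *\<^sub>R a" "t *\<^sub>R b"] that by simp
      also have "\<dots> \<le> h * norm a + h * norm b"
        using that by (intro add_mono mult_right_mono) auto
      also have "\<dots> = h * (norm u + norm w)" using that(5) by (simp flip: distrib_left)
      also have "\<dots> < h * (norm u + norm w + 1)" using \<open>h > 0\<close> by simp
      also have "\<dots> = d" using np by (simp add: h_def)
      finally show ?thesis .
    qed
    have inS: "x + s *\<^sub>R a + t *\<^sub>R b \<in> S"
      if "0 \<le> s" "s \<le> h" "0 \<le> t" "t \<le> h" "norm a + norm b = norm u + norm w" for s t a b
      using near[OF that] d d3 by (auto simp: subset_iff dist_commute)
    obtain s t where st: "0 \<le> s" "s \<le> h" "0 \<le> t" "t \<le> h" and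
      1: "f (x + h *\<^sub>R u + h *\<^sub>R w) - f (x + h *\<^sub>R u) - f (x + h *\<^sub>R w) + f x
        = h * h * P (x + s *\<^sub>R u + t *\<^sub>R w)"
      using second_difference[OF assms(2) \<open>h > 0\<close>, of x u w] inS unfolding P_def by blast
    obtain s' t' where st': "0 \<le> s'" "s' \<le> h" "0 \<le> t'" "t' \<le> h" and
      2: "f (x + h *\<^sub>R w + h *\<^sub>R u) - f (x + h *\<^sub>R w) - f (x + h *\<^sub>R u) + f x
        = h * h * Q (x + s' *\<^sub>R w + t' *\<^sub>R u)"
      using second_difference[OF assms(2) \<open>h > 0\<close>, of x w u] inS unfolding Q_def
      by (metis add.commute)
    have "h * h * P (x + s *\<^sub>R u + t *\<^sub>R w) = h * h * Q (x + s' *\<^sub>R w + t' *\<^sub>R u)"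
      using 1 2 by (simp add: algebra_simps)
    then have "P (x + s *\<^sub>R u + t *\<^sub>R w) = Q (x + s' *\<^sub>R w + t' *\<^sub>R u)"
      using \<open>h > 0\<close> by simp
    moreover have "dist (P (x + s *\<^sub>R u + t *\<^sub>R w)) (P x) < e / 2"
      using near[OF st, of u w] d by (intro d1) auto
    moreover have "dist (Q (x + s' *\<^sub>R w + t' *\<^sub>R u)) (Q x) < e / 2"
      using near[OF st', of w u] d by (intro d2) auto
    ultimately show ?thesis unfolding dist_real_def by arith
  qed
  then have "P x = Q x"
    using field_le_epsilon[of "\<bar>P x - Q x\<bar>" 0] by simp
  then show ?thesis by (simp add: P_def Q_def)
qed

lemma D_inner:
  fixes f :: "'a::euclidean_space \<Rightarrow> 'b::euclidean_space"
  assumes "f differentiable (at x)"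
  shows "D (\<lambda>y. f y \<bullet> b) x u = D f x u \<bullet> b"
proof -
  have "((\<lambda>y. f y \<bullet> b) has_derivative (\<lambda>u. D f x u \<bullet> b)) (at x)"
    using D_has_derivative[OF assms] by (rule has_derivative_inner_left)
  then show ?thesis by (simp add: D_eqI)
qed

lemma D_D_commute:
  fixes f :: "'a::euclidean_space \<Rightarrow> 'b::euclidean_space"
  assumes "open S" "Cinf_on f S" "x \<in> S"
  shows "D (\<lambda>y. D f y u) x w = D (\<lambda>y. D f y w) x u"
proof (rule euclidean_eqI)
  fix b :: 'b
  have f: "Cinf_on (\<lambda>y. f y \<bullet> b) S"
    by (rule Cinf_on_bounded_linear_compose[OF assms(1) _ assms(2)]) (rule bounded_linear_inner_left)
  have *: "D (\<lambda>y. D f y u) x w \<bullet> b = D (\<lambda>y. D (\<lambda>y. f y \<bullet> b) y u) x w" for u w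
  proof -
    have "D (\<lambda>y. D f y u) x w \<bullet> b = D (\<lambda>y. D f y u \<bullet> b) x w"
      using assms by (intro D_inner[symmetric] Cinf_on_differentiable[where S = S] Cinf_on_D)
    also have "\<dots> = D (\<lambda>y. D (\<lambda>y. f y \<bullet> b) y u) x w"
      using assms by (intro D_cong_open[THEN fun_cong, of S] D_inner[symmetric] Cinf_on_differentiable)
    finally show ?thesis .
  qed
  show "D (\<lambda>y. D f y u) x w \<bullet> b = D (\<lambda>y. D f y w) x u \<bullet> b"
    unfolding * by (rule D_D_commute_real[OF assms(1) f assms(3)])
qed

text \<open>Linearity in the inner direction is inherited from the outer one by symmetry of second
  derivatives.\<close>

lemma D_D_linear:
  fixes f :: "'a::euclidean_space \<Rightarrow> 'b::euclidean_space"
  assumes "open S" "Cinf_on f S" "x \<in> S"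
  shows "linear (\<lambda>u. D (\<lambda>y. D f y u) x w)"
  using linear_D[OF Cinf_on_differentiable[OF Cinf_on_D[OF assms(2)] assms(3)], of w]
  by (simp add: D_D_commute[OF assms, of _ w])

lemma linear_Basis_expansion:
  assumes "linear F" shows "F (h::'a::euclidean_space) = (\<Sum>b\<in>Basis. (h \<bullet> b) *\<^sub>R F b)"
proof -
  have "F h = F (\<Sum>b\<in>Basis. (h \<bullet> b) *\<^sub>R b)" by (simp add: euclidean_representation)
  then show ?thesis using assms by (simp add: linear_sum linear_scale)
qed

text \<open>Product rule for a derivative evaluated at a moving point in a moving direction.
  Expanding the direction in a basis leaves finitely many fixed directions, for which
  \<open>D f\<close> is an ordinary smooth function.\<close>

lemma has_derivative_D_compose:
  fixes f :: "'a::euclidean_space \<Rightarrow> 'b::euclidean_space"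
  assumes S: "open S" "Cinf_on f S" "p z \<in> S" and z: "z \<in> T"
    and p: "(p has_derivative p') (at z within T)" and h: "(h has_derivative h') (at z within T)"
  shows "((\<lambda>z. D f (p z) (h z)) has_derivative
    (\<lambda>k. D (\<lambda>q. D f q (h z)) (p z) (p' k) + D f (p z) (h' k))) (at z within T)"
proof -
  have Db: "((\<lambda>z. D f (p z) b) has_derivative (\<lambda>k. D (\<lambda>q. D f q b) (p z) (p' k))) (at z within T)" for b
    using p Cinf_on_has_derivative[OF Cinf_on_D[OF S(2)] S(3), of b] by (rule has_derivative_compose)
  have expand: "D f q v = (\<Sum>b\<in>Basis. (v \<bullet> b) *\<^sub>R D f q b)" if "q \<in> S" for q v
    by (rule linear_Basis_expansion[OF linear_D[OF Cinf_on_differentiable[OF S(2) that]]])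
  have expand2: "D (\<lambda>q. D f q v) (p z) u = (\<Sum>b\<in>Basis. (v \<bullet> b) *\<^sub>R D (\<lambda>q. D f q b) (p z) u)" for u v
    by (rule linear_Basis_expansion[OF D_D_linear[OF S]])
  have 1: "((\<lambda>z. \<Sum>b\<in>Basis. (h z \<bullet> b) *\<^sub>R D f (p z) b) has_derivative
     (\<lambda>k. \<Sum>b\<in>Basis. (h z \<bullet> b) *\<^sub>R D (\<lambda>q. D f q b) (p z) (p' k) + (h' k \<bullet> b) *\<^sub>R D f (p z) b))
     (at z within T)"
    by (intro has_derivative_sum has_derivative_scaleR has_derivative_inner_left h Db)
  have 2: "(\<lambda>k. \<Sum>b\<in>Basis. (h z \<bullet> b) *\<^sub>R D (\<lambda>q. D f q b) (p z) (p' k) + (h' k \<bullet> b) *\<^sub>R D f (p z) b)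
      = (\<lambda>k. D (\<lambda>q. D f q (h z)) (p z) (p' k) + D f (p z) (h' k))"
    by (simp add: sum.distrib expand2[of "h z"] expand[OF S(3), of "h' _"])
  \<comment> \<open>The expansion of \<open>D f\<close> holds only on \<open>S\<close>, so the
    transfer is restricted to arguments near \<open>z\<close>.\<close>
  obtain d where d: "d > 0" "\<And>y. y \<in> T \<Longrightarrow> dist y z < d \<Longrightarrow> p y \<in> S"
  proof -
    have "continuous (at z within T) p" using p by (rule has_derivative_continuous)
    then have "eventually (\<lambda>y. p y \<in> S) (at z within T)"
      using S(1,3) by (metis continuous_within topological_tendstoD)
    then show ?thesis using that S(3) unfolding eventually_at by metis
  qed
  show ?thesis
    by (rule has_derivative_transform_within[OF 1[unfolded 2] d(1) z]) (rule expand[OF d(2), symmetric])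
qed

section \<open>Base and fibre partial derivatives; homogeneous functions\<close>

lemma dx_eq_D:
  assumes "case_prod f differentiable (at (x, v))"
  shows "dx b f x v = D (case_prod f) (x, v) (axis b 1, 0)"
proof -
  have "((\<lambda>x'. (x', v)) has_derivative (\<lambda>h. (h, 0))) (at x)"
    by (auto intro!: derivative_eq_intros)
  from has_derivative_compose[OF this D_has_derivative[OF assms]]
  show ?thesis unfolding dx_def by (simp add: D_eqI)
qed

lemma dv_eq_D:
  assumes "case_prod f differentiable (at (x, v))"
  shows "dv b f x v = D (case_prod f) (x, v) (0, axis b 1)"
proof -
  have "((\<lambda>v'. (x, v')) has_derivative (\<lambda>h. (0, h))) (at v)"
    by (auto intro!: derivative_eq_intros)
  from has_derivative_compose[OF this D_has_derivative[OF assms]]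
  show ?thesis unfolding dv_def by (simp add: D_eqI)
qed

lemma Cinf_on_dx:
  assumes "open S" "Cinf_on (case_prod f) S" shows "Cinf_on (case_prod (dx b f)) S"
  by (rule Cinf_on_cong[OF assms(1) _ Cinf_on_D[OF assms(2), of "(axis b 1, 0)"]])
    (auto simp: dx_eq_D Cinf_on_differentiable[OF assms(2)])

lemma Cinf_on_dv:
  assumes "open S" "Cinf_on (case_prod f) S" shows "Cinf_on (case_prod (dv b f)) S"
  by (rule Cinf_on_cong[OF assms(1) _ Cinf_on_D[OF assms(2), of "(0, axis b 1)"]])
    (auto simp: dv_eq_D Cinf_on_differentiable[OF assms(2)])

lemma D_dx:
  assumes "open S" "Cinf_on (case_prod f) S" "p \<in> S"
  shows "D (case_prod (dx b f)) p h = D (\<lambda>q. D (case_prod f) q (axis b 1, 0)) p h"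
  by (rule D_cong_open[OF assms(1,3), THEN fun_cong])
    (auto simp: dx_eq_D Cinf_on_differentiable[OF assms(2)])

lemma D_dv:
  assumes "open S" "Cinf_on (case_prod f) S" "p \<in> S"
  shows "D (case_prod (dv b f)) p h = D (\<lambda>q. D (case_prod f) q (0, axis b 1)) p h"
  by (rule D_cong_open[OF assms(1,3), THEN fun_cong])
    (auto simp: dv_eq_D Cinf_on_differentiable[OF assms(2)])

lemma dv_dv_commute:
  assumes "open S" "Cinf_on (case_prod f) S" "(x, v) \<in> S"
  shows "dv a (dv b f) x v = dv b (dv a f) x v"
  using D_D_commute[OF assms, of "(0, axis b 1)" "(0, axis a 1)"]
  by (simp add: dv_eq_D[OF Cinf_on_differentiable[OF Cinf_on_dv[OF assms(1,2)] assms(3)]] D_dv[OF assms])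

lemma dv_dx_commute:
  assumes "open S" "Cinf_on (case_prod f) S" "(x, v) \<in> S"
  shows "dv a (dx b f) x v = dx b (dv a f) x v"
  using D_D_commute[OF assms, of "(axis b 1, 0)" "(0, axis a 1)"]
  by (simp add: dv_eq_D[OF Cinf_on_differentiable[OF Cinf_on_dx[OF assms(1,2)] assms(3)]] D_dx[OF assms]
      dx_eq_D[OF Cinf_on_differentiable[OF Cinf_on_dv[OF assms(1,2)] assms(3)]] D_dv[OF assms])

lemma linear_axis_expansion:
  fixes F :: "real^'d \<Rightarrow> 'b::real_vector"
  assumes "linear F" shows "F h = (\<Sum>b\<in>UNIV. (h $ b) *\<^sub>R F (axis b 1))"
proof -
  have "F h = F (\<Sum>b\<in>UNIV. (h $ b) *\<^sub>R axis b 1)"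
    using basis_expansion[of h] by (simp add: scalar_mult_eq_scaleR)
  then show ?thesis using assms by (simp add: linear_sum linear_scale)
qed

lemma D_case_prod:
  fixes f :: "real^'d \<Rightarrow> real^'d \<Rightarrow> real"
  assumes "case_prod f differentiable (at (x, v))"
  shows "D (case_prod f) (x, v) (h, k) = (\<Sum>b\<in>UNIV. dx b f x v * h $ b) + (\<Sum>b\<in>UNIV. dv b f x v * k $ b)"
proof -
  have lin: "linear (D (case_prod f) (x, v))" using assms by (rule linear_D)
  have "D (case_prod f) (x, v) (h, k) = D (case_prod f) (x, v) ((h, 0) + (0, k))" by simp
  also have "\<dots> = D (case_prod f) (x, v) (h, 0) + D (case_prod f) (x, v) (0, k)"
    using lin by (rule linear_add)
  also have "D (case_prod f) (x, v) (h, 0) = (\<Sum>b\<in>UNIV. (h $ b) *\<^sub>R D (case_prod f) (x, v) (axis b 1, 0))"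
    by (rule linear_axis_expansion, rule linearI)
      (use linear_add[OF lin, of "(_, 0)" "(_, 0)"] linear_scale[OF lin, of _ "(_, 0)"] in auto)
  also have "D (case_prod f) (x, v) (0, k) = (\<Sum>b\<in>UNIV. (k $ b) *\<^sub>R D (case_prod f) (x, v) (0, axis b 1))"
    by (rule linear_axis_expansion, rule linearI)
      (use linear_add[OF lin, of "(0, _)" "(0, _)"] linear_scale[OF lin, of _ "(0, _)"] in auto)
  finally show ?thesis
    by (simp add: dx_eq_D[OF assms] dv_eq_D[OF assms] mult.commute)
qed

text \<open>Both sides are the derivative of \<open>f (r v)\<close> with respect to \<open>r\<close>
  at \<open>r = 1\<close>.\<close>

lemma Euler_homogeneous:
  fixes f :: "'a::euclidean_space \<Rightarrow> real"
  assumes "f differentiable (at v)" "\<And>r. r > 0 \<Longrightarrow> f (r *\<^sub>R v) = r ^ k * f v"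
  shows "D f v v = real k * f v"
proof -
  have "((\<lambda>r. r *\<^sub>R v) has_derivative (\<lambda>h. h *\<^sub>R v)) (at 1)"
    by (auto intro!: derivative_eq_intros)
  moreover have "(f has_derivative D f v) (at (1 *\<^sub>R v))"
    using assms(1) by (simp add: D_has_derivative)
  ultimately have 1: "((\<lambda>r. f (r *\<^sub>R v)) has_derivative (\<lambda>h. D f v (h *\<^sub>R v))) (at 1)"
    by (rule has_derivative_compose)
  have "((\<lambda>r. r ^ k * f v) has_derivative (\<lambda>h. h * (real k * f v))) (at 1)"
    by (auto intro!: derivative_eq_intros)
  then have "((\<lambda>r. f (r *\<^sub>R v)) has_derivative (\<lambda>h. h * (real k * f v))) (at 1)"
    by (rule has_derivative_transform_within_open[of _ _ _ _ "{0<..}"]) (auto simp: assms(2))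
  from has_derivative_unique[OF 1 this] have "D f v (1 *\<^sub>R v) = 1 * (real k * f v)"
    by (rule fun_cong)
  then show ?thesis by simp
qed

text \<open>Differentiate the homogeneity identity at \<open>v\<close>: the chain rule produces one
  factor \<open>r\<close>, which lowers the degree by one.\<close>

lemma D_homogeneous:
  fixes f :: "'a::euclidean_space \<Rightarrow> real"
  assumes "f differentiable (at v)" "f differentiable (at (r *\<^sub>R v))" "r > 0" "v \<noteq> 0"
    and hom: "\<And>w. w \<noteq> 0 \<Longrightarrow> f (r *\<^sub>R w) = r ^ Suc k * f w"
  shows "D f (r *\<^sub>R v) w = r ^ k * D f v w"
proof -
  have "((\<lambda>w. r *\<^sub>R w) has_derivative (\<lambda>h. r *\<^sub>R h)) (at v)"
    by (auto intro!: derivative_eq_intros)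
  from has_derivative_compose[OF this D_has_derivative[OF assms(2)]]
  have 1: "((\<lambda>w. f (r *\<^sub>R w)) has_derivative (\<lambda>h. D f (r *\<^sub>R v) (r *\<^sub>R h))) (at v)" .
  have "((\<lambda>w. r ^ Suc k * f w) has_derivative (\<lambda>h. r ^ Suc k * D f v h)) (at v)"
    by (intro has_derivative_mult_right D_has_derivative assms)
  then have "((\<lambda>w. f (r *\<^sub>R w)) has_derivative (\<lambda>h. r ^ Suc k * D f v h)) (at v)"
    by (rule has_derivative_transform_within_open[of _ _ _ _ "- {0}"]) (use assms in auto)
  from has_derivative_unique[OF 1 this] have "D f (r *\<^sub>R v) (r *\<^sub>R w) = r ^ Suc k * D f v w"
    by (rule fun_cong)
  moreover have "D f (r *\<^sub>R v) (r *\<^sub>R w) = r * D f (r *\<^sub>R v) w"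
    using linear_scale[OF linear_D[OF assms(2)]] by simp
  ultimately have "r * D f (r *\<^sub>R v) w = r * (r ^ k * D f v w)" by (simp add: mult.assoc)
  then show ?thesis using \<open>r > 0\<close> by simp
qed

section \<open>Derivatives of matrix-valued curves\<close>

lemma bounded_bilinear_matrix_matrix_mult:
  "bounded_bilinear ((**) :: real^'n^'m \<Rightarrow> real^'k^'n \<Rightarrow> real^'k^'m)"
  unfolding bilinear_conv_bounded_bilinear[symmetric] bilinear_def
  by (auto intro!: linearI simp: vec_eq_iff matrix_matrix_mult_def algebra_simps sum.distrib sum_distrib_left)

lemma bounded_bilinear_matrix_vector_mult:
  "bounded_bilinear ((*v) :: real^'n^'m \<Rightarrow> real^'n \<Rightarrow> real^'m)"
  unfolding bilinear_conv_bounded_bilinear[symmetric] bilinear_def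
  by (auto intro!: linearI simp: vec_eq_iff matrix_vector_mult_def algebra_simps sum.distrib sum_distrib_left)

lemma bounded_linear_trace: "bounded_linear (trace :: real^'n^'n \<Rightarrow> real)"
  unfolding linear_conv_bounded_linear[symmetric]
  by (auto intro!: linearI simp: trace_def sum.distrib sum_distrib_left)

lemma has_vector_derivative_vec_lambda:
  fixes f :: "real \<Rightarrow> 'd::finite \<Rightarrow> 'b::euclidean_space"
  assumes "\<And>i. ((\<lambda>s. f s i) has_vector_derivative f' i) (at t within I)"
  shows "((\<lambda>s. \<chi> i. f s i) has_vector_derivative (\<chi> i. f' i)) (at t within I)"
proof -
  have *: "(\<chi> i. g i) = (\<Sum>i\<in>UNIV. axis i (g i))" for g :: "'d \<Rightarrow> 'b"
    by (simp add: vec_eq_iff axis_def if_distrib cong: if_cong)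
  have lin: "bounded_linear (axis i :: 'b \<Rightarrow> 'b^'d)" for i
    unfolding linear_conv_bounded_linear[symmetric]
    by (auto intro!: linearI simp: vec_eq_iff axis_def)
  show ?thesis
    unfolding * by (intro has_vector_derivative_sum bounded_linear.has_vector_derivative[OF lin] assms)
qed

text \<open>Existence is enough: the value is found later by differentiating the product of the
  matrix and its inverse.\<close>

lemma matrix_inv_has_vector_derivative:
  fixes M :: "real \<Rightarrow> real^'d^'d"
  assumes "(M has_vector_derivative M') (at t within I)" "invertible (M t)"
  shows "\<exists>W. ((\<lambda>s. matrix_inv (M s)) has_vector_derivative W) (at t within I)"
proof -
  define S where "S = {A :: real^'d^'d. det A \<noteq> 0}"
  have entries: "Cinf_on (\<lambda>A. A $ i $ j) T" for i j and T :: "(real^'d^'d) set"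
    by (rule Cinf_on_bounded_linear)
      (intro bounded_linear_compose[OF bounded_linear_vec_nth bounded_linear_vec_nth])
  have "open S"
  proof -
    have "continuous_on UNIV (det :: real^'d^'d \<Rightarrow> real)"
      by (rule Cinf_on_continuous, rule Cinf_on_det[where M = "\<lambda>A. A"]) (auto intro: entries)
    then have "open (det -` (- {0}) :: (real^'d^'d) set)"
      by (rule open_vimage[rotated]) auto
    then show ?thesis by (simp add: S_def vimage_def)
  qed
  have "\<exists>w. ((\<lambda>s. matrix_inv (M s) $ a $ b) has_vector_derivative w) (at t within I)" for a b
  proof -
    have "Cinf_on (\<lambda>A. matrix_inv A $ a $ b) S"
      by (rule Cinf_on_matrix_inv[OF \<open>open S\<close>]) (auto intro: entries simp: S_def invertible_det_nz)
    then have "((\<lambda>A. matrix_inv A $ a $ b) has_derivative D (\<lambda>A. matrix_inv A $ a $ b) (M t)) (at (M t))"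
      using assms(2) by (intro Cinf_on_has_derivative) (auto simp: S_def invertible_det_nz)
    from vector_derivative_diff_chain_within[OF assms(1) has_derivative_at_withinI[OF this]]
    show ?thesis unfolding o_def by blast
  qed
  then obtain W where "\<And>a b. ((\<lambda>s. matrix_inv (M s) $ a $ b) has_vector_derivative W a b) (at t within I)"
    by metis
  then have "((\<lambda>s. \<chi> a b. matrix_inv (M s) $ a $ b) has_vector_derivative (\<chi> a b. W a b)) (at t within I)"
    by (intro has_vector_derivative_vec_lambda)
  then show ?thesis by auto
qed

section \<open>Curves defined on intervals\<close>

text \<open>This makes derivatives within \<open>I\<close> unique, end points included.\<close>

lemma proper_interval_not_bot:
  assumes "proper_interval I" "t \<in> I"
  shows "at t within I \<noteq> bot"
proof -
  obtain a b where ab: "a \<in> I" "b \<in> I" "a < b" and "is_interval I"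
    using assms unfolding proper_interval_def by blast
  then have "connected I" by (simp add: is_interval_connected)
  moreover have "I \<noteq> {t}" using ab by auto
  ultimately show ?thesis
    using assms(2) connected_imp_perfect[of I t] trivial_limit_within by blast
qed

lemma derivI_eqI:
  assumes "proper_interval I" "t \<in> I" "(f has_vector_derivative f') (at t within I)"
  shows "derivI I f t = f'"
  unfolding derivI_def
  using vector_derivative_within[OF proper_interval_not_bot[OF assms(1,2)] assms(3)] .

text \<open>Coordinate formulas along a curve hold only while the curve stays in a chart domain,
  which is a relatively open part of \<open>I\<close>.\<close>

lemma has_vector_derivative_cong_openin:
  assumes "openin (top_of_set I) S" "t \<in> S" "\<And>s. s \<in> S \<Longrightarrow> f s = g s"
  shows "(f has_vector_derivative f') (at t within I) \<longleftrightarrow> (g has_vector_derivative f') (at t within I)"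
proof -
  obtain e where e: "e > 0" "ball t e \<inter> I \<subseteq> S"
    using assms(1,2) unfolding openin_contains_ball by blast
  have tI: "t \<in> I" using assms(1,2) openin_imp_subset by blast
  have eq: "f s = g s" if "s \<in> I" "dist s t < e" for s
    using that e assms(3)[of s] by (auto simp: dist_commute subset_iff)
  show ?thesis
    using has_vector_derivative_transform_within[of f f' t I e g]
      has_vector_derivative_transform_within[of g f' t I e f] eq e tI by auto
qed

lemma derivI_cong_openin:
  assumes "openin (top_of_set I) S" "t \<in> S" "\<And>s. s \<in> S \<Longrightarrow> f s = g s"
  shows "derivI I f t = derivI I g t"
proof -
  have "(\<lambda>f'. (f has_vector_derivative f') (at t within I)) = (\<lambda>f'. (g has_vector_derivative f') (at t within I))"
    by (intro ext has_vector_derivative_cong_openin[of I S] assms)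
  then show ?thesis unfolding derivI_def vector_derivative_def by simp
qed

lemma has_vector_derivative_compose_D:
  assumes "f differentiable (at (p t))" "(p has_vector_derivative p') (at t within I)"
  shows "((\<lambda>s. f (p s)) has_vector_derivative D f (p t) p') (at t within I)"
  using vector_derivative_diff_chain_within[OF assms(2) has_derivative_at_withinI[OF D_has_derivative[OF assms(1)]]]
  by (simp add: o_def)

text \<open>A local extension \<open>g\<close> is not unique, but its derivative at points of the
  interval is determined by the values there. Hence \<open>D g y 1\<close> is the derivative within
  \<open>I\<close>, and it is at the same time a smooth local extension of that derivative.\<close>

lemma smooth_on_interval:
  assumes I: "proper_interval I" and S: "openin (top_of_set I) S" and f: "smooth_on S f"
  shows smooth_on_has_vector_derivative:
      "\<And>t. t \<in> S \<Longrightarrow> (f has_vector_derivative derivI I f t) (at t within I)"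
    and smooth_on_derivI: "smooth_on S (derivI I f)"
proof -
  have *: "\<exists>U g. open U \<and> t \<in> U \<and> Cinf_on g U \<and>
      (\<forall>y\<in>U \<inter> S. f y = g y \<and> (f has_vector_derivative D g y 1) (at y within I) \<and> derivI I f y = D g y 1)"
    if tS: "t \<in> S" for t
  proof -
    obtain U g where U: "open U" "t \<in> U" "Cinf_on g U" "\<forall>y\<in>U \<inter> S. g y = f y"
      using f[unfolded smooth_on_def, rule_format, OF tS] unfolding Cinf_on_def by auto
    have "(f has_vector_derivative D g y 1) (at y within I)" if y: "y \<in> U \<inter> S" for y
    proof -
      have "(g has_vector_derivative D g y 1) (at y within I)"
        using has_vector_derivative_compose_D[of g "\<lambda>s. s" y 1 I] U(3) y
        by (simp add: Cinf_on_differentiable)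
      moreover have "openin (top_of_set I) (U \<inter> S)"
        using S U(1) by (metis inf.commute openin_Int_open)
      ultimately show ?thesis
        using has_vector_derivative_cong_openin[of I "U \<inter> S" y g f "D g y 1"] y U(4) by simp
    qed
    then have "\<forall>y\<in>U \<inter> S. f y = g y \<and> (f has_vector_derivative D g y 1) (at y within I) \<and> derivI I f y = D g y 1"
      using U(4) derivI_eqI[OF I, of _ f] openin_imp_subset[OF S] by (simp add: subset_iff)
    then show ?thesis using U by blast
  qed
  show "(f has_vector_derivative derivI I f t) (at t within I)" if "t \<in> S" for t
    using *[OF that] that by auto
  show "smooth_on S (derivI I f)"
    unfolding smooth_on_def
  proof
    fix t assume "t \<in> S"
    then obtain U g where U: "open U" "t \<in> U" "Cinf_on g U" "\<forall>y\<in>U \<inter> S. derivI I f y = D g y 1"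
      using *[of t] by auto
    then show "\<exists>U g. open U \<and> t \<in> U \<and> (\<forall>k. Ck_on k g U) \<and> (\<forall>y\<in>U \<inter> S. g y = derivI I f y)"
      using Cinf_on_D[OF U(3), of 1] unfolding Cinf_on_def
      by (intro exI[of _ U] exI[of _ "\<lambda>y. D g y 1"]) simp
  qed
qed

section \<open>The spray and the nonlinear connection in a chart\<close>

lemma differentiable_fst_section:
  fixes f :: "'a::euclidean_space \<Rightarrow> 'b::euclidean_space \<Rightarrow> 'c::real_normed_vector"
  assumes "case_prod f differentiable (at (x, v))" shows "(\<lambda>x'. f x' v) differentiable (at x)"
proof -
  have "((\<lambda>x'. (x', v)) has_derivative (\<lambda>h. (h, 0))) (at x)"
    by (auto intro!: derivative_eq_intros)
  from has_derivative_compose[OF this D_has_derivative[OF assms]]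
  show ?thesis unfolding differentiable_def by auto
qed

lemma differentiable_snd_section:
  fixes f :: "'a::euclidean_space \<Rightarrow> 'b::euclidean_space \<Rightarrow> 'c::real_normed_vector"
  assumes "case_prod f differentiable (at (x, v))" shows "f x differentiable (at v)"
proof -
  have "((\<lambda>v'. (x, v')) has_derivative (\<lambda>h. (0, h))) (at v)"
    by (auto intro!: derivative_eq_intros)
  from has_derivative_compose[OF this D_has_derivative[OF assms]]
  show ?thesis unfolding differentiable_def by auto
qed

lemma sum_rotate:
  "(\<Sum>a\<in>A. \<Sum>b\<in>B. \<Sum>c\<in>C. F a b c) = (\<Sum>c\<in>C. \<Sum>a\<in>A. \<Sum>b\<in>B. F a b c)"
proof -
  have "(\<Sum>a\<in>A. \<Sum>b\<in>B. \<Sum>c\<in>C. F a b c) = (\<Sum>a\<in>A. \<Sum>c\<in>C. \<Sum>b\<in>B. F a b c)"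
    by (intro sum.cong refl sum.swap)
  also have "\<dots> = (\<Sum>c\<in>C. \<Sum>a\<in>A. \<Sum>b\<in>B. F a b c)"
    by (rule sum.swap)
  finally show ?thesis .
qed

text \<open>The coordinate Lagrangian lives on the slit tangent bundle over \<open>X\<close>.
  Nondegeneracy of the fibre Hessian lets a vector be recovered from its contraction with the
  metric.\<close>

locale finsler_chart =
  fixes l :: "real^'d::finite \<Rightarrow> real^'d \<Rightarrow> real" and X :: "(real^'d) set"
  assumes open_X: "open X"
    and smooth_l: "Cinf_on (case_prod l) (X \<times> (UNIV - {0}))"
    and homogeneous_l: "\<And>x v r. x \<in> X \<Longrightarrow> v \<noteq> 0 \<Longrightarrow> r > 0 \<Longrightarrow> l x (r *\<^sub>R v) = r\<^sup>2 * l x v"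
    and invertible_metric: "\<And>x v. x \<in> X \<Longrightarrow> v \<noteq> 0 \<Longrightarrow> invertible (metric_matrix l x v)"
begin

abbreviation sm :: "(real^'d \<Rightarrow> real^'d \<Rightarrow> real) \<Rightarrow> bool" where
  "sm f \<equiv> Cinf_on (case_prod f) (X \<times> (UNIV - {0}))"

definition homog :: "nat \<Rightarrow> (real^'d \<Rightarrow> real^'d \<Rightarrow> real) \<Rightarrow> bool" where
  "homog k f \<longleftrightarrow> (\<forall>x\<in>X. \<forall>v r. v \<noteq> 0 \<longrightarrow> r > 0 \<longrightarrow> f x (r *\<^sub>R v) = r ^ k * f x v)"

lemma homogD: "homog k f \<Longrightarrow> x \<in> X \<Longrightarrow> v \<noteq> 0 \<Longrightarrow> r > 0 \<Longrightarrow> f x (r *\<^sub>R v) = r ^ k * f x v"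
  unfolding homog_def by blast

lemma open_S: "open (X \<times> (UNIV - {0 :: real^'d}))"
  using open_X by (intro open_Times open_Diff) auto

lemma sm_differentiable: "sm f \<Longrightarrow> x \<in> X \<Longrightarrow> v \<noteq> 0 \<Longrightarrow> case_prod f differentiable (at (x, v))"
  by (rule Cinf_on_differentiable) auto

lemma sm_differentiable_fst: "sm f \<Longrightarrow> x \<in> X \<Longrightarrow> v \<noteq> 0 \<Longrightarrow> (\<lambda>x'. f x' v) differentiable (at x)"
  by (rule differentiable_fst_section) (rule sm_differentiable)

lemma sm_differentiable_snd: "sm f \<Longrightarrow> x \<in> X \<Longrightarrow> v \<noteq> 0 \<Longrightarrow> f x differentiable (at v)"
  by (rule differentiable_snd_section) (rule sm_differentiable)

lemma sm_const: "sm (\<lambda>x v. c)"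
  using Cinf_on_const[of c] by (simp add: case_prod_unfold)

lemma sm_nth: "sm (\<lambda>x v. v $ i)"
  unfolding case_prod_unfold
  by (rule Cinf_on_bounded_linear) (intro bounded_linear_compose[OF bounded_linear_vec_nth bounded_linear_snd])

lemma sm_add: "sm f \<Longrightarrow> sm g \<Longrightarrow> sm (\<lambda>x v. f x v + g x v)"
  using Cinf_on_add[OF open_S, of "case_prod f" "case_prod g"] by (simp add: case_prod_unfold)

lemma sm_diff: "sm f \<Longrightarrow> sm g \<Longrightarrow> sm (\<lambda>x v. f x v - g x v)"
  using Cinf_on_diff[OF open_S, of "case_prod f" "case_prod g"] by (simp add: case_prod_unfold)

lemma sm_mult: "sm f \<Longrightarrow> sm g \<Longrightarrow> sm (\<lambda>x v. f x v * g x v)"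
  using Cinf_on_mult[OF open_S, of "case_prod f" "case_prod g"] by (simp add: case_prod_unfold)

lemma sm_sum: "(\<And>i. i \<in> K \<Longrightarrow> sm (f i)) \<Longrightarrow> sm (\<lambda>x v. \<Sum>i\<in>K. f i x v)"
  using Cinf_on_sum[OF open_S, of K "\<lambda>i. case_prod (f i)"] by (simp add: case_prod_unfold)

lemma sm_dx: "sm f \<Longrightarrow> sm (dx b f)"
  by (rule Cinf_on_dx[OF open_S])

lemma sm_dv: "sm f \<Longrightarrow> sm (dv b f)"
  by (rule Cinf_on_dv[OF open_S])

lemma dx_cong:
  assumes "\<And>x v. x \<in> X \<Longrightarrow> v \<noteq> 0 \<Longrightarrow> f x v = g x v" "x \<in> X" "v \<noteq> 0"
  shows "dx b f x v = dx b g x v"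
  unfolding dx_def by (rule D_cong_open[OF open_X, THEN fun_cong]) (use assms in auto)

lemma dv_cong:
  assumes "\<And>v. v \<noteq> 0 \<Longrightarrow> f x v = g x v" "v \<noteq> 0"
  shows "dv b f x v = dv b g x v"
  unfolding dv_def by (rule D_cong_open[where S = "- {0}", THEN fun_cong]) (use assms in auto)

lemma homog_dv:
  assumes "sm f" "homog (Suc k) f" shows "homog k (dv b f)"
  unfolding homog_def dv_def
  by (intro ballI allI impI D_homogeneous)
    (use assms(1) sm_differentiable_snd homogD[OF assms(2)] in simp_all)

lemma homog_dx:
  assumes "sm f" "homog k f" shows "homog k (dx b f)"
  unfolding homog_def
proof (intro ballI allI impI)
  fix x v :: "real^'d" and r :: real assume *: "x \<in> X" "v \<noteq> 0" "r > 0"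
  have "dx b f x (r *\<^sub>R v) = D (\<lambda>x'. r ^ k * f x' v) x (axis b 1)"
    unfolding dx_def
    by (rule D_cong_open[OF open_X, THEN fun_cong]) (use * assms(2) homogD in auto)
  also have "\<dots> = r ^ k * D (\<lambda>x'. f x' v) x (axis b 1)"
    using has_derivative_mult_right[OF D_has_derivative[OF sm_differentiable_fst[OF assms(1) *(1,2)]], of "r ^ k"]
    by (simp add: D_eqI)
  finally show "dx b f x (r *\<^sub>R v) = r ^ k * dx b f x v" unfolding dx_def .
qed

lemma Euler_dv:
  assumes "sm f" "homog k f" "x \<in> X" "v \<noteq> 0"
  shows "(\<Sum>b\<in>UNIV. dv b f x v * v $ b) = real k * f x v"
proof -
  have d: "f x differentiable (at v)" using assms by (intro sm_differentiable_snd)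
  have "D (f x) v v = real k * f x v"
    using assms by (intro Euler_homogeneous[OF d] homogD)
  moreover have "D (f x) v v = (\<Sum>b\<in>UNIV. (v $ b) *\<^sub>R D (f x) v (axis b 1))"
    by (rule linear_axis_expansion[OF linear_D[OF d]])
  ultimately show ?thesis by (simp add: dv_def mult.commute)
qed

text \<open>Meant for identities supplied by Euler's theorem. The factor \<open>v\<close> is
  constant under a base derivative, whereas a fibre derivative of such an identity has the extra
  term in \<open>dv_contract\<close>.\<close>

lemma dx_contract:
  assumes "\<And>c. sm (f c)" "\<And>x v. x \<in> X \<Longrightarrow> v \<noteq> 0 \<Longrightarrow> (\<Sum>c\<in>UNIV. f c x v * v $ c) = g x v"
    and "x \<in> X" "v \<noteq> 0"
  shows "(\<Sum>c\<in>UNIV. dx b (f c) x v * v $ c) = dx b g x v"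
proof -
  have "((\<lambda>x'. \<Sum>c\<in>UNIV. f c x' v * v $ c) has_derivative
      (\<lambda>h. \<Sum>c\<in>UNIV. D (\<lambda>x'. f c x' v) x h * v $ c)) (at x)"
    by (intro has_derivative_sum has_derivative_mult_left D_has_derivative sm_differentiable_fst assms)
  then have "D (\<lambda>x'. \<Sum>c\<in>UNIV. f c x' v * v $ c) x = (\<lambda>h. \<Sum>c\<in>UNIV. D (\<lambda>x'. f c x' v) x h * v $ c)"
    by (rule D_eqI)
  moreover have "D (\<lambda>x'. \<Sum>c\<in>UNIV. f c x' v * v $ c) x = D (\<lambda>x'. g x' v) x"
    by (rule D_cong_open[OF open_X]) (use assms in auto)
  ultimately show ?thesis unfolding dx_def by metis
qed

lemma dv_contract2:
  assumes "\<And>c. sm (f c)" "\<And>c. sm (h c)" "\<And>v. v \<noteq> 0 \<Longrightarrow> (\<Sum>c\<in>UNIV. f c x v * h c x v) = g x v"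
    and "x \<in> X" "v \<noteq> 0"
  shows "dv b g x v = (\<Sum>c\<in>UNIV. dv b (f c) x v * h c x v) + (\<Sum>c\<in>UNIV. f c x v * dv b (h c) x v)"
proof -
  have "((\<lambda>v. \<Sum>c\<in>UNIV. f c x v * h c x v) has_derivative
      (\<lambda>w. \<Sum>c\<in>UNIV. f c x v * D (h c x) v w + D (f c x) v w * h c x v)) (at v)"
    by (intro has_derivative_sum has_derivative_mult D_has_derivative sm_differentiable_snd assms)
  then have "D (\<lambda>v. \<Sum>c\<in>UNIV. f c x v * h c x v) v
      = (\<lambda>w. \<Sum>c\<in>UNIV. f c x v * D (h c x) v w + D (f c x) v w * h c x v)"
    by (rule D_eqI)
  moreover have "D (\<lambda>v. \<Sum>c\<in>UNIV. f c x v * h c x v) v = D (g x) v"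
    by (rule D_cong_open[where S = "- {0}"]) (use assms in auto)
  ultimately have "D (g x) v = (\<lambda>w. \<Sum>c\<in>UNIV. f c x v * D (h c x) v w + D (f c x) v w * h c x v)"
    by simp
  then show ?thesis unfolding dv_def by (simp add: sum.distrib)
qed

lemma dv_nth: "dv b (\<lambda>x v. v $ c) x (v :: real^'d) = (if b = c then 1 else 0)"
proof -
  have "D (\<lambda>v :: real^'d. v $ c) v = (\<lambda>v. v $ c)"
    by (rule D_eqI, rule bounded_linear_imp_has_derivative) (rule bounded_linear_vec_nth)
  then show ?thesis by (simp add: dv_def axis_def)
qed

lemma dv_contract:
  assumes "\<And>c. sm (f c)" "\<And>v. v \<noteq> 0 \<Longrightarrow> (\<Sum>c\<in>UNIV. f c x v * v $ c) = g x v"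
    and "x \<in> X" "v \<noteq> 0"
  shows "dv b g x v = (\<Sum>c\<in>UNIV. dv b (f c) x v * v $ c) + f b x v"
  using dv_contract2[where f = f and g = g and h = "\<lambda>c x v. v $ c" and b = b and x = x and v = v,
      OF assms(1) sm_nth assms(2-)]
  by (simp add: dv_nth if_distrib cong: if_cong)

lemma dv_scale:
  assumes "sm f" "x \<in> X" "v \<noteq> 0"
  shows "dv b (\<lambda>x v. c * f x v) x v = c * dv b f x v"
  unfolding dv_def
  using D_eqI[OF has_derivative_mult_right[OF D_has_derivative[OF sm_differentiable_snd[OF assms]], of c]]
  by simp

lemma dx_scale:
  assumes "sm f" "x \<in> X" "v \<noteq> 0"
  shows "dx b (\<lambda>x v. c * f x v) x v = c * dx b f x v"
  unfolding dx_def
  using D_eqI[OF has_derivative_mult_right[OF D_has_derivative[OF sm_differentiable_fst[OF assms]], of c]]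
  by simp

lemma dv_sub:
  assumes "sm f" "sm g" "x \<in> X" "v \<noteq> 0"
  shows "dv b (\<lambda>x v. f x v - g x v) x v = dv b f x v - dv b g x v"
  unfolding dv_def
  using D_eqI[OF has_derivative_diff[OF D_has_derivative[OF sm_differentiable_snd[OF assms(1,3,4)]]
    D_has_derivative[OF sm_differentiable_snd[OF assms(2,3,4)]]]]
  by simp

lemma dv_dv: "sm f \<Longrightarrow> x \<in> X \<Longrightarrow> v \<noteq> 0 \<Longrightarrow> dv a (dv b f) x v = dv b (dv a f) x v"
  by (rule dv_dv_commute[OF open_S]) auto

lemma dv_dx: "sm f \<Longrightarrow> x \<in> X \<Longrightarrow> v \<noteq> 0 \<Longrightarrow> dv a (dx b f) x v = dx b (dv a f) x v"
  by (rule dv_dx_commute[OF open_S]) auto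

section \<open>The fundamental tensor and the Euler-Lagrange form of the spray\<close>

lemma metric_eq: "metric l a b = dv a (dv b l)"
  by (intro ext) (simp add: metric_def)

lemma homog_l: "homog 2 l"
  unfolding homog_def using homogeneous_l by simp

lemma sm_metric: "sm (metric l a b)"
  unfolding metric_eq by (intro sm_dv smooth_l)

lemma sm_metric_inv: "sm (metric_inv l a b)"
proof -
  have "Cinf_on (\<lambda>p. matrix_inv (metric_matrix l (fst p) (snd p)) $ a $ b) (X \<times> (UNIV - {0}))"
  proof (rule Cinf_on_matrix_inv[OF open_S])
    fix i j
    show "Cinf_on (\<lambda>p. metric_matrix l (fst p) (snd p) $ i $ j) (X \<times> (UNIV - {0}))"
      using sm_metric[of i j] by (simp add: metric_matrix_def case_prod_unfold)
  qed (auto intro: invertible_metric)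
  then show ?thesis by (simp add: metric_inv_def case_prod_unfold)
qed

lemma sm_Chris_tilde: "sm (Chris_tilde l a b c)"
proof -
  have "sm (\<lambda>x v. 1/2 * (\<Sum>d\<in>UNIV. metric_inv l a d x v *
     (dx b (metric l d c) x v + dx c (metric l b d) x v - dx d (metric l b c) x v)))"
    by (intro sm_mult sm_const sm_sum sm_add sm_diff sm_dx sm_metric sm_metric_inv)
  then show ?thesis by (simp add: Chris_tilde_def[abs_def])
qed

lemma sm_spray: "sm (spray l a)"
proof -
  have "sm (\<lambda>x v. 1/2 * (\<Sum>b\<in>UNIV. \<Sum>c\<in>UNIV. Chris_tilde l a b c x v * v $ b * v $ c))"
    by (intro sm_mult sm_const sm_sum sm_Chris_tilde sm_nth)
  then show ?thesis by (simp add: spray_def[abs_def])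
qed

lemma Nconn_eq: "Nconn l a b = dv b (spray l a)"
  by (intro ext) (simp add: Nconn_def)

lemma sm_Nconn: "sm (Nconn l a b)"
  unfolding Nconn_eq by (intro sm_dv sm_spray)

lemma metric_sym: "x \<in> X \<Longrightarrow> v \<noteq> 0 \<Longrightarrow> metric l a b x v = metric l b a x v"
  unfolding metric_eq by (rule dv_dv[OF smooth_l])

lemma homog_dv_l: "homog 1 (dv a l)"
  using homog_dv[OF smooth_l, of 1] homog_l by (simp add: numeral_2_eq_2)

lemma homog_metric: "homog 0 (metric l a b)"
  unfolding metric_eq using homog_dv[OF sm_dv[OF smooth_l], of 0] homog_dv_l by simp

lemma metric_contract:
  assumes "x \<in> X" "v \<noteq> 0"
  shows "(\<Sum>b\<in>UNIV. metric l b a x v * v $ b) = dv a l x v"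
    and "(\<Sum>b\<in>UNIV. metric l a b x v * v $ b) = dv a l x v"
proof -
  show "(\<Sum>b\<in>UNIV. metric l b a x v * v $ b) = dv a l x v"
    using Euler_dv[OF sm_dv[OF smooth_l] homog_dv_l assms] by (simp add: metric_eq)
  then show "(\<Sum>b\<in>UNIV. metric l a b x v * v $ b) = dv a l x v"
    using metric_sym[OF assms] by simp
qed

lemma Euler_l: "x \<in> X \<Longrightarrow> v \<noteq> 0 \<Longrightarrow> (\<Sum>b\<in>UNIV. dv b l x v * v $ b) = 2 * l x v"
  using Euler_dv[OF smooth_l homog_l] by simp

lemma dx_metric_contract:
  assumes "x \<in> X" "v \<noteq> 0"
  shows "(\<Sum>c\<in>UNIV. dx b (metric l a c) x v * v $ c) = dx b (dv a l) x v"
    and "(\<Sum>c\<in>UNIV. dx b (metric l c a) x v * v $ c) = dx b (dv a l) x v"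
  by (rule dx_contract[OF sm_metric metric_contract(2) assms], assumption+)
    (rule dx_contract[OF sm_metric metric_contract(1) assms], assumption+)

lemma dx_dv_l_contract:
  assumes "x \<in> X" "v \<noteq> 0"
  shows "(\<Sum>c\<in>UNIV. dx b (dv c l) x v * v $ c) = 2 * dx b l x v"
  using dx_contract[of "\<lambda>c. dv c l" "\<lambda>x v. 2 * l x v", OF sm_dv[OF smooth_l] Euler_l assms]
  by (simp add: dx_scale[OF smooth_l assms])

lemma metric_metric_inv:
  assumes "x \<in> X" "v \<noteq> 0"
  shows "(\<Sum>a\<in>UNIV. metric l e a x v * (\<Sum>d\<in>UNIV. metric_inv l a d x v * w d)) = w e"
proof -
  have "metric_matrix l x v *v (matrix_inv (metric_matrix l x v) *v vec_lambda w) = vec_lambda w"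
    by (simp only: matrix_vector_mul_assoc matrix_inv_right_left(1)[OF invertible_metric[OF assms]]
        matrix_vector_mul_lid)
  then have "(metric_matrix l x v *v (matrix_inv (metric_matrix l x v) *v vec_lambda w)) $ e = w e"
    by simp
  then show ?thesis by (simp add: matrix_vector_mult_def metric_matrix_def metric_inv_def)
qed

text \<open>Identities with an upper index are proved after lowering it, where the inverse metric
  inside the spray and the Chern coefficients cancels.\<close>

lemma metric_inj:
  assumes "x \<in> X" "v \<noteq> 0"
    and "\<And>e. (\<Sum>a\<in>UNIV. metric l e a x v * u a) = (\<Sum>a\<in>UNIV. metric l e a x v * w a)"
  shows "u a = w a"
proof -
  have "metric_matrix l x v *v vec_lambda u = metric_matrix l x v *v vec_lambda w"
    using assms(3) by (simp add: vec_eq_iff matrix_vector_mult_def metric_matrix_def)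
  then have "matrix_inv (metric_matrix l x v) *v (metric_matrix l x v *v vec_lambda u)
      = matrix_inv (metric_matrix l x v) *v (metric_matrix l x v *v vec_lambda w)" by simp
  then have "vec_lambda u = (vec_lambda w :: real^'d)"
    by (simp only: matrix_vector_mul_assoc matrix_inv_right_left(2)[OF invertible_metric[OF assms(1,2)]]
        matrix_vector_mul_lid)
  then show ?thesis by (simp add: vec_eq_iff)
qed

lemma metric_Chris_tilde:
  assumes "x \<in> X" "v \<noteq> 0"
  shows "(\<Sum>a\<in>UNIV. metric l e a x v * Chris_tilde l a b c x v)
    = 1/2 * (dx b (metric l e c) x v + dx c (metric l b e) x v - dx e (metric l b c) x v)"
proof -
  have "(\<Sum>a\<in>UNIV. metric l e a x v * Chris_tilde l a b c x v) = (\<Sum>a\<in>UNIV. metric l e a x v *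
    (\<Sum>d\<in>UNIV. metric_inv l a d x v *
      (1/2 * (dx b (metric l d c) x v + dx c (metric l b d) x v - dx d (metric l b c) x v))))"
    unfolding Chris_tilde_def sum_distrib_left by (simp add: mult_ac)
  then show ?thesis by (simp only: metric_metric_inv[OF assms])
qed

lemma metric_Chris_tilde_contract:
  assumes "x \<in> X" "v \<noteq> 0"
  shows "(\<Sum>a\<in>UNIV. metric l e a x v * (\<Sum>b\<in>UNIV. Chris_tilde l a b c x v * v $ b))
    = 1/2 * ((\<Sum>b\<in>UNIV. dx b (metric l e c) x v * v $ b) + dx c (dv e l) x v - dx e (dv c l) x v)"
proof -
  have "(\<Sum>a\<in>UNIV. metric l e a x v * (\<Sum>b\<in>UNIV. Chris_tilde l a b c x v * v $ b))
    = (\<Sum>b\<in>UNIV. (\<Sum>a\<in>UNIV. metric l e a x v * Chris_tilde l a b c x v) * v $ b)"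
    unfolding sum_distrib_left sum_distrib_right by (subst sum.swap) (simp add: mult_ac)
  also have "\<dots> = 1/2 * ((\<Sum>b\<in>UNIV. dx b (metric l e c) x v * v $ b)
      + (\<Sum>b\<in>UNIV. dx c (metric l b e) x v * v $ b) - (\<Sum>b\<in>UNIV. dx e (metric l b c) x v * v $ b))"
    unfolding metric_Chris_tilde[OF assms]
    by (simp add: sum_distrib_left sum.distrib sum_subtractf algebra_simps flip: sum_divide_distrib)
  finally show ?thesis unfolding dx_metric_contract[OF assms] .
qed

text \<open>This is the Euler-Lagrange expression: homogeneity turns the contracted derivatives of
  the metric into derivatives of \<open>dv e l\<close> and of \<open>l\<close>, so two Christoffel
  terms coincide and the third becomes a multiple of \<open>dx e l\<close>. All later facts about
  the spray start from this form.\<close>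

lemma metric_spray:
  assumes "x \<in> X" "v \<noteq> 0"
  shows "(\<Sum>a\<in>UNIV. metric l e a x v * spray l a x v)
    = 1/2 * ((\<Sum>b\<in>UNIV. dx b (dv e l) x v * v $ b) - dx e l x v)"
proof -
  have split: "(\<Sum>c\<in>UNIV. 1/2 * (f c + g c - h c) * v $ c)
      = 1/2 * ((\<Sum>c\<in>UNIV. f c * v $ c) + (\<Sum>c\<in>UNIV. g c * v $ c) - (\<Sum>c\<in>UNIV. h c * v $ c))"
    for f g h :: "'d \<Rightarrow> real"
  proof -
    have "(\<Sum>c\<in>UNIV. 1/2 * (f c + g c - h c) * v $ c)
        = (\<Sum>c\<in>UNIV. 1/2 * (f c * v $ c) + 1/2 * (g c * v $ c) - 1/2 * (h c * v $ c))"
      by (intro sum.cong refl) (simp add: field_simps)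
    then show ?thesis
      by (simp only: sum.distrib sum_subtractf sum_distrib_left distrib_left right_diff_distrib)
  qed
  have swap: "(\<Sum>b\<in>UNIV. (\<Sum>c\<in>UNIV. dx b (metric l e c) x v * v $ c) * v $ b)
      = (\<Sum>c\<in>UNIV. (\<Sum>b\<in>UNIV. dx b (metric l e c) x v * v $ b) * v $ c)"
    unfolding sum_distrib_right by (subst sum.swap) (simp add: mult_ac)
  have "(\<Sum>a\<in>UNIV. metric l e a x v * spray l a x v)
    = 1/2 * (\<Sum>c\<in>UNIV. (\<Sum>a\<in>UNIV. metric l e a x v * (\<Sum>b\<in>UNIV. Chris_tilde l a b c x v * v $ b)) * v $ c)"
    unfolding spray_def sum_distrib_left sum_distrib_right
    by (subst sum_rotate) (simp add: mult_ac)
  also have "\<dots> = 1/2 * (1/2 * ((\<Sum>b\<in>UNIV. (\<Sum>c\<in>UNIV. dx b (metric l e c) x v * v $ c) * v $ b)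
      + (\<Sum>c\<in>UNIV. dx c (dv e l) x v * v $ c) - (\<Sum>c\<in>UNIV. dx e (dv c l) x v * v $ c)))"
    unfolding metric_Chris_tilde_contract[OF assms] split swap ..
  also have "\<dots> = 1/2 * ((\<Sum>b\<in>UNIV. dx b (dv e l) x v * v $ b) - dx e l x v)"
    unfolding dx_metric_contract[OF assms] dx_dv_l_contract[OF assms] by simp
  finally show ?thesis .
qed

section \<open>Homogeneity of the spray, the nonlinear connection and the curvature\<close>

lemma homog_metric_inv: "homog 0 (metric_inv l a b)"
  unfolding homog_def metric_inv_def metric_matrix_def using homogD[OF homog_metric] by simp

lemma homog_Chris_tilde: "homog 0 (Chris_tilde l a b c)"
  unfolding homog_def Chris_tilde_def
  using homogD[OF homog_metric_inv] homogD[OF homog_dx[OF sm_metric homog_metric]] by simp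

lemma homog_spray: "homog 2 (spray l a)"
  unfolding homog_def spray_def
  by (simp add: homogD[OF homog_Chris_tilde] sum_distrib_left power2_eq_square mult_ac)

lemma homog_Nconn: "homog 1 (Nconn l a b)"
  unfolding Nconn_eq using homog_dv[OF sm_spray, of 1] homog_spray by (simp add: numeral_2_eq_2)

text \<open>Each summand has degree 2: the spray has degree 2, \<open>Nconn\<close> degree 1 and its
  fibre derivatives degree 0. This scales the Ricci curvature from the velocity to eta*.\<close>

lemma curv_homogeneous:
  assumes "x \<in> X" "v \<noteq> 0" "r > 0"
  shows "curv l a b x (r *\<^sub>R v) = r\<^sup>2 * curv l a b x v"
proof -
  have 1: "homog 0 (dv c (Nconn l a b))" for c
    using homog_dv[OF sm_Nconn, of 0] homog_Nconn by simp
  show ?thesis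
    unfolding curv_def
    by (simp add: homogD[OF homog_dx[OF sm_spray homog_spray] assms]
        homogD[OF homog_dx[OF sm_Nconn homog_Nconn] assms] homogD[OF homog_spray assms]
        homogD[OF homog_Nconn assms] homogD[OF 1 assms]
        sum_distrib_left sum_subtractf algebra_simps power2_eq_square)
qed

lemma Nconn_contract:
  assumes "x \<in> X" "v \<noteq> 0" shows "(\<Sum>b\<in>UNIV. Nconn l a b x v * v $ b) = 2 * spray l a x v"
  using Euler_dv[OF sm_spray homog_spray assms] by (simp add: Nconn_eq)

text \<open>Euler's theorem turns every contracted derivative of \<open>Nconn\<close> back into the
  spray or \<open>Nconn\<close>, and the results cancel. Because of this the trace over the normal
  space that arises from the Jacobi equation is the full trace \<open>Ric\<close>.\<close>

lemma curv_contract: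
  assumes "x \<in> X" "v \<noteq> 0" shows "(\<Sum>b\<in>UNIV. curv l a b x v * v $ b) = 0"
proof -
  have dxN: "(\<Sum>b\<in>UNIV. dx c (Nconn l a b) x v * v $ b) = 2 * dx c (spray l a) x v" for c
    using dx_contract[where f = "Nconn l a" and g = "\<lambda>x v. 2 * spray l a x v", OF sm_Nconn Nconn_contract assms]
    by (simp add: dx_scale[OF sm_spray assms])
  have dvN: "(\<Sum>b\<in>UNIV. dv c (Nconn l a b) x v * v $ b) = Nconn l a c x v" for c
    using dv_contract[where f = "Nconn l a" and g = "\<lambda>x v. 2 * spray l a x v" and b = c,
        OF sm_Nconn Nconn_contract[OF assms(1)] assms]
    by (simp add: dv_scale[OF sm_spray assms] Nconn_eq)
  have "(\<Sum>b\<in>UNIV. curv l a b x v * v $ b) = 2 * (\<Sum>b\<in>UNIV. dx b (spray l a) x v * v $ b)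
     - ((\<Sum>b\<in>UNIV. \<Sum>c\<in>UNIV. dx c (Nconn l a b) x v * v $ c * v $ b)
        - 2 * (\<Sum>b\<in>UNIV. \<Sum>c\<in>UNIV. dv c (Nconn l a b) x v * spray l c x v * v $ b))
     - (\<Sum>b\<in>UNIV. \<Sum>c\<in>UNIV. Nconn l a c x v * Nconn l c b x v * v $ b)"
    unfolding curv_def
    by (simp add: sum_distrib_left sum_distrib_right sum.distrib sum_subtractf algebra_simps)
  also have "(\<Sum>b\<in>UNIV. \<Sum>c\<in>UNIV. dx c (Nconn l a b) x v * v $ c * v $ b)
      = (\<Sum>c\<in>UNIV. (\<Sum>b\<in>UNIV. dx c (Nconn l a b) x v * v $ b) * v $ c)"
    unfolding sum_distrib_right by (subst sum.swap) (simp add: mult_ac)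
  also have "\<dots> = 2 * (\<Sum>c\<in>UNIV. dx c (spray l a) x v * v $ c)"
    unfolding dxN by (simp add: sum_distrib_left mult_ac)
  also have "(\<Sum>b\<in>UNIV. \<Sum>c\<in>UNIV. dv c (Nconn l a b) x v * spray l c x v * v $ b)
      = (\<Sum>c\<in>UNIV. (\<Sum>b\<in>UNIV. dv c (Nconn l a b) x v * v $ b) * spray l c x v)"
    unfolding sum_distrib_right by (subst sum.swap) (simp add: mult_ac)
  also have "\<dots> = (\<Sum>c\<in>UNIV. Nconn l a c x v * spray l c x v)"
    unfolding dvN ..
  also have "(\<Sum>b\<in>UNIV. \<Sum>c\<in>UNIV. Nconn l a c x v * Nconn l c b x v * v $ b)
      = (\<Sum>c\<in>UNIV. Nconn l a c x v * (\<Sum>b\<in>UNIV. Nconn l c b x v * v $ b))"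
    unfolding sum_distrib_left by (subst sum.swap) (simp add: mult_ac)
  also have "\<dots> = 2 * (\<Sum>c\<in>UNIV. Nconn l a c x v * spray l c x v)"
    unfolding Nconn_contract[OF assms] by (simp add: sum_distrib_left mult_ac)
  finally show ?thesis by simp
qed

section \<open>The Cartan tensor and the contracted Chern connection\<close>

lemma dv_metric_contract:
  assumes "x \<in> X" "v \<noteq> 0"
  shows "(\<Sum>b\<in>UNIV. dv m (metric l b e) x v * v $ b) = 0"
  using dv_contract[where f = "\<lambda>b. metric l b e" and g = "dv e l" and b = m,
      OF sm_metric metric_contract(1)[OF assms(1)] assms]
  by (simp add: metric_eq)

text \<open>Symmetry of the Cartan tensor, the third fibre derivative of \<open>l\<close>.\<close>

lemma dv_metric_sym:
  assumes "x \<in> X" "v \<noteq> 0"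
  shows "dv m (metric l a b) x v = dv b (metric l a m) x v"
proof -
  have "dv m (metric l a b) x v = dv m (metric l b a) x v"
    using assms metric_sym by (intro dv_cong) auto
  also have "\<dots> = dv b (metric l m a) x v"
    unfolding metric_eq using dv_dv[OF sm_dv[OF smooth_l] assms] .
  also have "\<dots> = dv b (metric l a m) x v"
    using assms metric_sym by (intro dv_cong) auto
  finally show ?thesis .
qed

text \<open>Fibre derivative of \<open>metric_spray\<close>. The product rule on its left side
  yields the lowered \<open>Nconn\<close> together with a Cartan term, and the derivative of its
  right side is the contracted Christoffel expression of
  \<open>metric_Chris_tilde_contract\<close>.\<close>

lemma metric_Nconn:
  assumes "x \<in> X" "v \<noteq> 0"
  shows "(\<Sum>a\<in>UNIV. metric l e a x v * Nconn l a c x v)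
    = (\<Sum>a\<in>UNIV. metric l e a x v * (\<Sum>b\<in>UNIV. Chris_tilde l a b c x v * v $ b))
      - (\<Sum>a\<in>UNIV. dv a (metric l e c) x v * spray l a x v)"
proof -
  let ?g = "\<lambda>x v. 1/2 * ((\<Sum>b\<in>UNIV. dx b (dv e l) x v * v $ b) - dx e l x v)"
  have sm1: "sm (\<lambda>x v. \<Sum>b\<in>UNIV. dx b (dv e l) x v * v $ b)"
    by (intro sm_sum sm_mult sm_nth sm_dx sm_dv smooth_l)
  have e1: "dv c ?g x v = (\<Sum>a\<in>UNIV. dv c (metric l e a) x v * spray l a x v)
      + (\<Sum>a\<in>UNIV. metric l e a x v * dv c (spray l a) x v)"
    using dv_contract2[where f = "\<lambda>a. metric l e a" and h = "spray l" and g = ?g,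
        OF sm_metric sm_spray metric_spray[OF assms(1)] assms] .
  have e2: "dv c ?g x v = 1/2 * (dv c (\<lambda>x v. \<Sum>b\<in>UNIV. dx b (dv e l) x v * v $ b) x v - dv c (dx e l) x v)"
    unfolding dv_scale[OF sm_diff[OF sm1 sm_dx[OF smooth_l]] assms] dv_sub[OF sm1 sm_dx[OF smooth_l] assms] ..
  have e3: "dv c (\<lambda>x v. \<Sum>b\<in>UNIV. dx b (dv e l) x v * v $ b) x v
      = (\<Sum>b\<in>UNIV. dv c (dx b (dv e l)) x v * v $ b) + dx c (dv e l) x v"
    by (rule dv_contract[where f = "\<lambda>b. dx b (dv e l)"])
      (use assms in \<open>auto intro: sm_dx sm_dv smooth_l\<close>)
  have e4: "dv c (dx b (dv e l)) x v = dx b (metric l e c) x v" for b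
  proof -
    have "dv c (dx b (dv e l)) x v = dx b (metric l c e) x v"
      unfolding metric_eq by (rule dv_dx[OF sm_dv[OF smooth_l] assms])
    also have "\<dots> = dx b (metric l e c) x v"
      using metric_sym assms by (intro dx_cong) auto
    finally show ?thesis .
  qed
  have e5: "dv c (dx e l) x v = dx e (dv c l) x v"
    by (rule dv_dx[OF smooth_l assms])
  have e6: "dv c (metric l e a) x v = dv a (metric l e c) x v" for a
    by (rule dv_metric_sym[OF assms])
  have solve: "a = y + z \<Longrightarrow> a = 1/2 * (r - w) \<Longrightarrow> r = u \<Longrightarrow> z = 1/2 * (u - w) - y" for a y z r w u :: real
    by argo
  show ?thesis
    unfolding metric_Chris_tilde_contract[OF assms] Nconn_eq
    by (rule solve[OF e1[unfolded e6] e2[unfolded e5] e3[unfolded e4]])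
qed

text \<open>In two of the three correction terms the Cartan tensor is contracted with
  \<open>v\<close> and vanishes. In the remaining one \<open>Nconn\<close> contracts to twice the
  spray, which is exactly the correction in \<open>metric_Nconn\<close>. Covariant derivatives along
  a curve with its own velocity as reference thus involve \<open>Nconn\<close> alone.\<close>

lemma Chris_contract:
  assumes "x \<in> X" "v \<noteq> 0"
  shows "(\<Sum>b\<in>UNIV. Chris l a b c x v * v $ b) = Nconn l a c x v"
proof (rule metric_inj[OF assms, where u = "\<lambda>a. \<Sum>b\<in>UNIV. Chris l a b c x v * v $ b"
      and w = "\<lambda>a. Nconn l a c x v"])
  fix e
  have *: "(\<Sum>b\<in>UNIV. \<Sum>d\<in>UNIV. \<Sum>m\<in>UNIV. metric_inv l a d x v *
      (dv m (metric l d c) x v * Nconn l m b x v + dv m (metric l b d) x v * Nconn l m c x v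
        - dv m (metric l b c) x v * Nconn l m d x v) * v $ b)
     = (\<Sum>d\<in>UNIV. metric_inv l a d x v * (2 * (\<Sum>m\<in>UNIV. dv m (metric l d c) x v * spray l m x v)))" for a
  proof -
    have "(\<Sum>b\<in>UNIV. \<Sum>d\<in>UNIV. \<Sum>m\<in>UNIV. metric_inv l a d x v *
      (dv m (metric l d c) x v * Nconn l m b x v + dv m (metric l b d) x v * Nconn l m c x v
        - dv m (metric l b c) x v * Nconn l m d x v) * v $ b)
     = (\<Sum>d\<in>UNIV. \<Sum>m\<in>UNIV. \<Sum>b\<in>UNIV. metric_inv l a d x v *
      (dv m (metric l d c) x v * Nconn l m b x v + dv m (metric l b d) x v * Nconn l m c x v
        - dv m (metric l b c) x v * Nconn l m d x v) * v $ b)"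
      by (subst sum_rotate, subst sum_rotate) (rule refl)
    also have "\<dots> = (\<Sum>d\<in>UNIV. \<Sum>m\<in>UNIV. metric_inv l a d x v *
      (dv m (metric l d c) x v * (\<Sum>b\<in>UNIV. Nconn l m b x v * v $ b)
       + (\<Sum>b\<in>UNIV. dv m (metric l b d) x v * v $ b) * Nconn l m c x v
        - (\<Sum>b\<in>UNIV. dv m (metric l b c) x v * v $ b) * Nconn l m d x v))"
      by (simp add: sum_distrib_left sum_distrib_right sum.distrib sum_subtractf algebra_simps)
    also have "\<dots> = (\<Sum>d\<in>UNIV. metric_inv l a d x v * (2 * (\<Sum>m\<in>UNIV. dv m (metric l d c) x v * spray l m x v)))"
      unfolding dv_metric_contract[OF assms] Nconn_contract[OF assms]
      by (simp add: sum_distrib_left algebra_simps)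
    finally show ?thesis .
  qed
  have "(\<Sum>b\<in>UNIV. Chris l a b c x v * v $ b) = (\<Sum>b\<in>UNIV. Chris_tilde l a b c x v * v $ b)
      - (\<Sum>d\<in>UNIV. metric_inv l a d x v * (\<Sum>m\<in>UNIV. dv m (metric l d c) x v * spray l m x v))" for a
  proof -
    have "(\<Sum>b\<in>UNIV. Chris l a b c x v * v $ b) = (\<Sum>b\<in>UNIV. Chris_tilde l a b c x v * v $ b)
      - 1/2 * (\<Sum>b\<in>UNIV. \<Sum>d\<in>UNIV. \<Sum>m\<in>UNIV. metric_inv l a d x v *
      (dv m (metric l d c) x v * Nconn l m b x v + dv m (metric l b d) x v * Nconn l m c x v
        - dv m (metric l b c) x v * Nconn l m d x v) * v $ b)"
      unfolding Chris_def left_diff_distrib sum_subtractf sum_distrib_left sum_distrib_right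
      by (simp only: mult_ac)
    then show ?thesis unfolding * by (simp add: sum_distrib_left mult_ac)
  qed
  then have "(\<Sum>a\<in>UNIV. metric l e a x v * (\<Sum>b\<in>UNIV. Chris l a b c x v * v $ b))
    = (\<Sum>a\<in>UNIV. metric l e a x v * (\<Sum>b\<in>UNIV. Chris_tilde l a b c x v * v $ b))
      - (\<Sum>a\<in>UNIV. metric l e a x v *
          (\<Sum>d\<in>UNIV. metric_inv l a d x v * (\<Sum>m\<in>UNIV. dv m (metric l d c) x v * spray l m x v)))"
    by (simp only: right_diff_distrib sum_subtractf)
  then show "(\<Sum>a\<in>UNIV. metric l e a x v * (\<Sum>b\<in>UNIV. Chris l a b c x v * v $ b))
    = (\<Sum>a\<in>UNIV. metric l e a x v * Nconn l a c x v)"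
    unfolding metric_metric_inv[OF assms] metric_Nconn[OF assms] .
qed

text \<open>The horizontal derivative of \<open>l\<close> vanishes. The auxiliary identity proved
  first says that \<open>l\<close> is conserved along solutions of x'' = - 2 G; its fibre
  derivative, combined with \<open>metric_spray\<close>, gives the claim. It is used to show that
  the covector \<open>cov\<close> is parallel.\<close>

lemma dv_l_Nconn:
  assumes "x \<in> X" "v \<noteq> 0"
  shows "(\<Sum>a\<in>UNIV. dv a l x v * Nconn l a c x v) = dx c l x v"
proof -
  have *: "(\<Sum>a\<in>UNIV. dv a l x v * spray l a x v) = 1/2 * (\<Sum>b\<in>UNIV. dx b l x v * v $ b)" if "v \<noteq> 0" for v
  proof -
    have "(\<Sum>a\<in>UNIV. dv a l x v * spray l a x v)
        = (\<Sum>e\<in>UNIV. (\<Sum>a\<in>UNIV. metric l e a x v * spray l a x v) * v $ e)"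
      unfolding metric_contract(1)[OF assms(1) that, symmetric] sum_distrib_right
      by (subst sum.swap) (simp add: mult_ac)
    also have "\<dots> = 1/2 * ((\<Sum>e\<in>UNIV. (\<Sum>b\<in>UNIV. dx b (dv e l) x v * v $ b) * v $ e)
        - (\<Sum>e\<in>UNIV. dx e l x v * v $ e))"
      unfolding metric_spray[OF assms(1) that]
      by (simp add: sum_subtractf algebra_simps flip: sum_divide_distrib)
    also have "(\<Sum>e\<in>UNIV. (\<Sum>b\<in>UNIV. dx b (dv e l) x v * v $ b) * v $ e)
        = (\<Sum>b\<in>UNIV. (\<Sum>e\<in>UNIV. dx b (dv e l) x v * v $ e) * v $ b)"
      unfolding sum_distrib_right by (subst sum.swap) (simp add: mult_ac)
    also have "\<dots> = 2 * (\<Sum>b\<in>UNIV. dx b l x v * v $ b)"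
      unfolding dx_dv_l_contract[OF assms(1) that] by (simp add: sum_distrib_left mult_ac)
    finally show ?thesis by simp
  qed
  let ?h = "\<lambda>x v. \<Sum>b\<in>UNIV. dx b l x v * v $ b"
  have smh: "sm ?h" by (intro sm_sum sm_mult sm_nth sm_dx smooth_l)
  have e1: "dv c (\<lambda>x v. 1/2 * ?h x v) x v = (\<Sum>a\<in>UNIV. dv c (dv a l) x v * spray l a x v)
      + (\<Sum>a\<in>UNIV. dv a l x v * dv c (spray l a) x v)"
    using dv_contract2[where f = "\<lambda>a. dv a l" and h = "spray l" and g = "\<lambda>x v. 1/2 * ?h x v",
        OF sm_dv[OF smooth_l] sm_spray * assms] .
  have e2: "dv c (\<lambda>x v. 1/2 * ?h x v) x v = 1/2 * dv c ?h x v"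
    by (rule dv_scale[OF smh assms])
  have e3: "dv c ?h x v = (\<Sum>b\<in>UNIV. dv c (dx b l) x v * v $ b) + dx c l x v"
    by (rule dv_contract[where f = "\<lambda>b. dx b l"])
      (use assms in \<open>auto intro: sm_dx smooth_l\<close>)
  have e4: "dv c (dx b l) x v = dx b (dv c l) x v" for b
    by (rule dv_dx[OF smooth_l assms])
  have e5: "(\<Sum>a\<in>UNIV. dv c (dv a l) x v * spray l a x v)
      = 1/2 * ((\<Sum>b\<in>UNIV. dx b (dv c l) x v * v $ b) - dx c l x v)"
    using metric_spray[OF assms, of c] by (simp add: metric_eq)
  have solve: "a = y + z \<Longrightarrow> a = 1/2 * r \<Longrightarrow> r = u + d \<Longrightarrow> y = 1/2 * (u - d) \<Longrightarrow> z = d"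
    for a y z r u d :: real
    by argo
  show ?thesis unfolding Nconn_eq by (rule solve[OF e1 e2 e3[unfolded e4] e5])
qed

end

section \<open>Change of coordinates for the spray and the nonlinear connection\<close>

definition spray_vec :: "(real^'d::finite \<Rightarrow> real^'d \<Rightarrow> real) \<Rightarrow> real^'d \<Rightarrow> real^'d \<Rightarrow> real^'d" where
  "spray_vec l x v = (\<chi> a. spray l a x v)"

definition Nmat :: "(real^'d::finite \<Rightarrow> real^'d \<Rightarrow> real) \<Rightarrow> real^'d \<Rightarrow> real^'d \<Rightarrow> real^'d^'d" where
  "Nmat l x v = (\<chi> a b. Nconn l a b x v)"

context finsler_chart
begin

lemma spray_vec_has_derivative:
  assumes "x \<in> X" "v \<noteq> 0"
  shows "(spray_vec l x has_derivative (\<lambda>w. Nmat l x v *v w)) (at v)"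
proof -
  have "((\<lambda>v. spray l a x v) has_derivative (\<lambda>w. (Nmat l x v *v w) $ a)) (at v)" for a
  proof -
    have d: "spray l a x differentiable (at v)" by (rule sm_differentiable_snd[OF sm_spray assms])
    have "D (spray l a x) v = (\<lambda>w. (Nmat l x v *v w) $ a)"
    proof
      fix w show "D (spray l a x) v w = (Nmat l x v *v w) $ a"
        using linear_axis_expansion[OF linear_D[OF d], of w]
        by (simp add: Nmat_def matrix_vector_mult_def Nconn_def dv_def mult.commute)
    qed
    then show ?thesis using D_has_derivative[OF d] by simp
  qed
  then show ?thesis
    by (subst has_derivative_componentwise_within)
      (auto simp: Basis_vec_def inner_axis spray_vec_def)
qed

lemma D_dv_l:
  assumes "x \<in> X" "v \<noteq> 0"
  shows "D (\<lambda>q. D (case_prod l) q (0, axis e 1)) (x, v) (h, k)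
    = (\<Sum>b\<in>UNIV. dx b (dv e l) x v * h $ b) + (\<Sum>b\<in>UNIV. metric l e b x v * k $ b)"
proof -
  have "D (\<lambda>q. D (case_prod l) q (0, axis e 1)) (x, v) (h, k) = D (case_prod (dv e l)) (x, v) (h, k)"
    using assms by (intro D_dv[OF open_S smooth_l, symmetric]) auto
  also have "\<dots> = (\<Sum>b\<in>UNIV. dx b (dv e l) x v * h $ b) + (\<Sum>b\<in>UNIV. dv b (dv e l) x v * k $ b)"
    by (rule D_case_prod[OF sm_differentiable[OF sm_dv[OF smooth_l] assms]])
  finally show ?thesis using metric_sym[OF assms] by (simp add: metric_eq)
qed

text \<open>The Euler-Lagrange form tested against an arbitrary vector \<open>w\<close> and written
  with total derivatives of \<open>case_prod l\<close>, so that the chain rule for a map of tangent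
  bundles applies directly.\<close>

lemma spray_vec_char:
  assumes "x \<in> X" "v \<noteq> 0"
  shows "D (\<lambda>q. D (case_prod l) q (0, w)) (x, v) (0, 2 *\<^sub>R spray_vec l x v)
    = D (\<lambda>q. D (case_prod l) q (0, w)) (x, v) (v, 0) - D (case_prod l) (x, v) (w, 0)"
proof -
  have lin: "linear (\<lambda>w. D (\<lambda>q. D (case_prod l) q (0, w)) (x, v) k)" for k
  proof -
    have "linear (\<lambda>u. D (\<lambda>q. D (case_prod l) q u) (x, v) k)"
      by (rule D_D_linear[OF open_S smooth_l]) (use assms in auto)
    from linear_compose[OF _ this, of "\<lambda>w. (0, w)"] show ?thesis
      by (simp add: o_def linearI)
  qed
  have lin2: "linear (\<lambda>w. D (case_prod l) (x, v) (w, 0))"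
    using linear_compose[OF _ linear_D[OF sm_differentiable[OF smooth_l assms]], of "\<lambda>w. (w, 0)"]
    by (simp add: o_def linearI)
  have eq: "D (\<lambda>q. D (case_prod l) q (0, axis e 1)) (x, v) (0, 2 *\<^sub>R spray_vec l x v)
    = D (\<lambda>q. D (case_prod l) q (0, axis e 1)) (x, v) (v, 0) - D (case_prod l) (x, v) (axis e 1, 0)" for e
  proof -
    have "(\<Sum>b\<in>UNIV. metric l e b x v * (2 *\<^sub>R spray_vec l x v) $ b)
        = 2 * (\<Sum>b\<in>UNIV. metric l e b x v * spray l b x v)"
      by (simp add: spray_vec_def sum_distrib_left mult_ac)
    then show ?thesis
      unfolding D_dv_l[OF assms] D_case_prod[OF sm_differentiable[OF smooth_l assms]] metric_spray[OF assms]
      by (simp add: axis_def if_distrib cong: if_cong)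
  qed
  show ?thesis
    unfolding linear_axis_expansion[OF lin, where h = w] linear_axis_expansion[OF lin2, where h = w]
    by (simp add: eq sum_subtractf right_diff_distrib)
qed

end

text \<open>This is the law under which x'' = - 2 G keeps its form: for y = \<phi>(x) the second
  derivative of y gains the Hessian of \<phi> on the velocity. It is proved without curves, by
  transporting the characterisation \<open>spray_vec_char\<close> between the charts.\<close>

lemma spray_transform:
  fixes \<phi> :: "real^'d \<Rightarrow> real^'d"
  assumes l: "finsler_chart l X" and l': "finsler_chart l' X'"
    and W: "open W" "W \<subseteq> X" "Cinf_on \<phi> W" "\<phi> ` W \<subseteq> X'"
    and inv: "\<And>x. x \<in> W \<Longrightarrow> bij (D \<phi> x)"
    and ll': "\<And>x v. x \<in> W \<Longrightarrow> v \<noteq> 0 \<Longrightarrow> l x v = l' (\<phi> x) (D \<phi> x v)"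
    and xv: "x \<in> W" "v \<noteq> 0"
  shows "D \<phi> x (2 *\<^sub>R spray_vec l x v)
    = 2 *\<^sub>R spray_vec l' (\<phi> x) (D \<phi> x v) + D (\<lambda>y. D \<phi> y v) x v"
proof -
  interpret l: finsler_chart l X by fact
  interpret l': finsler_chart l' X' by fact
  \<comment> \<open>The tangent map of \<phi>; on \<open>V\<close> the Lagrangian \<open>l\<close>
    is the pullback of \<open>l'\<close> under it.\<close>
  define \<Phi> where "\<Phi> = (\<lambda>q. (\<phi> (fst q), D \<phi> (fst q) (snd q)))"
  define V where "V = W \<times> (UNIV - {0 :: real^'d})"
  let ?F = "case_prod l" and ?F' = "case_prod l'"
  let ?S' = "X' \<times> (UNIV - {0 :: real^'d})"
  let ?P = "D \<phi> x"
  have lin: "linear (D \<phi> y)" if "y \<in> W" for y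
    by (rule linear_D[OF Cinf_on_differentiable[OF W(3) that]])
  have nz: "D \<phi> y u \<noteq> 0" if "y \<in> W" "u \<noteq> 0" for y u
    using inv[OF that(1)] lin[OF that(1)] that(2) by (metis bij_def injD linear_0)
  have "open V" unfolding V_def using W(1) by (intro open_Times open_Diff) auto
  have V_S': "\<Phi> q \<in> ?S'" if "q \<in> V" for q
    using that W(4) nz by (auto simp: V_def \<Phi>_def)
  have fd: "(fst has_derivative fst) (at q)" "(snd has_derivative snd) (at q)" for q :: "(real^'d) \<times> (real^'d)"
    by (auto intro!: derivative_eq_intros)
  have d\<Phi>: "(\<Phi> has_derivative (\<lambda>h. (D \<phi> (fst q) (fst h),
      D (\<lambda>y. D \<phi> y (snd q)) (fst q) (fst h) + D \<phi> (fst q) (snd h)))) (at q)" if "q \<in> V" for q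
    unfolding \<Phi>_def
  proof (rule has_derivative_Pair)
    have y: "fst q \<in> W" using that by (auto simp: V_def)
    show "((\<lambda>q. \<phi> (fst q)) has_derivative (\<lambda>h. D \<phi> (fst q) (fst h))) (at q)"
      using has_derivative_compose[OF fd(1) Cinf_on_has_derivative[OF W(3) y]] .
    show "((\<lambda>q. D \<phi> (fst q) (snd q)) has_derivative
      (\<lambda>h. D (\<lambda>y. D \<phi> y (snd q)) (fst q) (fst h) + D \<phi> (fst q) (snd h))) (at q)"
      using has_derivative_D_compose[OF W(1,3) y UNIV_I fd] .
  qed
  have F: "?F q = ?F' (\<Phi> q)" if "q \<in> V" for q
    by (cases q) (use that in \<open>simp add: V_def \<Phi>_def ll'\<close>)
  have DF: "D ?F q h = D ?F' (\<Phi> q) (D \<phi> (fst q) (fst h),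
      D (\<lambda>y. D \<phi> y (snd q)) (fst q) (fst h) + D \<phi> (fst q) (snd h))" if "q \<in> V" for q h
  proof -
    have "D ?F q = D (\<lambda>q. ?F' (\<Phi> q)) q"
      using F by (intro D_cong_open[OF \<open>open V\<close> that])
    also have "\<dots> = (\<lambda>h. D ?F' (\<Phi> q) (D \<phi> (fst q) (fst h),
      D (\<lambda>y. D \<phi> y (snd q)) (fst q) (fst h) + D \<phi> (fst q) (snd h)))"
      by (rule D_eqI[OF has_derivative_compose[OF d\<Phi>[OF that]
        Cinf_on_has_derivative[OF l'.smooth_l V_S'[OF that]]]])
    finally show ?thesis by (rule fun_cong)
  qed
  have p: "(x, v) \<in> V" using xv by (simp add: V_def)
  have \<Phi>p: "\<Phi> (x, v) = (\<phi> x, ?P v)" by (simp add: \<Phi>_def)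
  have DDF: "D (\<lambda>q. D ?F q (0, w)) (x, v) h
      = D (\<lambda>q. D ?F' q (0, ?P w)) (\<phi> x, ?P v) (?P (fst h), D (\<lambda>y. D \<phi> y v) x (fst h) + ?P (snd h))
        + D ?F' (\<phi> x, ?P v) (0, D (\<lambda>y. D \<phi> y w) x (fst h))" for w h
  proof -
    have 1: "D (\<lambda>q. D ?F q (0, w)) (x, v) = D (\<lambda>q. D ?F' (\<Phi> q) (0, D \<phi> (fst q) w)) (x, v)"
    proof (rule D_cong_open[OF \<open>open V\<close> p])
      fix q assume q: "q \<in> V"
      then have "linear (D (\<lambda>y. D \<phi> y (snd q)) (fst q))"
        by (intro linear_D Cinf_on_differentiable[OF Cinf_on_D[OF W(3)]]) (auto simp: V_def)
      then show "D ?F q (0, w) = D ?F' (\<Phi> q) (0, D \<phi> (fst q) w)"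
        using lin[of "fst q"] q by (simp add: DF linear_0 V_def mem_Times_iff)
    qed
    have 2: "((\<lambda>q. (0, D \<phi> (fst q) w)) has_derivative (\<lambda>h. (0, D (\<lambda>y. D \<phi> y w) x (fst h)))) (at (x, v))"
      using has_derivative_compose[OF fd(1)[of "(x, v)"], of "\<lambda>y. D \<phi> y w"]
        Cinf_on_has_derivative[OF Cinf_on_D[OF W(3)] xv(1), of w]
      by (intro has_derivative_Pair has_derivative_const) simp
    show ?thesis
      using D_eqI[OF has_derivative_D_compose[OF l'.open_S l'.smooth_l V_S'[OF p] UNIV_I d\<Phi>[OF p] 2]]
      by (simp add: 1 \<Phi>p)
  qed
  have xX: "x \<in> X" and x'X: "\<phi> x \<in> X'" and Pv: "?P v \<noteq> 0"
    using xv W nz by auto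
  have lin2: "linear (D (\<lambda>y. D \<phi> y u) x)" for u
    by (rule linear_D[OF Cinf_on_differentiable[OF Cinf_on_D[OF W(3)] xv(1)]])
  have eq: "D (\<lambda>q. D ?F' q (0, ?P w)) (\<phi> x, ?P v) (0, ?P (2 *\<^sub>R spray_vec l x v))
    = D (\<lambda>q. D ?F' q (0, ?P w)) (\<phi> x, ?P v) (0, 2 *\<^sub>R spray_vec l' (\<phi> x) (?P v) + D (\<lambda>y. D \<phi> y v) x v)" for w
  proof -
    let ?A = "D (\<lambda>q. D ?F' q (0, ?P w)) (\<phi> x, ?P v)"
    let ?B = "D ?F' (\<phi> x, ?P v)"
    have linA: "linear ?A"
      by (rule linear_D[OF Cinf_on_differentiable[OF Cinf_on_D[OF l'.smooth_l]]]) (use x'X Pv in auto)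
    have linB: "linear ?B"
      by (rule linear_D[OF Cinf_on_differentiable[OF l'.smooth_l]]) (use x'X Pv in auto)
    have split: "f (a, b) = f (a, 0) + f (0, b)" if "linear f" for f :: "(real^'d) \<times> (real^'d) \<Rightarrow> real" and a b
      using linear_add[OF that, of "(a, 0)" "(0, b)"] by simp
    have "?A (0, ?P (2 *\<^sub>R spray_vec l x v)) = ?A (?P v, D (\<lambda>y. D \<phi> y v) x v) + ?B (0, D (\<lambda>y. D \<phi> y w) x v)
       - ?B (?P w, D (\<lambda>y. D \<phi> y v) x w)"
      using l.spray_vec_char[OF xX xv(2), of w] linear_0[OF lin2] linear_0[OF lin[OF xv(1)]] linear_0[OF linB]
      by (simp add: DDF DF[OF p] \<Phi>p flip: zero_prod_def)
    \<comment> \<open>Symmetry of the Hessian cancels the two terms with the first fibre derivative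
      of \<open>l'\<close>; only second derivatives of \<open>l'\<close> in the fibre survive next
      to the expression for the spray of \<open>l'\<close>.\<close>
    also have "D (\<lambda>y. D \<phi> y w) x v = D (\<lambda>y. D \<phi> y v) x w"
      by (rule D_D_commute[OF W(1,3) xv(1)])
    also have "?B (?P w, D (\<lambda>y. D \<phi> y v) x w) = ?B (?P w, 0) + ?B (0, D (\<lambda>y. D \<phi> y v) x w)"
      by (rule split[OF linB])
    also have "?A (?P v, D (\<lambda>y. D \<phi> y v) x v) = ?A (?P v, 0) + ?A (0, D (\<lambda>y. D \<phi> y v) x v)"
      by (rule split[OF linA])
    finally have "?A (0, ?P (2 *\<^sub>R spray_vec l x v))
       = (?A (?P v, 0) - ?B (?P w, 0)) + ?A (0, D (\<lambda>y. D \<phi> y v) x v)" by simp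
    also have "?A (?P v, 0) - ?B (?P w, 0) = ?A (0, 2 *\<^sub>R spray_vec l' (\<phi> x) (?P v))"
      using l'.spray_vec_char[OF x'X Pv, of "?P w"] by simp
    also have "?A (0, 2 *\<^sub>R spray_vec l' (\<phi> x) (?P v)) + ?A (0, D (\<lambda>y. D \<phi> y v) x v)
       = ?A (0, 2 *\<^sub>R spray_vec l' (\<phi> x) (?P v) + D (\<lambda>y. D \<phi> y v) x v)"
      using linear_add[OF linA, of "(0, 2 *\<^sub>R spray_vec l' (\<phi> x) (?P v))" "(0, D (\<lambda>y. D \<phi> y v) x v)"] by simp
    finally show ?thesis .
  qed
  let ?u = "?P (2 *\<^sub>R spray_vec l x v)"
  let ?w = "2 *\<^sub>R spray_vec l' (\<phi> x) (?P v) + D (\<lambda>y. D \<phi> y v) x v"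
  have "(\<Sum>a\<in>UNIV. metric l' e a (\<phi> x) (?P v) * ?u $ a) = (\<Sum>a\<in>UNIV. metric l' e a (\<phi> x) (?P v) * ?w $ a)" for e
  proof -
    \<comment> \<open>\<open>eq\<close> tests only with vectors of the form \<open>?P w\<close>;
      since \<open>?P\<close> is onto, these are all vectors, and nondegeneracy of the metric of
      \<open>l'\<close> concludes.\<close>
    obtain w where w: "?P w = axis e 1" using inv[OF xv(1)] by (metis bij_def surjD)
    from eq[of w] show ?thesis unfolding w l'.D_dv_l[OF x'X Pv] by simp
  qed
  from l'.metric_inj[OF x'X Pv, where u = "\<lambda>a. ?u $ a" and w = "\<lambda>a. ?w $ a", OF this]
  show ?thesis by (simp only: vec_eq_iff) simp
qed

text \<open>Fibre derivative of \<open>spray_transform\<close>. The Hessian term is quadratic in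
  \<open>v\<close>, so its derivative is twice the symmetric bilinear form, and the factor 2
  cancels.\<close>

lemma Nmat_transform:
  fixes \<phi> :: "real^'d \<Rightarrow> real^'d"
  assumes l: "finsler_chart l X" and l': "finsler_chart l' X'"
    and W: "open W" "W \<subseteq> X" "Cinf_on \<phi> W" "\<phi> ` W \<subseteq> X'"
    and inv: "\<And>x. x \<in> W \<Longrightarrow> bij (D \<phi> x)"
    and ll': "\<And>x v. x \<in> W \<Longrightarrow> v \<noteq> 0 \<Longrightarrow> l x v = l' (\<phi> x) (D \<phi> x v)"
    and xv: "x \<in> W" "v \<noteq> 0"
  shows "D \<phi> x (Nmat l x v *v w) = Nmat l' (\<phi> x) (D \<phi> x v) *v D \<phi> x w + D (\<lambda>y. D \<phi> y w) x v"
proof -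
  interpret l: finsler_chart l X by fact
  interpret l': finsler_chart l' X' by fact
  let ?P = "D \<phi> x" and ?B = "\<lambda>u h. D (\<lambda>y. D \<phi> y u) x h"
  have lin: "linear ?P" by (rule linear_D[OF Cinf_on_differentiable[OF W(3) xv(1)]])
  then have blin: "bounded_linear ?P" by (simp add: linear_conv_bounded_linear)
  have Pv: "?P v \<noteq> 0" using inv[OF xv(1)] lin xv(2) by (metis bij_def injD linear_0)
  have xX: "x \<in> X" "\<phi> x \<in> X'" using xv W by auto
  have "bilinear ?B" unfolding bilinear_def
    using D_D_linear[OF W(1,3) xv(1)]
      linear_D[OF Cinf_on_differentiable[OF Cinf_on_D[OF W(3)] xv(1)]] by blast
  then have bB: "bounded_bilinear ?B" by (simp add: bilinear_conv_bounded_bilinear)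
  have 1: "((\<lambda>v. ?P (2 *\<^sub>R spray_vec l x v)) has_derivative (\<lambda>w. ?P (2 *\<^sub>R (Nmat l x v *v w)))) (at v)"
    by (intro bounded_linear.has_derivative[OF blin] has_derivative_scaleR_right
        l.spray_vec_has_derivative xX xv)
  have 2: "((\<lambda>v. 2 *\<^sub>R spray_vec l' (\<phi> x) (?P v) + ?B v v) has_derivative
      (\<lambda>w. 2 *\<^sub>R (Nmat l' (\<phi> x) (?P v) *v ?P w) + (?B v w + ?B w v))) (at v)"
    by (intro has_derivative_add has_derivative_scaleR_right bounded_bilinear.FDERIV[OF bB] has_derivative_ident
        has_derivative_compose[OF bounded_linear_imp_has_derivative[OF blin]]
        l'.spray_vec_has_derivative xX Pv)
  have "((\<lambda>v. ?P (2 *\<^sub>R spray_vec l x v)) has_derivative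
      (\<lambda>w. 2 *\<^sub>R (Nmat l' (\<phi> x) (?P v) *v ?P w) + (?B v w + ?B w v))) (at v)"
    by (rule has_derivative_transform_within_open[OF 2, of "- {0}"])
      (use xv spray_transform[OF l l' W inv ll' xv(1)] in auto)
  from has_derivative_unique[OF 1 this]
  have "?P (2 *\<^sub>R (Nmat l x v *v w)) = 2 *\<^sub>R (Nmat l' (\<phi> x) (?P v) *v ?P w) + (?B v w + ?B w v)"
    by (rule fun_cong)
  then have "2 *\<^sub>R ?P (Nmat l x v *v w) = 2 *\<^sub>R (Nmat l' (\<phi> x) (?P v) *v ?P w + ?B w v)"
    using D_D_commute[OF W(1,3) xv(1), of v w] linear_scale[OF lin, of 2 "Nmat l x v *v w"]
    by (simp add: scaleR_2 algebra_simps)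
  then show ?thesis by simp
qed

section \<open>Change of charts on the manifold\<close>

definition chart_trans :: "('m, 'd::finite) chart \<Rightarrow> ('m, 'd) chart \<Rightarrow> real^'d \<Rightarrow> real^'d" where
  "chart_trans c c' = snd c' \<circ> chart_inv c"

text \<open>\<open>tcoord\<close> and \<open>tvec\<close> are the instances with
  \<open>chart_at A p\<close> at one end, so a single cocycle rule,
  \<open>tangent_trans_trans\<close>, covers all conversions.\<close>

definition tangent_trans :: "('m, 'd::finite) chart \<Rightarrow> ('m, 'd) chart \<Rightarrow> 'm \<Rightarrow> real^'d \<Rightarrow> real^'d" where
  "tangent_trans c c' p = D (chart_trans c c') (snd c p)"

lemma tcoord_eq: "tcoord A c p = tangent_trans (chart_at A p) c p"
  by (intro ext) (simp add: tcoord_def tangent_trans_def chart_trans_def)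

lemma tvec_eq: "tvec A c p = tangent_trans c (chart_at A p) p"
  by (intro ext) (simp add: tvec_def tangent_trans_def chart_trans_def)

locale atlas =
  fixes A :: "('m::topological_space, 'd::finite) chart set"
  assumes smooth_atlas: "smooth_atlas A"
begin

lemma chart_at: "chart_at A p \<in> A" "p \<in> fst (chart_at A p)"
proof -
  have "\<exists>c. c \<in> A \<and> p \<in> fst c" using smooth_atlas unfolding smooth_atlas_def by blast
  from someI_ex[OF this] show "chart_at A p \<in> A" "p \<in> fst (chart_at A p)"
    unfolding chart_at_def by auto
qed

lemma chart:
  assumes "c \<in> A"
  shows open_chart: "open (fst c)" and open_chart_image: "open (chart_image c)"
    and chart_homeo: "homeomorphism (fst c) (chart_image c) (snd c) (chart_inv c)"
  using assms smooth_atlas unfolding smooth_atlas_def is_chart_def by auto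

lemma chart_inv_chart: "c \<in> A \<Longrightarrow> p \<in> fst c \<Longrightarrow> chart_inv c (snd c p) = p"
  using chart_homeo homeomorphism_apply1 by blast

lemma chart_chart_inv: "c \<in> A \<Longrightarrow> x \<in> chart_image c \<Longrightarrow> snd c (chart_inv c x) = x"
  using chart_homeo homeomorphism_apply2 by blast

lemma chart_inv_in: "c \<in> A \<Longrightarrow> x \<in> chart_image c \<Longrightarrow> chart_inv c x \<in> fst c"
  using homeomorphism_image2[OF chart_homeo, of c] by blast

lemma chart_in_image: "p \<in> fst c \<Longrightarrow> snd c p \<in> chart_image c"
  by (simp add: chart_image_def)

lemma open_image_chart:
  assumes "c \<in> A" "open U" shows "open (snd c ` (fst c \<inter> U))"
proof -
  have "snd c ` (fst c \<inter> U) = chart_image c \<inter> chart_inv c -` U"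
  proof (intro subset_antisym subsetI)
    fix x assume "x \<in> snd c ` (fst c \<inter> U)"
    then obtain p where "x = snd c p" "p \<in> fst c" "p \<in> U" by blast
    then show "x \<in> chart_image c \<inter> chart_inv c -` U"
      using chart_inv_chart[OF assms(1)] chart_in_image[of p c] by simp
  next
    fix x assume "x \<in> chart_image c \<inter> chart_inv c -` U"
    then show "x \<in> snd c ` (fst c \<inter> U)"
      using chart_chart_inv[OF assms(1), of x] chart_inv_in[OF assms(1), of x]
      by (intro image_eqI[of _ _ "chart_inv c x"]) simp_all
  qed
  moreover have "open (chart_image c \<inter> chart_inv c -` U)"
    using homeomorphism_cont2[OF chart_homeo[OF assms(1)]] open_chart_image[OF assms(1)] assms(2)
    by (rule continuous_open_preimage)
  ultimately show ?thesis by simp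
qed

lemma Cinf_on_chart_trans:
  assumes "c \<in> A" "c' \<in> A"
  shows "Cinf_on (chart_trans c c') (snd c ` (fst c \<inter> fst c'))"
proof -
  have "smooth_on (snd c ` (fst c \<inter> fst c')) (chart_trans c c')"
    using smooth_atlas assms unfolding smooth_atlas_def chart_trans_def by blast
  then show ?thesis
    using smooth_on_open_iff[OF open_image_chart[OF assms(1) open_chart[OF assms(2)]]] by blast
qed

lemma chart_trans_chart: "c \<in> A \<Longrightarrow> p \<in> fst c \<Longrightarrow> chart_trans c c' (snd c p) = snd c' p"
  by (simp add: chart_trans_def chart_inv_chart)

lemma chart_trans_has_derivative:
  assumes "c \<in> A" "c' \<in> A" "p \<in> fst c" "p \<in> fst c'"
  shows "(chart_trans c c' has_derivative tangent_trans c c' p) (at (snd c p))"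
  unfolding tangent_trans_def
  by (rule Cinf_on_has_derivative[OF Cinf_on_chart_trans[OF assms(1,2)]]) (use assms in auto)

lemma linear_tangent_trans:
  assumes "c \<in> A" "c' \<in> A" "p \<in> fst c" "p \<in> fst c'"
  shows "linear (tangent_trans c c' p)"
  using chart_trans_has_derivative[OF assms] by (rule has_derivative_linear)

lemma tangent_trans_trans:
  assumes c: "c \<in> A" "c' \<in> A" "c'' \<in> A" and p: "p \<in> fst c" "p \<in> fst c'" "p \<in> fst c''"
  shows "tangent_trans c' c'' p (tangent_trans c c' p w) = tangent_trans c c'' p w"
proof -
  let ?U = "snd c ` (fst c \<inter> (fst c' \<inter> fst c''))"
  have U: "open ?U" "snd c p \<in> ?U"
    using p open_image_chart[OF c(1) open_Int[OF open_chart[OF c(2)] open_chart[OF c(3)]]] by auto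
  have "(chart_trans c' c'' has_derivative tangent_trans c' c'' p) (at (chart_trans c c' (snd c p)))"
    using chart_trans_has_derivative[OF c(2,3) p(2,3)] by (simp add: chart_trans_chart c p)
  from has_derivative_compose[OF chart_trans_has_derivative[OF c(1,2) p(1,2)] this]
  have "((\<lambda>x. chart_trans c' c'' (chart_trans c c' x)) has_derivative
      (\<lambda>w. tangent_trans c' c'' p (tangent_trans c c' p w))) (at (snd c p))" .
  then have "(chart_trans c c'' has_derivative
      (\<lambda>w. tangent_trans c' c'' p (tangent_trans c c' p w))) (at (snd c p))"
    by (rule has_derivative_transform_within_open[OF _ U]) (auto simp: chart_trans_chart c)
  then have "D (chart_trans c c'') (snd c p) = (\<lambda>w. tangent_trans c' c'' p (tangent_trans c c' p w))"
    by (rule D_eqI)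
  then show ?thesis by (simp add: tangent_trans_def)
qed

lemma tangent_trans_id:
  assumes "c \<in> A" "p \<in> fst c" shows "tangent_trans c c p w = w"
proof -
  have "((\<lambda>x. x) has_derivative (\<lambda>w. w)) (at (snd c p))" by (rule has_derivative_ident)
  then have "(chart_trans c c has_derivative (\<lambda>w. w)) (at (snd c p))"
    by (rule has_derivative_transform_within_open[OF _ open_chart_image[OF assms(1)]])
      (use assms in \<open>auto simp: chart_in_image chart_trans_def chart_chart_inv\<close>)
  then show ?thesis unfolding tangent_trans_def by (simp add: D_eqI)
qed

lemma tangent_trans_inverse:
  assumes "c \<in> A" "c' \<in> A" "p \<in> fst c" "p \<in> fst c'"
  shows "tangent_trans c' c p (tangent_trans c c' p w) = w"
  using tangent_trans_trans[of c c' c p w] assms by (simp add: tangent_trans_id)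

lemma bij_tangent_trans:
  assumes "c \<in> A" "c' \<in> A" "p \<in> fst c" "p \<in> fst c'"
  shows "bij (tangent_trans c c' p)"
  by (rule bij_betw_byWitness[where f' = "tangent_trans c' c p"])
    (auto simp: tangent_trans_inverse assms)

lemma tcoord_tvec: "c \<in> A \<Longrightarrow> p \<in> fst c \<Longrightarrow> tcoord A c p (tvec A c p w) = w"
  and tvec_tcoord: "c \<in> A \<Longrightarrow> p \<in> fst c \<Longrightarrow> tvec A c p (tcoord A c p w) = w"
  by (simp_all add: tcoord_eq tvec_eq tangent_trans_inverse chart_at)

lemma linear_tcoord: "c \<in> A \<Longrightarrow> p \<in> fst c \<Longrightarrow> linear (tcoord A c p)"
  and linear_tvec: "c \<in> A \<Longrightarrow> p \<in> fst c \<Longrightarrow> linear (tvec A c p)"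
  by (simp_all add: tcoord_eq tvec_eq linear_tangent_trans chart_at)

lemma tcoord_chart_at: "tcoord A (chart_at A p) p w = w" and tvec_chart_at: "tvec A (chart_at A p) p w = w"
  by (simp_all add: tcoord_eq tvec_eq tangent_trans_id chart_at)

lemma tangent_trans_tcoord:
  "c \<in> A \<Longrightarrow> c' \<in> A \<Longrightarrow> p \<in> fst c \<Longrightarrow> p \<in> fst c' \<Longrightarrow> tangent_trans c c' p (tcoord A c p w) = tcoord A c' p w"
  by (simp add: tcoord_eq tangent_trans_trans chart_at)

lemma tvec_tangent_trans:
  "c \<in> A \<Longrightarrow> c' \<in> A \<Longrightarrow> p \<in> fst c \<Longrightarrow> p \<in> fst c' \<Longrightarrow> tvec A c' p (tangent_trans c c' p w) = tvec A c p w"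
  by (simp add: tvec_eq tangent_trans_trans chart_at)

lemma local_rep_chart:
  "c \<in> A \<Longrightarrow> p \<in> fst c \<Longrightarrow> local_rep A c f (snd c p) w = f p (tvec A c p w)"
  by (simp add: local_rep_def chart_inv_chart)

lemma local_rep_trans:
  assumes "c \<in> A" "c' \<in> A" "p \<in> fst c" "p \<in> fst c'"
  shows "local_rep A c' f (snd c' p) (tangent_trans c c' p w) = local_rep A c f (snd c p) w"
  using assms by (simp add: local_rep_chart tvec_tangent_trans)

end

lemma lorentz_signature_invertible:
  fixes g :: "real^'d::finite^'d"
  assumes "lorentz_signature g" shows "invertible g"
proof -
  obtain P :: "real^'d^'d" and k where P: "transpose P ** g ** P = (\<chi> i j. if i \<noteq> j then 0 else if i = k then - 1 else (1::real))"
    using assms unfolding lorentz_signature_def by blast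
  define E :: "real^'d^'d" where "E = (\<chi> i j. if i \<noteq> j then 0 else if i = k then - 1 else 1)"
  have "det E = (\<Prod>i\<in>UNIV. E $ i $ i)"
    by (rule det_diagonal) (simp add: E_def)
  also have "\<dots> \<noteq> 0" by (simp add: E_def)
  finally have "det (transpose P ** g ** P) \<noteq> 0" using P by (simp add: E_def)
  then have "det g \<noteq> 0" by (auto simp: det_mul)
  then show ?thesis by (simp add: invertible_det_nz)
qed

locale lorentz_finsler_manifold = atlas A
  for A :: "('m::topological_space, 'd::finite) chart set" +
  fixes L :: "'m \<Rightarrow> real^'d \<Rightarrow> real"
  assumes lorentz_finsler: "lorentz_finsler A L"
begin

lemma L_homogeneous: "r > 0 \<Longrightarrow> L p (r *\<^sub>R v) = r\<^sup>2 * L p v"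
  using lorentz_finsler unfolding lorentz_finsler_def by blast

lemma finsler_chart:
  assumes c: "c \<in> A" shows "finsler_chart (local_rep A c L) (chart_image c)"
proof
  show "open (chart_image c)" by (rule open_chart_image[OF c])
  then have "open (chart_image c \<times> (UNIV - {0 :: real^'d}))"
    by (intro open_Times open_Diff) auto
  moreover have "smooth_on (chart_image c \<times> (UNIV - {0})) (case_prod (local_rep A c L))"
    using lorentz_finsler c unfolding lorentz_finsler_def by auto
  ultimately show "Cinf_on (case_prod (local_rep A c L)) (chart_image c \<times> (UNIV - {0}))"
    by (simp add: smooth_on_open_iff)
next
  fix x v and r :: real assume x: "x \<in> chart_image c" and "r > 0"
  have "linear (tvec A c (chart_inv c x))" using linear_tvec chart_inv_in c x by blast
  then show "local_rep A c L x (r *\<^sub>R v) = r\<^sup>2 * local_rep A c L x v"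
    using \<open>r > 0\<close> by (simp add: local_rep_def linear_scale L_homogeneous)
next
  fix x v :: "real^'d" assume "x \<in> chart_image c" "v \<noteq> 0"
  then show "invertible (metric_matrix (local_rep A c L) x v)"
    using lorentz_finsler c lorentz_signature_invertible unfolding lorentz_finsler_def by blast
qed

text \<open>\<open>Nmat_transform\<close> applies because the two coordinate expressions of
  \<open>L\<close> differ by the tangent map of the transition function.\<close>

lemma Nmat_tangent_trans:
  assumes c: "c \<in> A" "c' \<in> A" "p \<in> fst c" "p \<in> fst c'" and "v \<noteq> 0"
  shows "tangent_trans c c' p (Nmat (local_rep A c L) (snd c p) v *v w)
    = Nmat (local_rep A c' L) (snd c' p) (tangent_trans c c' p v) *v tangent_trans c c' p w
      + D (\<lambda>y. D (chart_trans c c') y w) (snd c p) v"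
proof -
  let ?W = "snd c ` (fst c \<inter> fst c')"
  have bij: "bij (D (chart_trans c c') x)" if "x \<in> ?W" for x
    using that bij_tangent_trans[OF c(1,2)] unfolding tangent_trans_def by auto
  have eq: "local_rep A c L x v = local_rep A c' L (chart_trans c c' x) (D (chart_trans c c') x v)"
    if xW: "x \<in> ?W" for x v
  proof -
    obtain q where q: "x = snd c q" "q \<in> fst c" "q \<in> fst c'" using xW by blast
    then show ?thesis
      using local_rep_trans[OF c(1,2) q(2,3), where f = L] chart_trans_chart[OF c(1) q(2), of c']
      unfolding tangent_trans_def by simp
  qed
  have "?W \<subseteq> chart_image c" "chart_trans c c' ` ?W \<subseteq> chart_image c'"
    by (auto simp: chart_image_def chart_trans_chart[OF c(1)])
  from Nmat_transform[OF finsler_chart[OF c(1)] finsler_chart[OF c(2)]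
      open_image_chart[OF c(1) open_chart[OF c(2)]] this(1) Cinf_on_chart_trans[OF c(1,2)] this(2)
      bij eq, of "snd c p" v w]
  show ?thesis using assms chart_trans_chart[OF c(1), of p] by (simp add: tangent_trans_def)
qed

end

section \<open>Covariant derivatives in an arbitrary chart\<close>

locale manifold_curve = lorentz_finsler_manifold A L
  for A :: "('m::topological_space, 'd::finite) chart set" and L +
  fixes I :: "real set" and \<eta> :: "real \<Rightarrow> 'm"
  assumes interval: "proper_interval I" and smooth_curve: "smooth_curve A I \<eta>"
begin

definition dom :: "('m, 'd) chart \<Rightarrow> real set" where "dom c = {t \<in> I. \<eta> t \<in> fst c}"

definition pos :: "('m, 'd) chart \<Rightarrow> real \<Rightarrow> real^'d" where "pos c t = snd c (\<eta> t)"

definition vel :: "('m, 'd) chart \<Rightarrow> real \<Rightarrow> real^'d" where "vel c = derivI I (pos c)"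

lemma pos_eq: "snd c \<circ> \<eta> = pos c"
  by (auto simp: pos_def)

lemma dom_chart_at: "t \<in> I \<Longrightarrow> t \<in> dom (chart_at A (\<eta> t))"
  by (simp add: dom_def chart_at)

lemma domD: "t \<in> dom c \<Longrightarrow> t \<in> I" "t \<in> dom c \<Longrightarrow> \<eta> t \<in> fst c"
  by (auto simp: dom_def)

lemma openin_dom: "c \<in> A \<Longrightarrow> openin (top_of_set I) (dom c)"
proof -
  assume "c \<in> A"
  have "continuous_on I \<eta>" using smooth_curve by (simp add: smooth_curve_def)
  then have "openin (top_of_set I) (I \<inter> \<eta> -` fst c)"
    using open_chart[OF \<open>c \<in> A\<close>] by (rule continuous_openin_preimage_gen)
  then show ?thesis by (simp add: dom_def vimage_def Int_def)
qed

lemma openin_dom2: "c \<in> A \<Longrightarrow> c' \<in> A \<Longrightarrow> openin (top_of_set I) (dom c \<inter> dom c')"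
  by (intro openin_Int openin_dom)

lemma smooth_pos: "c \<in> A \<Longrightarrow> smooth_on (dom c) (pos c)"
  using smooth_curve unfolding smooth_curve_def dom_def pos_eq by blast

lemma smooth_vel: "c \<in> A \<Longrightarrow> smooth_on (dom c) (vel c)"
  unfolding vel_def by (rule smooth_on_derivI[OF interval openin_dom smooth_pos])

lemma pos_has_derivative:
  "c \<in> A \<Longrightarrow> t \<in> dom c \<Longrightarrow> (pos c has_vector_derivative vel c t) (at t within I)"
  unfolding vel_def by (rule smooth_on_has_vector_derivative[OF interval openin_dom smooth_pos])

lemma vel_has_derivative:
  "c \<in> A \<Longrightarrow> t \<in> dom c \<Longrightarrow> (vel c has_vector_derivative derivI I (vel c) t) (at t within I)"
  by (rule smooth_on_has_vector_derivative[OF interval openin_dom smooth_vel])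

lemma vel_trans:
  assumes c: "c \<in> A" "c' \<in> A" "t \<in> dom c" "t \<in> dom c'"
  shows "vel c' t = tangent_trans c c' (\<eta> t) (vel c t)"
proof -
  have "(chart_trans c c' has_derivative tangent_trans c c' (\<eta> t)) (at (pos c t))"
    unfolding pos_def by (rule chart_trans_has_derivative) (use c in \<open>auto simp: domD\<close>)
  from vector_derivative_diff_chain_within[OF pos_has_derivative[OF c(1,3)] has_derivative_at_withinI[OF this]]
  have "((\<lambda>s. chart_trans c c' (pos c s)) has_vector_derivative tangent_trans c c' (\<eta> t) (vel c t)) (at t within I)"
    by (simp add: o_def)
  then have "(pos c' has_vector_derivative tangent_trans c c' (\<eta> t) (vel c t)) (at t within I)"
    using has_vector_derivative_cong_openin[OF openin_dom2[OF c(1,2)], of t "\<lambda>s. chart_trans c c' (pos c s)" "pos c'"]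
      c(3,4) by (auto simp: pos_def chart_trans_chart c(1) domD)
  then show ?thesis
    unfolding vel_def using derivI_eqI[OF interval domD(1)[OF c(3)]] by blast
qed

lemma velocity_eq: "velocity A I \<eta> t = vel (chart_at A (\<eta> t)) t"
  by (simp add: velocity_def vel_def pos_eq)

lemma tcoord_velocity:
  assumes "c \<in> A" "t \<in> dom c" shows "tcoord A c (\<eta> t) (velocity A I \<eta> t) = vel c t"
  unfolding velocity_eq tcoord_eq
  using vel_trans[OF chart_at(1) assms(1) dom_chart_at[OF domD(1)[OF assms(2)]] assms(2)] by simp

lemma vel_nonzero:
  assumes "c \<in> A" "t \<in> dom c" "velocity A I \<eta> t \<noteq> 0" shows "vel c t \<noteq> 0"
proof
  assume "vel c t = 0"
  then have "tvec A c (\<eta> t) (tcoord A c (\<eta> t) (velocity A I \<eta> t)) = tvec A c (\<eta> t) 0"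
    using tcoord_velocity[OF assms(1,2)] by simp
  then show False
    using assms domD(2)[OF assms(2)] by (simp add: tvec_tcoord linear_0[OF linear_tvec])
qed

abbreviation conn :: "('m, 'd) chart \<Rightarrow> real \<Rightarrow> real^'d^'d" where
  "conn c t \<equiv> Nmat (local_rep A c L) (pos c t) (vel c t)"

text \<open>\<open>cov_deriv\<close> is computed in \<open>chart_at A (\<eta> t)\<close>. Converting
  the components to the chart \<open>c\<close> and differentiating brings in the second derivative
  of the transition map, which is exactly the inhomogeneous term in the transformation law of the
  connection.\<close>

lemma tcoord_cov_deriv:
  assumes c: "c \<in> A" "t \<in> dom c" and nz: "velocity A I \<eta> t \<noteq> 0"
    and Y: "((\<lambda>s. tcoord A c (\<eta> s) (Y s)) has_vector_derivative Y') (at t within I)"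
  shows "tcoord A c (\<eta> t) (cov_deriv A L I \<eta> Y t) = Y' + conn c t *v tcoord A c (\<eta> t) (Y t)"
proof -
  define b where "b = chart_at A (\<eta> t)"
  have b: "b \<in> A" "t \<in> dom b"
    using chart_at dom_chart_at[OF domD(1)[OF c(2)]] by (auto simp: b_def)
  have pt: "\<eta> t \<in> fst b" "\<eta> t \<in> fst c" using b c by (auto simp: domD)
  let ?\<phi> = "chart_trans c b" and ?T = "tangent_trans c b (\<eta> t)"
  let ?Y = "\<lambda>s. tcoord A c (\<eta> s) (Y s)"
  have T: "?T w = D ?\<phi> (pos c t) w" for w by (simp add: tangent_trans_def pos_def)
  have "((\<lambda>s. D ?\<phi> (pos c s) (?Y s)) has_vector_derivative
      D (\<lambda>q. D ?\<phi> q (?Y t)) (pos c t) (vel c t) + D ?\<phi> (pos c t) Y') (at t within I)"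
  proof -
    have "pos c t \<in> snd c ` (fst c \<inter> fst b)" using pt by (auto simp: pos_def)
    from has_derivative_D_compose[OF open_image_chart[OF c(1) open_chart[OF b(1)]] Cinf_on_chart_trans[OF c(1) b(1)]
        this domD(1)[OF c(2)] pos_has_derivative[OF c, unfolded has_vector_derivative_def] Y[unfolded has_vector_derivative_def]]
    have "((\<lambda>s. D ?\<phi> (pos c s) (?Y s)) has_derivative
      (\<lambda>k. D (\<lambda>q. D ?\<phi> q (?Y t)) (pos c t) (k *\<^sub>R vel c t) + D ?\<phi> (pos c t) (k *\<^sub>R Y'))) (at t within I)" .
    moreover have "linear (D (\<lambda>q. D ?\<phi> q (?Y t)) (pos c t))"
      by (rule linear_D[OF Cinf_on_differentiable[OF Cinf_on_D[OF Cinf_on_chart_trans[OF c(1) b(1)]]]])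
        (use pt in \<open>auto simp: pos_def\<close>)
    moreover have "linear (D ?\<phi> (pos c t))"
      by (rule linear_D[OF Cinf_on_differentiable[OF Cinf_on_chart_trans[OF c(1) b(1)]]])
        (use pt in \<open>auto simp: pos_def\<close>)
    ultimately show ?thesis
      by (simp add: has_vector_derivative_def linear_scale scaleR_add_right)
  qed
  then have "((\<lambda>s. tcoord A b (\<eta> s) (Y s)) has_vector_derivative
      D (\<lambda>q. D ?\<phi> q (?Y t)) (pos c t) (vel c t) + ?T Y') (at t within I)"
  proof (subst has_vector_derivative_cong_openin[OF openin_dom2[OF c(1) b(1)]])
    fix s assume "s \<in> dom c \<inter> dom b"
    then show "tcoord A b (\<eta> s) (Y s) = D ?\<phi> (pos c s) (?Y s)"
      using tangent_trans_tcoord[OF c(1) b(1), of "\<eta> s" "Y s"]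
      by (simp add: domD tangent_trans_def pos_def)
  qed (use b c T in auto)
  from derivI_eqI[OF interval domD(1)[OF c(2)] this]
  have d: "derivI I (\<lambda>s. tcoord A b (\<eta> s) (Y s)) t = D (\<lambda>q. D ?\<phi> q (?Y t)) (pos c t) (vel c t) + ?T Y'" .
  interpret B: finsler_chart "local_rep A b L" "chart_image b" by (rule finsler_chart[OF b(1)])
  have vb: "velocity A I \<eta> t = vel b t" by (simp add: velocity_eq b_def)
  have Yt: "Y t = ?T (?Y t)"
    using tangent_trans_tcoord[OF c(1) b(1) pt(2,1), of "Y t"] tcoord_chart_at[of "\<eta> t"] by (simp add: b_def)
  have "(\<chi> a. \<Sum>e\<in>UNIV. \<Sum>d\<in>UNIV. Chris (local_rep A b L) a e d (pos b t) (vel b t) * vel b t $ e * Y t $ d)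
     = conn b t *v Y t"
  proof (rule vec_eq_iff[THEN iffD2], rule allI)
    fix a
    have "(\<Sum>e\<in>UNIV. \<Sum>d\<in>UNIV. Chris (local_rep A b L) a e d (pos b t) (vel b t) * vel b t $ e * Y t $ d)
      = (\<Sum>d\<in>UNIV. (\<Sum>e\<in>UNIV. Chris (local_rep A b L) a e d (pos b t) (vel b t) * vel b t $ e) * Y t $ d)"
      unfolding sum_distrib_right by (rule sum.swap)
    also have "\<dots> = (\<Sum>d\<in>UNIV. Nconn (local_rep A b L) a d (pos b t) (vel b t) * Y t $ d)"
      using B.Chris_contract[of "pos b t" "vel b t"] chart_in_image[OF pt(1)] vel_nonzero[OF b nz]
      by (simp add: pos_def)
    finally show "(\<chi> a. \<Sum>e\<in>UNIV. \<Sum>d\<in>UNIV. Chris (local_rep A b L) a e d (pos b t) (vel b t) * vel b t $ e * Y t $ d) $ a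
     = (conn b t *v Y t) $ a"
      by (simp add: matrix_vector_mult_def Nmat_def)
  qed
  then have "cov_deriv A L I \<eta> Y t = D (\<lambda>q. D ?\<phi> q (?Y t)) (pos c t) (vel c t) + ?T Y' + conn b t *v Y t"
    unfolding cov_deriv_def Let_def b_def[symmetric] vb d pos_def[symmetric] by simp
  also have "conn b t *v Y t + D (\<lambda>q. D ?\<phi> q (?Y t)) (pos c t) (vel c t) = ?T (conn c t *v ?Y t)"
    using Nmat_tangent_trans[OF c(1) b(1) pt(2,1) vel_nonzero[OF c nz], of "?Y t"]
      vel_trans[OF c(1) b(1) c(2) b(2)] Yt by (simp add: pos_def)
  then have "D (\<lambda>q. D ?\<phi> q (?Y t)) (pos c t) (vel c t) + ?T Y' + conn b t *v Y t = ?T (Y' + conn c t *v ?Y t)"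
    using linear_add[OF linear_tangent_trans[OF c(1) b(1) pt(2,1)], of Y' "conn c t *v ?Y t"]
    by (simp add: algebra_simps)
  finally show ?thesis
    using tangent_trans_inverse[OF c(1) b(1) pt(2,1)] by (simp add: tcoord_eq b_def)
qed

section \<open>Endomorphism fields as matrices in a chart\<close>

definition rep :: "('m, 'd) chart \<Rightarrow> (real \<Rightarrow> real^'d \<Rightarrow> real^'d) \<Rightarrow> real \<Rightarrow> real^'d^'d" where
  "rep c E s = matrix (\<lambda>w. tcoord A c (\<eta> s) (E s (tvec A c (\<eta> s) w)))"

lemma linear_conj:
  assumes "c \<in> A" "s \<in> dom c" "linear (E s)"
  shows "linear (\<lambda>w. tcoord A c (\<eta> s) (E s (tvec A c (\<eta> s) w)))"
  using linear_compose[OF linear_compose[OF linear_tvec[OF assms(1) domD(2)[OF assms(2)]] assms(3)]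
      linear_tcoord[OF assms(1) domD(2)[OF assms(2)]]]
  by (simp add: o_def)

lemma tcoord_endo:
  assumes "c \<in> A" "s \<in> dom c" "linear (E s)"
  shows "tcoord A c (\<eta> s) (E s w) = rep c E s *v tcoord A c (\<eta> s) w"
  unfolding rep_def fun_cong[OF matrix_vector_mul(2)[OF linear_conj[of c s E, OF assms]]]
  by (simp add: tvec_tcoord assms domD)

text \<open>The commutator comes from the two covariant derivatives in E'(P) = E(P)' - E(P'). The
  derivative \<open>Q'\<close> of the components of the test field \<open>P\<close> enters both and
  cancels.\<close>

lemma tcoord_cov_deriv_endo:
  assumes c: "c \<in> A" "t \<in> dom c" and nz: "velocity A I \<eta> t \<noteq> 0"
    and lin: "\<And>s. s \<in> I \<Longrightarrow> linear (E s)"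
    and E: "(rep c E has_vector_derivative M') (at t within I)"
  shows "tcoord A c (\<eta> t) (cov_deriv_endo A L I \<eta> E t w)
    = (M' + conn c t ** rep c E t - rep c E t ** conn c t) *v tcoord A c (\<eta> t) w"
proof -
  define b where "b = chart_at A (\<eta> t)"
  have b: "b \<in> A" "t \<in> dom b"
    using chart_at dom_chart_at[OF domD(1)[OF c(2)]] by (auto simp: b_def)
  have pt: "\<eta> t \<in> fst b" "\<eta> t \<in> fst c" using b c by (auto simp: domD)
  define P where "P = (\<lambda>s. tvec A b (\<eta> s) w)"
  define Q where "Q = (\<lambda>s. tcoord A c (\<eta> s) (P s))"
  \<comment> \<open>\<open>P\<close> has constant components in the chart at
    \<open>\<eta> t\<close>, not in \<open>c\<close>; all that matters is that it is differentiable
    in \<open>c\<close>.\<close>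
  have "\<exists>Q'. (Q has_vector_derivative Q') (at t within I)"
  proof -
    have "pos b t \<in> snd b ` (fst b \<inter> fst c)" using pt by (auto simp: pos_def)
    then have "(\<lambda>q. D (chart_trans b c) q w) differentiable (at (pos b t))"
      by (rule Cinf_on_differentiable[OF Cinf_on_D[OF Cinf_on_chart_trans[OF b(1) c(1)]]])
    from has_vector_derivative_compose_D[of "\<lambda>q. D (chart_trans b c) q w", OF this pos_has_derivative[OF b]]
    have 1: "((\<lambda>s. D (chart_trans b c) (pos b s) w) has_vector_derivative
      D (\<lambda>q. D (chart_trans b c) q w) (pos b t) (vel b t)) (at t within I)" .
    have 2: "D (chart_trans b c) (pos b s) w = Q s" if "s \<in> dom b \<inter> dom c" for s
    proof -
      have s: "\<eta> s \<in> fst b" "\<eta> s \<in> fst c" using that by (auto simp: domD)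
      have "Q s = tangent_trans b c (\<eta> s) (tcoord A b (\<eta> s) (P s))"
        unfolding Q_def using tangent_trans_tcoord[OF b(1) c(1) s] by simp
      then show ?thesis using s b by (simp add: P_def tcoord_tvec tangent_trans_def pos_def)
    qed
    have "t \<in> dom b \<inter> dom c" using b c by simp
    from iffD1[OF has_vector_derivative_cong_openin[OF openin_dom2[OF b(1) c(1)] this 2] 1]
    show ?thesis by (rule exI)
  qed
  then obtain Q' where Q': "(Q has_vector_derivative Q') (at t within I)" by blast
  have tI: "t \<in> I" using c by (simp add: domD)
  have P': "tcoord A c (\<eta> t) (cov_deriv A L I \<eta> P t) = Q' + conn c t *v Q t"
    using tcoord_cov_deriv[OF c nz, of P Q'] Q' by (simp add: Q_def)
  have 1: "((\<lambda>s. rep c E s *v Q s) has_vector_derivative rep c E t *v Q' + M' *v Q t) (at t within I)"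
    by (rule bounded_bilinear.has_vector_derivative[OF bounded_bilinear_matrix_vector_mult E Q'])
  have 2: "rep c E s *v Q s = tcoord A c (\<eta> s) (E s (P s))" if "s \<in> dom c" for s
    unfolding Q_def using tcoord_endo[of c s E "P s"] that c(1) lin[of s] by (simp add: domD)
  from iffD1[OF has_vector_derivative_cong_openin[OF openin_dom[OF c(1)] c(2) 2] 1]
  have "((\<lambda>s. tcoord A c (\<eta> s) (E s (P s))) has_vector_derivative rep c E t *v Q' + M' *v Q t) (at t within I)" .
  from tcoord_cov_deriv[OF c nz this]
  have EP: "tcoord A c (\<eta> t) (cov_deriv A L I \<eta> (\<lambda>s. E s (P s)) t)
      = rep c E t *v Q' + M' *v Q t + conn c t *v (rep c E t *v Q t)"
    using tcoord_endo[where E = E and s = t and c = c, of "P t"] c lin[OF tI] by (simp add: Q_def)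
  have endo: "tcoord A c (\<eta> t) (E t z) = rep c E t *v tcoord A c (\<eta> t) z" for z
    by (rule tcoord_endo[where E = E]) (use c lin tI in auto)
  have Qt: "Q t = tcoord A c (\<eta> t) w"
    by (simp add: Q_def P_def b_def tvec_chart_at)
  have "tcoord A c (\<eta> t) (cov_deriv_endo A L I \<eta> E t w)
    = rep c E t *v Q' + M' *v Q t + conn c t *v (rep c E t *v Q t) - rep c E t *v (Q' + conn c t *v Q t)"
    unfolding cov_deriv_endo_def Let_def b_def[symmetric] P_def[symmetric]
    using linear_diff[OF linear_tcoord[OF c(1) pt(2)]] endo EP P' by simp
  then show ?thesis
    by (simp add: Qt matrix_vector_mul_assoc matrix_vector_mult_add_rdistrib matrix_vector_mult_diff_rdistrib
        matrix_vector_right_distrib)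
qed

lemma rep_eqI:
  assumes "c \<in> A" "s \<in> dom c" "\<And>w. tcoord A c (\<eta> s) (E s w) = B *v tcoord A c (\<eta> s) w"
  shows "rep c E s = B"
proof -
  have "tcoord A c (\<eta> s) (E s (tvec A c (\<eta> s) w)) = B *v w" for w
    using assms by (simp add: tcoord_tvec domD)
  then show ?thesis unfolding rep_def by (simp add: matrix_of_matrix_vector_mul)
qed

lemma linear_of_rep:
  assumes "c \<in> A" "s \<in> dom c" "\<And>w. tcoord A c (\<eta> s) (E s w) = B *v tcoord A c (\<eta> s) w"
  shows "linear (E s)"
proof -
  have "E s w = tvec A c (\<eta> s) (B *v tcoord A c (\<eta> s) w)" for w
    using tvec_tcoord[OF assms(1) domD(2)[OF assms(2)], of "E s w"] assms(3) by simp
  then have "E s = tvec A c (\<eta> s) \<circ> ((*v) B \<circ> tcoord A c (\<eta> s))" by auto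
  then show ?thesis
    by (simp add: linear_compose linear_tvec linear_tcoord matrix_vector_mul_linear assms(1) domD(2)[OF assms(2)])
qed

end

section \<open>The Riccati equation for matrices\<close>

definition outer :: "real^'n \<Rightarrow> real^'n \<Rightarrow> real^'n^'n" where
  "outer v a = (\<chi> i j. v $ i * a $ j)"

lemma bounded_bilinear_outer: "bounded_bilinear (outer :: real^'n \<Rightarrow> real^'n \<Rightarrow> real^'n^'n)"
  unfolding bilinear_conv_bounded_bilinear[symmetric] bilinear_def
  by (auto intro!: linearI simp: outer_def vec_eq_iff algebra_simps)

lemma outer_vec: "outer v a *v w = (a \<bullet> w) *\<^sub>R v"
  by (simp add: outer_def matrix_vector_mult_def vec_eq_iff inner_vec_def sum_distrib_left mult_ac)

lemma vec_outer: "w v* outer v a = (v \<bullet> w) *\<^sub>R a"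
  by (simp add: outer_def vector_matrix_mult_def vec_eq_iff inner_vec_def sum_distrib_left mult_ac)

lemma matrix_mul_outer: "A ** outer v a = outer (A *v v) a"
  by (simp add: outer_def matrix_matrix_mult_def matrix_vector_mult_def vec_eq_iff sum_distrib_left mult_ac)

lemma outer_matrix_mul: "outer v a ** A = outer v (a v* A)"
  by (simp add: outer_def matrix_matrix_mult_def vector_matrix_mult_def vec_eq_iff sum_distrib_left mult_ac)

lemma bounded_bilinear_vector_matrix_mult:
  "bounded_bilinear ((v*) :: real^'m \<Rightarrow> real^'n^'m \<Rightarrow> real^'n)"
  unfolding bilinear_conv_bounded_bilinear[symmetric] bilinear_def
  by (auto intro!: linearI simp: vec_eq_iff vector_matrix_mult_def algebra_simps sum.distrib sum_distrib_left)

lemmas vector_matrix_bilinear =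
  bounded_bilinear.add_right[OF bounded_bilinear_vector_matrix_mult]
  bounded_bilinear.diff_right[OF bounded_bilinear_vector_matrix_mult]

lemma trace_outer: "trace (outer v a) = v \<bullet> a"
  by (simp add: trace_def outer_def inner_vec_def)

lemma outer_zero: "outer 0 a = 0" "outer v 0 = 0"
  by (simp_all add: outer_def vec_eq_iff)

lemma trace_scaleR: "trace (c *\<^sub>R (A :: real^'n^'n)) = c * trace A"
  by (simp add: trace_def sum_distrib_left)

lemma trace_minus: "trace (- (A :: real^'n^'n)) = - trace A"
  by (simp add: trace_def sum_negf)

lemmas matrix_bilinear =
  bounded_bilinear.add_left[OF bounded_bilinear_matrix_matrix_mult]
  bounded_bilinear.add_right[OF bounded_bilinear_matrix_matrix_mult]
  bounded_bilinear.diff_left[OF bounded_bilinear_matrix_matrix_mult]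
  bounded_bilinear.diff_right[OF bounded_bilinear_matrix_matrix_mult]
  bounded_bilinear.minus_left[OF bounded_bilinear_matrix_matrix_mult]
  bounded_bilinear.minus_right[OF bounded_bilinear_matrix_matrix_mult]
  bounded_bilinear.scaleR_left[OF bounded_bilinear_matrix_matrix_mult]
  bounded_bilinear.scaleR_right[OF bounded_bilinear_matrix_matrix_mult]

text \<open>Here \<open>v\<close> stands for the velocity, \<open>a\<close> for the covector with kernel \<open>Nspace\<close> and \<open>a v = 1\<close>,
  \<open>M\<close> for a normal endomorphism and \<open>K\<close> for its covariant derivative; adding \<open>outer v a\<close> makes
  \<open>M\<close> invertible on the whole tangent space.\<close>

locale normal_pair =
  fixes M K :: "real^'d^'d" and v a :: "real^'d"
  assumes av: "a \<bullet> v = 1"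
    and Mv: "M *v v = 0" and aM: "a v* M = 0"
    and Kv: "K *v v = 0" and aK: "a v* K = 0"
    and inv: "invertible (M + outer v a)"
begin

text \<open>It inverts \<open>M\<close> on the kernel of \<open>a\<close> and fixes
  \<open>v\<close>, as \<open>Wv\<close> and \<open>aW\<close> express.\<close>

definition W where "W = matrix_inv (M + outer v a)"

lemma W: "(M + outer v a) ** W = mat 1" "W ** (M + outer v a) = mat 1"
  unfolding W_def using matrix_inv_right_left[OF inv] by auto

lemma Wv: "W *v v = v"
proof -
  have "(M + outer v a) *v v = v"
    by (simp add: matrix_vector_mult_add_rdistrib Mv outer_vec av)
  then have "W *v v = (W ** (M + outer v a)) *v v" by (metis matrix_vector_mul_assoc)
  then show ?thesis by (simp add: W)
qed

lemma aW: "a v* W = a"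
proof -
  have "a v* (M + outer v a) = a"
    by (simp add: vector_matrix_bilinear aM vec_outer av inner_commute)
  then have "a v* W = a v* ((M + outer v a) ** W)"
    by (metis vector_matrix_mul_assoc)
  then show ?thesis by (simp add: W)
qed

text \<open>The projection onto the kernel of \<open>a\<close> along \<open>v\<close>: the identity
  of the normal space, extended by zero.\<close>

lemma MW: "M ** W = mat 1 - outer v a"
proof -
  have "M ** W + outer v a ** W = mat 1" using W(1) by (simp add: matrix_bilinear)
  then show ?thesis unfolding outer_matrix_mul aW by (simp add: eq_diff_eq)
qed

lemma KWv: "(K ** W) *v v = 0"
  by (metis Kv Wv matrix_vector_mul_assoc)

lemma aKW: "a v* (K ** W) = 0"
  by (metis aK vector_matrix_mul_assoc vector_matrix_mult_0)

lemma trace_MW: "trace (M ** W) = real CARD('d) - 1"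
  using av by (simp add: MW trace_sub trace_I trace_outer inner_commute)

lemma KW_proj: "(K ** W) ** (mat 1 - outer v a) = K ** W" "(mat 1 - outer v a) ** (K ** W) = K ** W"
  and proj_proj: "(mat 1 - outer v a) ** (mat 1 - outer v a) = mat 1 - outer v a"
proof -
  show "(K ** W) ** (mat 1 - outer v a) = K ** W"
    by (simp only: matrix_bilinear matrix_mul_outer KWv outer_zero) simp
  show "(mat 1 - outer v a) ** (K ** W) = K ** W"
    by (simp only: matrix_bilinear outer_matrix_mul aKW outer_zero) simp
  have "outer v a ** outer v a = outer v a"
    by (simp add: matrix_mul_outer outer_vec av)
  then show "(mat 1 - outer v a) ** (mat 1 - outer v a) = mat 1 - outer v a"
    by (simp add: matrix_bilinear)
qed

text \<open>\<open>M ** W\<close> is idempotent and acts as a two-sided unit on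
  \<open>K ** W\<close>, so the square expands as for commuting elements. With \<open>x\<close>
  equal to the mean of the trace this is the square of the shear.\<close>

lemma trace_shear_square:
  "trace ((K ** W - x *\<^sub>R (M ** W)) ** (K ** W - x *\<^sub>R (M ** W)))
    = trace ((K ** W) ** (K ** W)) - 2 * x * trace (K ** W) + x\<^sup>2 * (real CARD('d) - 1)"
proof -
  have "trace ((B - x *\<^sub>R P) ** (B - x *\<^sub>R P)) = trace (B ** B) - 2 * x * trace B + x\<^sup>2 * trace P"
    if "B ** P = B" "P ** B = B" "P ** P = P" for B P :: "real^'d^'d"
    by (simp only: matrix_bilinear that trace_sub trace_scaleR) (simp add: algebra_simps power2_eq_square)
  from this[OF KW_proj proj_proj] show ?thesis
    unfolding MW[symmetric] by (simp add: trace_MW)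
qed

end

text \<open>The hypotheses on \<open>v\<close> and \<open>a\<close> say that both are parallel for
  the connection \<open>N\<close>. Ordinary derivatives are used throughout, since only the trace is
  wanted and there the connection terms cancel.\<close>

lemma matrix_riccati:
  fixes M M1 K N :: "real \<Rightarrow> real^'d^'d" and v a :: "real \<Rightarrow> real^'d"
  assumes I: "proper_interval I" and S: "openin (top_of_set I) S"
    and M': "\<And>s. s \<in> S \<Longrightarrow> (M has_vector_derivative M1 s) (at s within I)"
    and v': "\<And>s. s \<in> S \<Longrightarrow> (v has_vector_derivative - (N s *v v s)) (at s within I)"
    and a': "\<And>s. s \<in> S \<Longrightarrow> (a has_vector_derivative a s v* N s) (at s within I)"
    and K: "\<And>s. s \<in> S \<Longrightarrow> K s = M1 s + N s ** M s - M s ** N s"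
    and Mv: "\<And>s. s \<in> S \<Longrightarrow> M s *v v s = 0" and aM: "\<And>s. s \<in> S \<Longrightarrow> a s v* M s = 0"
    and av: "\<And>s. s \<in> S \<Longrightarrow> a s \<bullet> v s = 1"
    and inv: "\<And>s. s \<in> S \<Longrightarrow> invertible (M s + outer (v s) (a s))"
  shows matrix_riccati_normal_pair: "\<And>s. s \<in> S \<Longrightarrow> normal_pair (M s) (K s) (v s) (a s)"
    and matrix_riccati_trace:
      "\<And>t K' R. t \<in> S \<Longrightarrow> (K has_vector_derivative K') (at t within I) \<Longrightarrow> R *v v t = 0 \<Longrightarrow>
        (\<And>w. a t \<bullet> w = 0 \<Longrightarrow> (K' + N t ** K t - K t ** N t) *v w + R *v (M t *v w) = 0) \<Longrightarrow>
        ((\<lambda>s. trace (K s ** matrix_inv (M s + outer (v s) (a s)))) has_vector_derivative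
          - trace R - trace ((K t ** matrix_inv (M t + outer (v t) (a t))) ** (K t ** matrix_inv (M t + outer (v t) (a t)))))
          (at t within I)"
proof -
  note mv = matrix_vector_mul_assoc[symmetric] matrix_vector_mult_add_rdistrib matrix_vector_mult_diff_rdistrib
  have SI: "s \<in> I" if "s \<in> S" for s using S that openin_imp_subset by blast
  \<comment> \<open>Differentiate \<open>M v = 0\<close> and insert the equation for
    \<open>v\<close>; the next claim treats \<open>a M = 0\<close> in the same way.\<close>
  have Kv: "K s *v v s = 0" if s: "s \<in> S" for s
  proof -
    have "((\<lambda>s. M s *v v s) has_vector_derivative M s *v - (N s *v v s) + M1 s *v v s) (at s within I)"
      by (rule bounded_bilinear.has_vector_derivative[OF bounded_bilinear_matrix_vector_mult M'[OF s] v'[OF s]])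
    moreover have "((\<lambda>s. M s *v v s) has_vector_derivative 0) (at s within I)"
      using has_vector_derivative_cong_openin[OF S s, of "\<lambda>s. M s *v v s" "\<lambda>s. 0" 0] Mv by simp
    ultimately have "M s *v - (N s *v v s) + M1 s *v v s = 0"
      using vector_derivative_unique_within[OF proper_interval_not_bot[OF I SI[OF s]]] by blast
    then show ?thesis
      by (simp add: K[OF s] mv Mv[OF s] vec.neg)
  qed
  have aK: "a s v* K s = 0" if s: "s \<in> S" for s
  proof -
    have "((\<lambda>s. a s v* M s) has_vector_derivative a s v* M1 s + (a s v* N s) v* M s) (at s within I)"
      by (rule bounded_bilinear.has_vector_derivative[OF bounded_bilinear_vector_matrix_mult a'[OF s] M'[OF s]])
    moreover have "((\<lambda>s. a s v* M s) has_vector_derivative 0) (at s within I)"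
      using has_vector_derivative_cong_openin[OF S s, of "\<lambda>s. a s v* M s" "\<lambda>s. 0" 0] aM by simp
    ultimately have "a s v* M1 s + (a s v* N s) v* M s = 0"
      using vector_derivative_unique_within[OF proper_interval_not_bot[OF I SI[OF s]]] by blast
    then show ?thesis
      by (simp add: K[OF s] vector_matrix_bilinear vector_matrix_mul_assoc[symmetric] aM[OF s])
  qed
  show normal: "normal_pair (M s) (K s) (v s) (a s)" if s: "s \<in> S" for s
    by unfold_locales (use s av Mv aM Kv aK inv in auto)
  fix t K' R
  assume t: "t \<in> S" and K': "(K has_vector_derivative K') (at t within I)" and Rv: "R *v v t = 0"
    and jac: "\<And>w. a t \<bullet> w = 0 \<Longrightarrow> (K' + N t ** K t - K t ** N t) *v w + R *v (M t *v w) = 0"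
  interpret np: normal_pair "M t" "K t" "v t" "a t" by (rule normal[OF t])
  let ?W = "\<lambda>s. matrix_inv (M s + outer (v s) (a s))"
  let ?B = "K t ** np.W"
  have "(K' + N t ** K t - K t ** N t) *v v t = 0"
  proof -
    have "((\<lambda>s. K s *v v s) has_vector_derivative K t *v - (N t *v v t) + K' *v v t) (at t within I)"
      by (rule bounded_bilinear.has_vector_derivative[OF bounded_bilinear_matrix_vector_mult K' v'[OF t]])
    moreover have "((\<lambda>s. K s *v v s) has_vector_derivative 0) (at t within I)"
      using has_vector_derivative_cong_openin[OF S t, of "\<lambda>s. K s *v v s" "\<lambda>s. 0" 0] Kv by simp
    ultimately have "K t *v - (N t *v v t) + K' *v v t = 0"
      using vector_derivative_unique_within[OF proper_interval_not_bot[OF I SI[OF t]]] by blast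
    then show ?thesis by (simp add: mv Kv[OF t] vec.neg)
  qed
  \<comment> \<open>The Jacobi equation is given on the kernel of \<open>a\<close>. Both of its
    terms vanish on \<open>v\<close>, so it holds on the whole space and becomes a matrix
    identity.\<close>
  then have jac': "(K' + N t ** K t - K t ** N t) *v w + R *v (M t *v w) = 0" for w
  proof -
    let ?u = "w - (a t \<bullet> w) *\<^sub>R v t"
    have "a t \<bullet> ?u = 0" by (simp add: inner_diff_right av[OF t])
    from jac[OF this] \<open>(K' + N t ** K t - K t ** N t) *v v t = 0\<close> show ?thesis
      by (simp add: matrix_vector_mult_diff_distrib matrix_vector_mult_scaleR Mv[OF t])
  qed
  have jacM: "K' = K t ** N t - N t ** K t - R ** M t"
  proof -
    have "K' + N t ** K t - K t ** N t + R ** M t = 0"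
      using jac' unfolding matrix_eq by (simp add: mv)
    then show ?thesis by (simp add: algebra_simps add_eq_0_iff)
  qed
  obtain W' where W': "(?W has_vector_derivative W') (at t within I)"
  proof -
    have "((\<lambda>s. M s + outer (v s) (a s)) has_vector_derivative
      M1 t + (outer (v t) (a t v* N t) + outer (- (N t *v v t)) (a t))) (at t within I)"
      by (intro has_vector_derivative_add M'[OF t]
        bounded_bilinear.has_vector_derivative[OF bounded_bilinear_outer v'[OF t] a'[OF t]])
    from matrix_inv_has_vector_derivative[OF this inv[OF t]] show ?thesis using that by blast
  qed
  define J1 where "J1 = M1 t + (outer (v t) (a t v* N t) + outer (- (N t *v v t)) (a t))"
  have J': "((\<lambda>s. M s + outer (v s) (a s)) has_vector_derivative J1) (at t within I)"
    unfolding J1_def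
    by (intro has_vector_derivative_add M'[OF t]
        bounded_bilinear.has_vector_derivative[OF bounded_bilinear_outer v'[OF t] a'[OF t]])
  have Wt: "?W t = np.W" by (simp add: np.W_def)
  \<comment> \<open>As \<open>outer v a\<close> is parallel, the covariant derivative of
    \<open>M + outer v a\<close> is \<open>K\<close>; this is the equation solved for the ordinary
    derivative.\<close>
  have J1: "J1 = K t - N t ** (M t + outer (v t) (a t)) + (M t + outer (v t) (a t)) ** N t"
    unfolding J1_def K[OF t]
    by (simp add: matrix_bilinear matrix_mul_outer outer_matrix_mul bounded_bilinear.minus_left[OF bounded_bilinear_outer])
  have d1: "((\<lambda>s. (M s + outer (v s) (a s)) ** ?W s) has_vector_derivative
      (M t + outer (v t) (a t)) ** W' + J1 ** ?W t) (at t within I)"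
    by (rule bounded_bilinear.has_vector_derivative[OF bounded_bilinear_matrix_matrix_mult J' W'])
  have d2: "((\<lambda>s. (M s + outer (v s) (a s)) ** ?W s) has_vector_derivative 0) (at t within I)"
    using has_vector_derivative_cong_openin[OF S t, of "\<lambda>s. (M s + outer (v s) (a s)) ** ?W s" "\<lambda>s. mat 1" 0]
      matrix_inv_right_left(1)[OF inv] by simp
  have "(M t + outer (v t) (a t)) ** W' + J1 ** np.W = 0"
    using vector_derivative_unique_within[OF proper_interval_not_bot[OF I SI[OF t]] d1 d2] by (simp only: Wt)
  then have "(M t + outer (v t) (a t)) ** W' = - (J1 ** np.W)" by (simp add: add_eq_0_iff2)
  then have "np.W ** ((M t + outer (v t) (a t)) ** W') = - (np.W ** (J1 ** np.W))"
    by (simp add: matrix_bilinear)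
  then have W'_eq: "W' = - (np.W ** J1 ** np.W)"
    by (simp only: matrix_mul_assoc np.W matrix_mul_lid)
  have "((\<lambda>s. K s ** ?W s) has_vector_derivative K t ** W' + K' ** ?W t) (at t within I)"
    by (rule bounded_bilinear.has_vector_derivative[OF bounded_bilinear_matrix_matrix_mult K' W'])
  from bounded_linear.has_vector_derivative[OF bounded_linear_trace this]
  have "((\<lambda>s. trace (K s ** ?W s)) has_vector_derivative trace (K t ** W' + K' ** np.W)) (at t within I)"
    by (simp only: Wt)
  moreover have "trace (K t ** W' + K' ** np.W) = - trace R - trace (?B ** ?B)"
  proof -
    have 1: "K t ** W' = - (?B ** ?B) + ?B ** N t - K t ** N t ** np.W"
    proof -
      have "K t ** W' = - (?B ** J1 ** np.W)"
        by (simp add: W'_eq matrix_bilinear matrix_mul_assoc)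
      also have "?B ** J1 ** np.W = ?B ** ?B - (?B ** N t) ** ((M t + outer (v t) (a t)) ** np.W)
          + K t ** (np.W ** (M t + outer (v t) (a t))) ** N t ** np.W"
        by (simp add: J1 matrix_bilinear matrix_mul_assoc)
      finally show ?thesis by (simp add: np.W)
    qed
    \<comment> \<open>\<open>M ** W\<close> differs from the identity by \<open>outer v a\<close>,
      and \<open>R\<close> annihilates \<open>v\<close>.\<close>
    have "R ** M t ** np.W = R"
      by (simp only: matrix_mul_assoc[symmetric] np.MW) (simp add: matrix_bilinear matrix_mul_outer Rv outer_zero)
    then have 2: "K' ** np.W = K t ** N t ** np.W - N t ** ?B - R"
      by (simp add: jacM matrix_bilinear matrix_mul_assoc)
    \<comment> \<open>In the sum of \<open>1\<close> and \<open>2\<close> the connection survives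
      only in the commutator of \<open>?B\<close> and \<open>N\<close>, whose trace is zero.\<close>
    have "trace (?B ** N t) = trace (N t ** ?B)" by (rule trace_mul_sym)
    then show ?thesis unfolding 1 2 by (simp add: trace_add trace_sub trace_minus)
  qed
  ultimately show "((\<lambda>s. trace (K s ** ?W s)) has_vector_derivative
      - trace R - trace ((K t ** ?W t) ** (K t ** ?W t))) (at t within I)"
    by (simp only: Wt)
qed

section \<open>Traces\<close>

text \<open>Independence of the basis, needed because \<open>trace_on\<close> selects one
  arbitrarily: expand the axis vectors in \<open>B\<close> and exchange the sums.\<close>

lemma trace_eq_sum_representation:
  fixes F :: "real^'d \<Rightarrow> real^'d"
  assumes F: "linear F" and B: "independent B" "span B = UNIV"
  shows "(\<Sum>b\<in>B. representation B (F b) b) = trace (matrix F)"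
proof -
  have "finite B" using B(1) by (rule independent_imp_finite)
  have lin: "linear (\<lambda>v. representation B v b)" for b
    by (rule linearI) (simp_all add: representation_add[OF B(1)] representation_scale[OF B(1)] B(2))
  have rep: "(\<Sum>b\<in>B. representation B v b *\<^sub>R b) = v" for v
    using sum_representation_eq[OF B(1) _ \<open>finite B\<close> order_refl, of v] B(2) by simp
  have "trace (matrix F) = (\<Sum>i\<in>UNIV. F (axis i 1) $ i)"
    by (simp add: trace_def matrix_def)
  also have "\<dots> = (\<Sum>i\<in>UNIV. (\<Sum>b\<in>B. representation B (axis i 1) b *\<^sub>R F b) $ i)"
  proof (intro sum.cong refl)
    fix i :: 'd
    have "F (axis i 1) = F (\<Sum>b\<in>B. representation B (axis i 1) b *\<^sub>R b)" by (simp only: rep)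
    also have "\<dots> = (\<Sum>b\<in>B. representation B (axis i 1) b *\<^sub>R F b)"
      by (simp add: linear_sum[OF F] linear_scale[OF F])
    finally show "F (axis i 1) $ i = (\<Sum>b\<in>B. representation B (axis i 1) b *\<^sub>R F b) $ i" by simp
  qed
  also have "\<dots> = (\<Sum>b\<in>B. \<Sum>i\<in>UNIV. (F b $ i) *\<^sub>R representation B (axis i 1) b)"
    by (simp add: sum.swap[of _ B] mult.commute)
  also have "\<dots> = (\<Sum>b\<in>B. representation B (F b) b)"
    by (intro sum.cong refl linear_axis_expansion[OF lin, symmetric])
  finally show ?thesis by simp
qed

text \<open>The selected basis of \<open>V\<close> is completed by \<open>v\<close>, and
  \<open>v\<close> contributes nothing because \<open>F v = 0\<close>.\<close>

lemma trace_on_eq: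
  fixes F :: "real^'d \<Rightarrow> real^'d"
  assumes F: "linear F" "F v = 0" "\<And>w. w \<in> V \<Longrightarrow> F w \<in> V" and f: "\<And>w. w \<in> V \<Longrightarrow> f w = F w"
    and V: "subspace V" "v \<notin> V" "\<And>w. \<exists>r. w - r *\<^sub>R v \<in> V"
  shows "trace_on V f = trace (matrix F)"
proof -
  define B where "B = (SOME B. B \<subseteq> V \<and> independent B \<and> V \<subseteq> span B)"
  have "\<exists>B. B \<subseteq> V \<and> independent B \<and> V \<subseteq> span B"
    using maximal_independent_subset[of V] by metis
  then have B: "B \<subseteq> V" "independent B" "V \<subseteq> span B"
    unfolding B_def by (metis (mono_tags, lifting) someI_ex)+
  have "span B = V" using B V(1) span_minimal by blast
  have "finite B" using B(2) by (rule independent_imp_finite)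
  have "v \<notin> B" using B(1) V(2) by blast
  have ind: "independent (insert v B)"
    using B(2) V(2) \<open>span B = V\<close> by (simp add: independent_insert)
  have span_all: "w \<in> span (insert v B)" for w
  proof -
    obtain r where "w - r *\<^sub>R v \<in> V" using V(3) by blast
    then have "w - r *\<^sub>R v \<in> span (insert v B)"
      using \<open>span B = V\<close> span_mono[of B "insert v B"] by blast
    then have "(w - r *\<^sub>R v) + r *\<^sub>R v \<in> span (insert v B)"
      by (rule span_add) (simp add: span_base span_scale)
    then show ?thesis by simp
  qed
  have "trace (matrix F) = (\<Sum>b\<in>insert v B. representation (insert v B) (F b) b)"
    by (rule trace_eq_sum_representation[OF F(1) ind, symmetric]) (use span_all in auto)
  also have "\<dots> = (\<Sum>b\<in>B. representation (insert v B) (F b) b)"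
    using \<open>finite B\<close> \<open>v \<notin> B\<close> F(2) by (simp add: representation_zero)
  also have "\<dots> = (\<Sum>b\<in>B. representation B (f b) b)"
  proof (intro sum.cong refl)
    fix b assume "b \<in> B"
    then have "F b \<in> span B" "f b = F b" using B(1) F(3) f \<open>span B = V\<close> by auto
    then show "representation (insert v B) (F b) b = representation B (f b) b"
      using representation_extend[OF ind _ subset_insertI, of "F b"] by simp
  qed
  finally show ?thesis unfolding trace_on_def Let_def B_def[symmetric] by simp
qed

section \<open>Normal tensor fields along a unit speed geodesic\<close>

text \<open>The speed is left free, because the weight is also differentiated along rescaled
  geodesics and along the arbitrarily selected one. Unit speed is added in
  \<open>unit_geodesic\<close>.\<close>

locale geodesic_curve = manifold_curve A L I \<eta>
  for A :: "('m::topological_space, 'd::finite) chart set" and L I \<eta> +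
  assumes geodesic: "\<And>c t. c \<in> A \<Longrightarrow> t \<in> dom c \<Longrightarrow>
      derivI I (vel c) t = - 2 *\<^sub>R spray_vec (local_rep A c L) (pos c t) (vel c t)"
    and velocity_nonzero: "\<And>t. t \<in> I \<Longrightarrow> velocity A I \<eta> t \<noteq> 0"
begin

lemma vel_nz: "c \<in> A \<Longrightarrow> t \<in> dom c \<Longrightarrow> vel c t \<noteq> 0"
  using vel_nonzero velocity_nonzero domD(1) by blast

lemma pos_in: "t \<in> dom c \<Longrightarrow> pos c t \<in> chart_image c"
  by (simp add: pos_def chart_in_image domD)

lemma along_has_derivative:
  assumes c: "c \<in> A" "t \<in> dom c"
    and f: "Cinf_on (case_prod f) (chart_image c \<times> (UNIV - {0}))"
  shows "((\<lambda>s. f (pos c s) (vel c s)) has_vector_derivative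
    (\<Sum>b\<in>UNIV. dx b f (pos c t) (vel c t) * vel c t $ b)
     - 2 * (\<Sum>b\<in>UNIV. dv b f (pos c t) (vel c t) * spray (local_rep A c L) b (pos c t) (vel c t)))
    (at t within I)"
proof -
  have d: "case_prod f differentiable (at (pos c t, vel c t))"
    by (rule Cinf_on_differentiable[OF f]) (use c vel_nz pos_in in auto)
  have "((\<lambda>s. (pos c s, vel c s)) has_vector_derivative (vel c t, derivI I (vel c) t)) (at t within I)"
    by (rule has_vector_derivative_Pair[OF pos_has_derivative[OF c] vel_has_derivative[OF c]])
  from has_vector_derivative_compose_D[OF d this]
  have "((\<lambda>s. f (pos c s) (vel c s)) has_vector_derivative
      D (case_prod f) (pos c t, vel c t) (vel c t, derivI I (vel c) t)) (at t within I)"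
    by simp
  moreover have "(\<Sum>b\<in>UNIV. dv b f (pos c t) (vel c t) * derivI I (vel c) t $ b)
    = - 2 * (\<Sum>b\<in>UNIV. dv b f (pos c t) (vel c t) * spray (local_rep A c L) b (pos c t) (vel c t))"
    by (simp add: geodesic[OF c] spray_vec_def sum_distrib_left mult_ac)
  ultimately show ?thesis by (simp add: D_case_prod[OF d])
qed

end

locale unit_geodesic = geodesic_curve A L I \<eta>
  for A :: "('m::topological_space, 'd::finite) chart set" and L I \<eta> +
  assumes unit_speed: "\<And>t. t \<in> I \<Longrightarrow> L (\<eta> t) (velocity A I \<eta> t) = - 1 / 2"
begin

text \<open>This is - g_v(v, .) for the velocity v. The sign makes its value on a unit timelike
  velocity equal to +1, as the projection along \<open>v\<close> requires.\<close>

definition cov :: "('m, 'd) chart \<Rightarrow> real \<Rightarrow> real^'d" where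
  "cov c t = (\<chi> b. - dv b (local_rep A c L) (pos c t) (vel c t))"

lemma vel_parallel:
  assumes c: "c \<in> A" "t \<in> dom c"
  shows "(vel c has_vector_derivative - (conn c t *v vel c t)) (at t within I)"
proof -
  interpret C: finsler_chart "local_rep A c L" "chart_image c" by (rule finsler_chart[OF c(1)])
  have "conn c t *v vel c t = 2 *\<^sub>R spray_vec (local_rep A c L) (pos c t) (vel c t)"
    using C.Nconn_contract[OF pos_in[OF c(2)] vel_nz[OF c]]
    by (simp add: vec_eq_iff matrix_vector_mult_def Nmat_def spray_vec_def)
  then show ?thesis using vel_has_derivative[OF c] geodesic[OF c] by simp
qed

text \<open>By the Euler-Lagrange form of the spray, the derivative of \<open>dv b l\<close> along
  the geodesic is \<open>dx b l\<close>, and \<open>dv_l_Nconn\<close> rewrites this through the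
  connection.\<close>

lemma cov_parallel:
  assumes c: "c \<in> A" "t \<in> dom c"
  shows "(cov c has_vector_derivative cov c t v* conn c t) (at t within I)"
proof -
  interpret C: finsler_chart "local_rep A c L" "chart_image c" by (rule finsler_chart[OF c(1)])
  let ?l = "local_rep A c L" and ?x = "pos c t" and ?v = "vel c t"
  note xv = pos_in[OF c(2)] vel_nz[OF c]
  have "((\<lambda>s. - dv b ?l (pos c s) (vel c s)) has_vector_derivative (cov c t v* conn c t) $ b) (at t within I)" for b
  proof -
    have "(\<Sum>e\<in>UNIV. dv e (dv b ?l) ?x ?v * spray ?l e ?x ?v) = (\<Sum>e\<in>UNIV. metric ?l b e ?x ?v * spray ?l e ?x ?v)"
      using C.metric_sym[OF xv, of b] by (simp add: C.metric_eq)
    then have "(\<Sum>e\<in>UNIV. dx e (dv b ?l) ?x ?v * ?v $ e)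
       - 2 * (\<Sum>e\<in>UNIV. dv e (dv b ?l) ?x ?v * spray ?l e ?x ?v) = dx b ?l ?x ?v"
      using C.metric_spray[OF xv, of b] by simp
    also have "\<dots> = - (cov c t v* conn c t) $ b"
      by (simp add: C.dv_l_Nconn[OF xv, symmetric] vector_matrix_mult_def cov_def Nmat_def sum_negf)
    finally show ?thesis
      using has_vector_derivative_minus[OF along_has_derivative[OF c C.sm_dv[OF C.smooth_l, of b]]] by simp
  qed
  then have "((\<lambda>s. \<chi> b. - dv b ?l (pos c s) (vel c s)) has_vector_derivative (\<chi> b. (cov c t v* conn c t) $ b)) (at t within I)"
    by (rule has_vector_derivative_vec_lambda)
  then show ?thesis by (simp add: cov_def[abs_def])
qed

lemma cov_vel:
  assumes c: "c \<in> A" "t \<in> dom c" shows "cov c t \<bullet> vel c t = 1"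
proof -
  interpret C: finsler_chart "local_rep A c L" "chart_image c" by (rule finsler_chart[OF c(1)])
  have "tvec A c (\<eta> t) (vel c t) = velocity A I \<eta> t"
    using tcoord_velocity[OF c] tvec_tcoord[OF c(1) domD(2)[OF c(2)]] by metis
  then have "local_rep A c L (pos c t) (vel c t) = - 1 / 2"
    unfolding pos_def using local_rep_chart[OF c(1) domD(2)[OF c(2)]] unit_speed[OF domD(1)[OF c(2)]] by simp
  then show ?thesis
    using C.Euler_l[OF pos_in[OF c(2)] vel_nz[OF c]] by (simp add: cov_def inner_vec_def sum_negf)
qed

lemma cov_eq_D:
  assumes c: "c \<in> A" "t \<in> dom c"
  shows "cov c t \<bullet> w = - D (local_rep A c L (pos c t)) (vel c t) w"
proof -
  interpret C: finsler_chart "local_rep A c L" "chart_image c" by (rule finsler_chart[OF c(1)])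
  have "linear (D (local_rep A c L (pos c t)) (vel c t))"
    by (rule linear_D[OF C.sm_differentiable_snd[OF C.smooth_l pos_in[OF c(2)] vel_nz[OF c]]])
  from linear_axis_expansion[OF this, of w]
  show ?thesis by (simp add: cov_def dv_def inner_vec_def sum_negf mult.commute)
qed

lemma cov_trans:
  assumes c: "c \<in> A" "c' \<in> A" "t \<in> dom c" "t \<in> dom c'"
  shows "cov c' t \<bullet> tangent_trans c c' (\<eta> t) w = cov c t \<bullet> w"
proof -
  let ?T = "tangent_trans c c' (\<eta> t)"
  interpret C': finsler_chart "local_rep A c' L" "chart_image c'" by (rule finsler_chart[OF c(2)])
  have pt: "\<eta> t \<in> fst c" "\<eta> t \<in> fst c'" using c by (auto simp: domD)
  have "(?T has_derivative ?T) (at (vel c t))"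
    using linear_tangent_trans[OF c(1,2) pt] linear_imp_has_derivative by blast
  moreover have "(local_rep A c' L (pos c' t) has_derivative D (local_rep A c' L (pos c' t)) (?T (vel c t))) (at (?T (vel c t)))"
    using D_has_derivative[OF C'.sm_differentiable_snd[OF C'.smooth_l pos_in[OF c(4)] vel_nz[OF c(2,4)]]]
      vel_trans[OF c] by simp
  ultimately have "((\<lambda>v. local_rep A c' L (pos c' t) (?T v)) has_derivative
      (\<lambda>w. D (local_rep A c' L (pos c' t)) (?T (vel c t)) (?T w))) (at (vel c t))"
    by (rule has_derivative_compose)
  moreover have "(\<lambda>v. local_rep A c' L (pos c' t) (?T v)) = local_rep A c L (pos c t)"
    unfolding pos_def using local_rep_trans[OF c(1,2) pt] by auto
  ultimately have "D (local_rep A c L (pos c t)) (vel c t) = (\<lambda>w. D (local_rep A c' L (pos c' t)) (?T (vel c t)) (?T w))"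
    by (simp add: D_eqI)
  then show ?thesis
    using cov_eq_D[OF c(2,4)] cov_eq_D[OF c(1,3)] vel_trans[OF c] by simp
qed

lemma Nspace_iff:
  assumes c: "c \<in> A" "t \<in> dom c"
  shows "w \<in> Nspace A L I \<eta> t \<longleftrightarrow> cov c t \<bullet> tcoord A c (\<eta> t) w = 0"
proof -
  define b where "b = chart_at A (\<eta> t)"
  have b: "b \<in> A" "t \<in> dom b"
    using chart_at dom_chart_at[OF domD(1)[OF c(2)]] by (auto simp: b_def)
  interpret B: finsler_chart "local_rep A b L" "chart_image b" by (rule finsler_chart[OF b(1)])
  have "gprod A L (\<eta> t) (velocity A I \<eta> t) (velocity A I \<eta> t) w
      = (\<Sum>j\<in>UNIV. (\<Sum>i\<in>UNIV. metric (local_rep A b L) i j (pos b t) (vel b t) * vel b t $ i) * w $ j)"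
    unfolding gprod_def Let_def b_def[symmetric] velocity_eq pos_def[symmetric] sum_distrib_right
    by (rule sum.swap)
  also have "\<dots> = - (cov b t \<bullet> w)"
    by (simp add: B.metric_contract(1)[OF pos_in[OF b(2)] vel_nz[OF b]] cov_def inner_vec_def sum_negf)
  also have "cov b t \<bullet> w = cov c t \<bullet> tcoord A c (\<eta> t) w"
    using cov_trans[OF b(1) c(1) b(2) c(2), of w] by (simp add: tcoord_eq b_def)
  finally show ?thesis by (simp add: Nspace_def Let_def)
qed

lemma subspace_Nspace:
  assumes "t \<in> I" shows "subspace (Nspace A L I \<eta> t)"
proof -
  have "Nspace A L I \<eta> t = {w. cov (chart_at A (\<eta> t)) t \<bullet> w = 0}"
    using Nspace_iff[OF chart_at(1) dom_chart_at[OF assms]] by (auto simp: tcoord_chart_at)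
  then show ?thesis by (simp add: subspace_hyperplane)
qed

text \<open>\<open>G\<close> kills the velocity and maps into the normal space, so it represents the
  extension of \<open>f\<close> by zero; passing to the components of \<open>c\<close> is a
  conjugation and preserves the trace.\<close>

lemma trace_on_Nspace:
  assumes c: "c \<in> A" "t \<in> dom c" and G: "G *v vel c t = 0" "cov c t v* G = 0"
    and f: "\<And>w. w \<in> Nspace A L I \<eta> t \<Longrightarrow> tcoord A c (\<eta> t) (f w) = G *v tcoord A c (\<eta> t) w"
  shows "trace_on (Nspace A L I \<eta> t) f = trace G"
proof -
  have pt: "\<eta> t \<in> fst c" using c by (simp add: domD)
  let ?P = "tcoord A c (\<eta> t)" and ?Q = "tvec A c (\<eta> t)"
  let ?F = "\<lambda>w. ?Q (G *v ?P w)"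
  have lin: "linear ?P" "linear ?Q"
    using linear_tcoord linear_tvec c(1) pt by blast+
  have linF: "linear ?F"
    using linear_compose[OF linear_compose[OF lin(1) matrix_vector_mul_linear] lin(2), of G] by (simp add: o_def)
  have "trace_on (Nspace A L I \<eta> t) f = trace (matrix ?F)"
  proof (rule trace_on_eq[OF linF, where v = "velocity A I \<eta> t"])
    show "?F (velocity A I \<eta> t) = 0"
      using tcoord_velocity[OF c] G(1) linear_0[OF lin(2)] by simp
    show "?F w \<in> Nspace A L I \<eta> t" for w
      using G(2) dot_lmul_matrix[of "cov c t" G "?P w"]
      by (simp add: Nspace_iff[OF c] tcoord_tvec[OF c(1) pt])
    show "f w = ?F w" if "w \<in> Nspace A L I \<eta> t" for w
      using f[OF that] tvec_tcoord[OF c(1) pt, of "f w"] by simp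
    show "subspace (Nspace A L I \<eta> t)" using subspace_Nspace c by (simp add: domD)
    show "velocity A I \<eta> t \<notin> Nspace A L I \<eta> t"
      using cov_vel[OF c] by (simp add: Nspace_iff[OF c] tcoord_velocity[OF c])
    fix w
    have "w - (cov c t \<bullet> ?P w) *\<^sub>R velocity A I \<eta> t \<in> Nspace A L I \<eta> t"
      using cov_vel[OF c]
      by (simp add: Nspace_iff[OF c] linear_diff[OF lin(1)] linear_scale[OF lin(1)] tcoord_velocity[OF c] inner_diff_right)
    then show "\<exists>r. w - r *\<^sub>R velocity A I \<eta> t \<in> Nspace A L I \<eta> t" by blast
  qed
  also have "matrix ?F = matrix ?Q ** (G ** matrix ?P)"
  proof -
    have "matrix ?Q ** (G ** matrix ?P) *v w = ?F w" for w
      by (simp add: matrix_vector_mul_assoc[symmetric] fun_cong[OF matrix_vector_mul(2)[OF lin(1)]]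
          fun_cong[OF matrix_vector_mul(2)[OF lin(2)]])
    then have "?F = (*v) (matrix ?Q ** (G ** matrix ?P))" by auto
    then show ?thesis by (simp only: matrix_of_matrix_vector_mul)
  qed
  also have "trace (matrix ?Q ** (G ** matrix ?P)) = trace (G ** (matrix ?P ** matrix ?Q))"
    by (subst trace_mul_sym) (simp add: matrix_mul_assoc)
  also have "matrix ?P ** matrix ?Q = mat 1"
    by (simp add: matrix_eq matrix_vector_mul_assoc[symmetric] fun_cong[OF matrix_vector_mul(2)[OF lin(1)]]
        fun_cong[OF matrix_vector_mul(2)[OF lin(2)]] tcoord_tvec[OF c(1) pt])
  finally show ?thesis by simp
qed

lemma conn_has_derivative:
  assumes c: "c \<in> A" "t \<in> dom c"
  shows "\<exists>N'. (conn c has_vector_derivative N') (at t within I)"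
proof -
  interpret C: finsler_chart "local_rep A c L" "chart_image c" by (rule finsler_chart[OF c(1)])
  have "\<forall>a b. \<exists>n. ((\<lambda>s. Nconn (local_rep A c L) a b (pos c s) (vel c s)) has_vector_derivative n) (at t within I)"
    using along_has_derivative[OF c C.sm_Nconn] by blast
  then obtain n where "\<And>a b. ((\<lambda>s. Nconn (local_rep A c L) a b (pos c s) (vel c s)) has_vector_derivative n a b) (at t within I)"
    by metis
  then have "((\<lambda>s. \<chi> a b. Nconn (local_rep A c L) a b (pos c s) (vel c s)) has_vector_derivative (\<chi> a b. n a b)) (at t within I)"
    by (intro has_vector_derivative_vec_lambda)
  then show ?thesis by (auto simp: Nmat_def)
qed

end

section \<open>The matrix of a nonsingular normal tensor field and the traced Riccati
  equation\<close>

locale normal_field = unit_geodesic A L I \<eta>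
  for A :: "('m::topological_space, 'd::finite) chart set" and L I \<eta> +
  fixes J :: "real \<Rightarrow> real^'d \<Rightarrow> real^'d"
  assumes normal: "normal_endo_field A L I \<eta> J" and nonsing: "nonsingular A L I \<eta> J"
begin

lemma linear_J: "s \<in> I \<Longrightarrow> linear (J s)"
  and J_Nspace: "s \<in> I \<Longrightarrow> J s w \<in> Nspace A L I \<eta> s"
  and J_velocity: "s \<in> I \<Longrightarrow> J s (velocity A I \<eta> s) = 0"
  using normal unfolding normal_endo_field_def by blast+

text \<open>A column of the matrix of \<open>J\<close>: smoothness of a normal endomorphism field is
  expressed through images of vectors with constant components, that is, column by column.\<close>

definition col :: "('m, 'd) chart \<Rightarrow> 'd \<Rightarrow> real \<Rightarrow> real^'d" where
  "col c j s = tcoord A c (\<eta> s) (J s (tvec A c (\<eta> s) (axis j 1)))"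

definition M1 :: "('m, 'd) chart \<Rightarrow> real \<Rightarrow> real^'d^'d" where
  "M1 c s = (\<chi> i j. derivI I (col c j) s $ i)"

lemma smooth_col: "c \<in> A \<Longrightarrow> smooth_on (dom c) (col c j)"
  using normal unfolding normal_endo_field_def dom_def col_def by blast

lemma rep_J: "rep c J s = (\<chi> i j. col c j s $ i)"
  by (simp add: rep_def matrix_def col_def)

lemma rep_J_has_derivative:
  assumes c: "c \<in> A" "s \<in> dom c"
  shows "(rep c J has_vector_derivative M1 c s) (at s within I)"
  unfolding rep_J M1_def
  by (intro has_vector_derivative_vec_lambda bounded_linear.has_vector_derivative[OF bounded_linear_vec_nth]
      smooth_on_has_vector_derivative[OF interval openin_dom smooth_col] c)

lemma M1_has_derivative:
  assumes c: "c \<in> A" "s \<in> dom c"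
  shows "\<exists>M2. (M1 c has_vector_derivative M2) (at s within I)"
proof
  have "smooth_on (dom c) (derivI I (col c j))" for j
    by (rule smooth_on_derivI[OF interval openin_dom[OF c(1)] smooth_col[OF c(1)]])
  then show "(M1 c has_vector_derivative (\<chi> i j. derivI I (derivI I (col c j)) s $ i)) (at s within I)"
    unfolding M1_def
    by (intro has_vector_derivative_vec_lambda bounded_linear.has_vector_derivative[OF bounded_linear_vec_nth]
        smooth_on_has_vector_derivative[OF interval openin_dom[OF c(1)]] c)
qed

abbreviation DJ where "DJ \<equiv> cov_deriv_endo A L I \<eta> J"

definition K :: "('m, 'd) chart \<Rightarrow> real \<Rightarrow> real^'d^'d" where
  "K c s = M1 c s + conn c s ** rep c J s - rep c J s ** conn c s"

lemma tcoord_DJ: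
  assumes c: "c \<in> A" "s \<in> dom c"
  shows "tcoord A c (\<eta> s) (DJ s w) = K c s *v tcoord A c (\<eta> s) w"
  unfolding K_def
  by (rule tcoord_cov_deriv_endo[OF c velocity_nonzero[OF domD(1)[OF c(2)]] linear_J rep_J_has_derivative[OF c]])

lemma rep_DJ: "c \<in> A \<Longrightarrow> s \<in> dom c \<Longrightarrow> rep c DJ s = K c s"
  by (rule rep_eqI) (auto intro: tcoord_DJ)

lemma linear_DJ: "s \<in> I \<Longrightarrow> linear (DJ s)"
  by (rule linear_of_rep[OF chart_at(1) dom_chart_at tcoord_DJ[OF chart_at(1) dom_chart_at]])

lemma K_has_derivative:
  assumes c: "c \<in> A" "s \<in> dom c"
  shows "\<exists>K'. (K c has_vector_derivative K') (at s within I)"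
proof -
  obtain N' where N': "(conn c has_vector_derivative N') (at s within I)"
    using conn_has_derivative[OF c] by blast
  obtain M2 where M2: "(M1 c has_vector_derivative M2) (at s within I)"
    using M1_has_derivative[OF c] by blast
  note b = bounded_bilinear.has_vector_derivative[OF bounded_bilinear_matrix_matrix_mult]
  have "((\<lambda>s. M1 c s + conn c s ** rep c J s - rep c J s ** conn c s) has_vector_derivative
    M2 + (conn c s ** M1 c s + N' ** rep c J s) - (rep c J s ** N' + M1 c s ** conn c s)) (at s within I)"
    by (intro has_vector_derivative_add has_vector_derivative_diff M2 b N' rep_J_has_derivative[OF c])
  then show ?thesis unfolding K_def[abs_def] by blast
qed

lemma rep_J_vec: "c \<in> A \<Longrightarrow> s \<in> dom c \<Longrightarrow> rep c J s *v tcoord A c (\<eta> s) w = tcoord A c (\<eta> s) (J s w)"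
  using tcoord_endo[where E = J and c = c and s = s and w = w] linear_J domD(1)[of s c] by simp

lemma rep_J_vel:
  assumes c: "c \<in> A" "s \<in> dom c" shows "rep c J s *v vel c s = 0"
  using rep_J_vec[OF c, of "velocity A I \<eta> s"] J_velocity[OF domD(1)[OF c(2)]]
    linear_0[OF linear_tcoord[OF c(1) domD(2)[OF c(2)]]]
  by (simp add: tcoord_velocity[OF c])

lemma cov_rep_J:
  assumes c: "c \<in> A" "s \<in> dom c" shows "cov c s v* rep c J s = 0"
proof -
  have "(cov c s v* rep c J s) \<bullet> w = 0" for w
  proof -
    have "rep c J s *v w = tcoord A c (\<eta> s) (J s (tvec A c (\<eta> s) w))"
      using rep_J_vec[OF c, of "tvec A c (\<eta> s) w"] tcoord_tvec[OF c(1) domD(2)[OF c(2)], of w] by simp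
    then show ?thesis
      using J_Nspace[OF domD(1)[OF c(2)], of "tvec A c (\<eta> s) w"] by (simp add: dot_lmul_matrix Nspace_iff[OF c])
  qed
  then show ?thesis by (metis inner_eq_zero_iff)
qed

text \<open>Applying \<open>cov\<close> to a kernel vector shows that it is normal; then
  \<open>J\<close> annihilates it, and injectivity of \<open>J\<close> on the normal space
  finishes.\<close>

lemma invertible_rep_J:
  assumes c: "c \<in> A" "s \<in> dom c" shows "invertible (rep c J s + outer (vel c s) (cov c s))"
proof -
  let ?M = "rep c J s + outer (vel c s) (cov c s)" and ?V = "Nspace A L I \<eta> s"
  have pt: "\<eta> s \<in> fst c" "s \<in> I" using c by (auto simp: domD)
  have "w = 0" if w: "?M *v w = 0" for w
  proof -
    have "cov c s \<bullet> (?M *v w) = cov c s \<bullet> w"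
      using cov_vel[OF c] cov_rep_J[OF c] dot_lmul_matrix[of "cov c s" "rep c J s" w]
      by (simp add: matrix_vector_mult_add_rdistrib outer_vec inner_add_right)
    then have 0: "cov c s \<bullet> w = 0" using w by simp
    define u where "u = tvec A c (\<eta> s) w"
    have uw: "tcoord A c (\<eta> s) u = w" by (simp add: u_def tcoord_tvec c pt)
    have "u \<in> ?V" using 0 by (simp add: Nspace_iff[OF c] uw)
    moreover have "rep c J s *v w = 0"
      using w 0 by (simp add: matrix_vector_mult_add_rdistrib outer_vec)
    then have "tcoord A c (\<eta> s) (J s u) = 0" using rep_J_vec[OF c, of u] uw by simp
    then have "J s u = 0"
      using tvec_tcoord[OF c(1) pt(1), of "J s u"] linear_0[OF linear_tvec[OF c(1) pt(1)]] by simp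
    then have "J s u = J s 0" using linear_0[OF linear_J[OF pt(2)]] by simp
    moreover have "0 \<in> ?V" using subspace_Nspace[OF pt(2)] by (rule subspace_0)
    moreover have "inj_on (J s) ?V" using nonsing pt(2) unfolding nonsingular_def bij_betw_def by blast
    ultimately have "u = 0" by (simp add: inj_on_eq_iff)
    then show "w = 0" using uw linear_0[OF linear_tcoord[OF c(1) pt(1)]] by simp
  qed
  then have "\<exists>B. B ** ?M = mat 1" by (simp add: matrix_left_invertible_ker)
  then show ?thesis by (simp add: invertible_left_inverse)
qed

lemmas riccati_assms = interval openin_dom rep_J_has_derivative vel_parallel cov_parallel K_def
  rep_J_vel cov_rep_J cov_vel invertible_rep_J

lemma normal_pair:
  assumes c: "c \<in> A" "s \<in> dom c" shows "normal_pair (rep c J s) (K c s) (vel c s) (cov c s)"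
  by (rule matrix_riccati_normal_pair[where S = "dom c" and I = I and M = "rep c J" and N = "conn c"])
    (use riccati_assms c in auto)

definition W :: "('m, 'd) chart \<Rightarrow> real \<Rightarrow> real^'d^'d" where
  "W c s = matrix_inv (rep c J s + outer (vel c s) (cov c s))"

text \<open>With \<open>c\<close> the chart selected at \<open>\<eta> t\<close>,
  \<open>tcoord\<close> is the identity at \<open>t\<close>, so the Jacobi equation and
  \<open>curv_matrix\<close> can be read off in \<open>c\<close> directly. For \<open>s\<close> near
  \<open>t\<close> the matrix \<open>K c s\<close> still represents \<open>DJ\<close>, by
  \<open>rep_DJ\<close>.\<close>

lemma trace_DJ_has_derivative:
  assumes t: "t \<in> I" and c: "c = chart_at A (\<eta> t)"
    and jacobi: "\<And>w. w \<in> Nspace A L I \<eta> t \<Longrightarrow>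
      cov_deriv_endo A L I \<eta> DJ t w + curv_matrix A L (\<eta> t) (velocity A I \<eta> t) *v J t w = 0"
  shows "((\<lambda>s. trace (K c s ** W c s)) has_vector_derivative
    - Ric A L (\<eta> t) (velocity A I \<eta> t) - trace ((K c t ** W c t) ** (K c t ** W c t))) (at t within I)"
proof -
  have cA: "c \<in> A" "t \<in> dom c" using chart_at dom_chart_at[OF t] by (auto simp: c)
  let ?R = "curv_matrix A L (\<eta> t) (velocity A I \<eta> t)"
  interpret C: finsler_chart "local_rep A c L" "chart_image c" by (rule finsler_chart[OF cA(1)])
  obtain K' where K': "(K c has_vector_derivative K') (at t within I)"
    using K_has_derivative[OF cA] by blast
  have v: "velocity A I \<eta> t = vel c t" by (simp add: velocity_eq c)
  have Rv: "?R *v vel c t = 0"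
    using C.curv_contract[OF pos_in[OF cA(2)] vel_nz[OF cA]]
    by (simp add: vec_eq_iff matrix_vector_mult_def curv_matrix_def Let_def v pos_def c)
  have jac: "(K' + conn c t ** K c t - K c t ** conn c t) *v w + ?R *v (rep c J t *v w) = 0"
    if "cov c t \<bullet> w = 0" for w
  proof -
    have tc: "tcoord A c (\<eta> t) u = u" for u by (simp add: c tcoord_chart_at)
    have "(rep c DJ has_vector_derivative K') (at t within I)"
      using has_vector_derivative_cong_openin[OF openin_dom[OF cA(1)] cA(2), of "K c" "rep c DJ"] K'
      by (simp add: rep_DJ[OF cA(1)])
    from tcoord_cov_deriv_endo[OF cA velocity_nonzero[OF t] linear_DJ this, of w]
    have "cov_deriv_endo A L I \<eta> DJ t w = (K' + conn c t ** K c t - K c t ** conn c t) *v w"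
      by (simp add: tc rep_DJ[OF cA])
    moreover have "rep c J t *v w = J t w" using rep_J_vec[OF cA, of w] by (simp add: tc)
    moreover have "w \<in> Nspace A L I \<eta> t" using that by (simp add: Nspace_iff[OF cA] tc)
    ultimately show ?thesis using jacobi[of w] by simp
  qed
  show ?thesis
    unfolding W_def Ric_def
    by (rule matrix_riccati_trace[where K = "K c" and a = "cov c" and N = "conn c",
          OF interval openin_dom[OF cA(1)] rep_J_has_derivative[OF cA(1)] vel_parallel[OF cA(1)]
          cov_parallel[OF cA(1)] K_def rep_J_vel[OF cA(1)] cov_rep_J[OF cA(1)] cov_vel[OF cA(1)]
          invertible_rep_J[OF cA(1)] cA(2) K' Rv jac])
qed

end

section \<open>The \<open>\<epsilon>\<close>-expansion and the \<open>\<epsilon>\<close>-shear\<close>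

context normal_field
begin

context
  fixes \<psi> :: "'m \<Rightarrow> real^'d \<Rightarrow> real" and n :: nat and \<epsilon> p' s :: real and c :: "('m, 'd) chart"
  assumes n: "n > 0" "CARD('d) = n + 1" and c: "c \<in> A" "s \<in> dom c"
    and psi': "(psi_along A \<psi> I \<eta> has_vector_derivative p') (at s within I)"
begin

abbreviation "E \<equiv> exp (- psi_along A \<psi> I \<eta> s / real n)"

text \<open>The matrix of \<open>B_eps\<close>, extended by zero on the velocity: differentiating
  the factor of \<open>J_psi\<close> subtracts p'/n times \<open>J\<close>, and the factor itself
  cancels against the inverse.\<close>

abbreviation "G \<equiv> tau_factor A \<psi> n \<epsilon> I \<eta> s *\<^sub>R ((K c s - (p' / real n) *\<^sub>R rep c J s) ** W c s)"

lemma rep_J_psi: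
  assumes "r \<in> dom c"
  shows "rep c (J_psi A \<psi> n I \<eta> J) r = exp (- psi_along A \<psi> I \<eta> r / real n) *\<^sub>R rep c J r"
proof (rule rep_eqI[OF c(1) assms])
  fix w
  show "tcoord A c (\<eta> r) (J_psi A \<psi> n I \<eta> J r w)
      = (exp (- psi_along A \<psi> I \<eta> r / real n) *\<^sub>R rep c J r) *v tcoord A c (\<eta> r) w"
    unfolding J_psi_def
    by (simp add: linear_scale[OF linear_tcoord[OF c(1) domD(2)[OF assms]]] rep_J_vec[OF c(1) assms, symmetric]
        scaleR_matrix_vector_assoc)
qed

lemma tcoord_D_J_psi:
  "tcoord A c (\<eta> s) (cov_deriv_endo A L I \<eta> (J_psi A \<psi> n I \<eta> J) s w)
    = E *\<^sub>R ((K c s - (p' / real n) *\<^sub>R rep c J s) *v tcoord A c (\<eta> s) w)"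
proof -
  have lin: "linear (J_psi A \<psi> n I \<eta> J r)" if "r \<in> I" for r
    unfolding J_psi_def using linear_compose_scale_right[OF linear_J[OF that]] .
  have "((\<lambda>r. psi_along A \<psi> I \<eta> r) has_real_derivative p') (at s within I)"
    using psi' by (simp add: has_real_derivative_iff_has_vector_derivative)
  then have "((\<lambda>r. exp (- psi_along A \<psi> I \<eta> r / real n)) has_real_derivative E * (- p' / real n)) (at s within I)"
    using n by (auto intro!: derivative_eq_intros)
  from has_vector_derivative_scaleR[OF this rep_J_has_derivative[OF c]]
  have "((\<lambda>r. exp (- psi_along A \<psi> I \<eta> r / real n) *\<^sub>R rep c J r) has_vector_derivative
      E *\<^sub>R M1 c s + (E * (- p' / real n)) *\<^sub>R rep c J s) (at s within I)" .
  then have "(rep c (J_psi A \<psi> n I \<eta> J) has_vector_derivative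
      E *\<^sub>R M1 c s + (E * (- p' / real n)) *\<^sub>R rep c J s) (at s within I)"
    using has_vector_derivative_cong_openin[OF openin_dom[OF c(1)] c(2), of "rep c (J_psi A \<psi> n I \<eta> J)"]
      rep_J_psi by simp
  from tcoord_cov_deriv_endo[OF c velocity_nonzero[OF domD(1)[OF c(2)]] lin this, of w]
  have "tcoord A c (\<eta> s) (cov_deriv_endo A L I \<eta> (J_psi A \<psi> n I \<eta> J) s w)
      = (E *\<^sub>R M1 c s + (E * (- p' / real n)) *\<^sub>R rep c J s + conn c s ** (E *\<^sub>R rep c J s)
          - (E *\<^sub>R rep c J s) ** conn c s) *v tcoord A c (\<eta> s) w"
    by (simp only: rep_J_psi[OF c(2)])
  also have "E *\<^sub>R M1 c s + (E * (- p' / real n)) *\<^sub>R rep c J s + conn c s ** (E *\<^sub>R rep c J s)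
          - (E *\<^sub>R rep c J s) ** conn c s = E *\<^sub>R (K c s - (p' / real n) *\<^sub>R rep c J s)"
    by (simp add: K_def matrix_bilinear scaleR_diff_right scaleR_add_right)
  finally show ?thesis by (simp add: scaleR_matrix_vector_assoc)
qed

lemma tcoord_B_eps:
  assumes w: "w \<in> Nspace A L I \<eta> s"
  shows "tcoord A c (\<eta> s) (B_eps A L \<psi> n \<epsilon> I \<eta> J s w) = G *v tcoord A c (\<eta> s) w"
proof -
  interpret np: normal_pair "rep c J s" "K c s" "vel c s" "cov c s" by (rule normal_pair[OF c])
  have Weq: "W c s = np.W" by (simp add: W_def np.W_def)
  have pt: "\<eta> s \<in> fst c" "s \<in> I" using c by (auto simp: domD)
  let ?V = "Nspace A L I \<eta> s" and ?w = "tcoord A c (\<eta> s) w"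
  \<comment> \<open>The preimage of \<open>w\<close> under \<open>J\<close>; it is normal because
    \<open>W\<close> preserves \<open>cov\<close>.\<close>
  define u where "u = tvec A c (\<eta> s) (W c s *v ?w)"
  have tu: "tcoord A c (\<eta> s) u = W c s *v ?w" by (simp add: u_def tcoord_tvec c pt)
  have "cov c s \<bullet> (W c s *v ?w) = cov c s \<bullet> ?w"
    using np.aW dot_lmul_matrix[of "cov c s" "W c s" ?w] by (simp add: Weq)
  then have uV: "u \<in> ?V" using w by (simp add: Nspace_iff[OF c] tu)
  have "tcoord A c (\<eta> s) (J s u) = (rep c J s ** W c s) *v ?w"
    using rep_J_vec[OF c, of u] tu by (simp add: matrix_vector_mul_assoc)
  also have "\<dots> = ?w"
    using w by (simp add: Weq np.MW matrix_vector_mult_diff_rdistrib outer_vec Nspace_iff[OF c])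
  finally have Ju: "J s u = w"
    using tvec_tcoord[OF c(1) pt(1)] by metis
  have inj: "inj_on (J_psi A \<psi> n I \<eta> J s) ?V"
    using nonsing pt(2) unfolding nonsingular_def bij_betw_def J_psi_def inj_on_def by simp
  have "inv_into ?V (J_psi A \<psi> n I \<eta> J s) w = inverse E *\<^sub>R u"
  proof (rule inv_into_f_eq[OF inj])
    show "inverse E *\<^sub>R u \<in> ?V" using uV subspace_Nspace[OF pt(2)] by (simp add: subspace_scale)
    show "J_psi A \<psi> n I \<eta> J s (inverse E *\<^sub>R u) = w"
      by (simp add: J_psi_def linear_scale[OF linear_J[OF pt(2)]] Ju)
  qed
  then have "tcoord A c (\<eta> s) (B_eps A L \<psi> n \<epsilon> I \<eta> J s w)
    = tau_factor A \<psi> n \<epsilon> I \<eta> s *\<^sub>R (E *\<^sub>R ((K c s - (p' / real n) *\<^sub>R rep c J s) *v (inverse E *\<^sub>R (W c s *v ?w))))"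
    unfolding B_eps_def
    by (simp add: linear_scale[OF linear_tcoord[OF c(1) pt(1)]] tcoord_D_J_psi tu)
  also have "\<dots> = G *v ?w"
    by (simp add: matrix_vector_mult_scaleR scaleR_matrix_vector_assoc matrix_vector_mul_assoc matrix_bilinear(8))
  finally show ?thesis .
qed

text \<open>\<open>rep c J s ** W c s\<close> has trace \<open>n\<close>, which cancels the
  denominator of p'/n.\<close>

lemma eps_expansion_eq:
  "eps_expansion A L \<psi> n \<epsilon> I \<eta> J s = tau_factor A \<psi> n \<epsilon> I \<eta> s * (trace (K c s ** W c s) - p')"
proof -
  interpret np: normal_pair "rep c J s" "K c s" "vel c s" "cov c s" by (rule normal_pair[OF c])
  have Weq: "W c s = np.W" by (simp add: W_def np.W_def)
  have "eps_expansion A L \<psi> n \<epsilon> I \<eta> J s = trace G"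
    unfolding eps_expansion_def
  proof (rule trace_on_Nspace[OF c _ _ tcoord_B_eps])
    show "G *v vel c s = 0"
      by (simp add: scaleR_matrix_vector_assoc[symmetric] matrix_vector_mul_assoc[symmetric] Weq np.Wv
          matrix_vector_mult_diff_rdistrib np.Kv np.Mv)
    have "cov c s v* (K c s - (p' / real n) *\<^sub>R rep c J s) = 0"
      by (simp add: vector_matrix_bilinear np.aK np.aM
          bounded_bilinear.scaleR_right[OF bounded_bilinear_vector_matrix_mult])
    then show "cov c s v* G = 0"
      by (simp add: bounded_bilinear.scaleR_right[OF bounded_bilinear_vector_matrix_mult]
          flip: vector_matrix_mul_assoc)
  qed
  then show ?thesis
    using n np.trace_MW by (simp add: trace_scaleR matrix_bilinear trace_sub Weq)
qed

text \<open>The weight changes \<open>B_eps\<close> by a multiple of the identity of the normal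
  space, so it drops out of the trace-free part. What remains is the factor \<open>?\<tau>\<close>
  times the unweighted shear.\<close>

lemma trace_shear_eq:
  "trace_on (Nspace A L I \<eta> s) (eps_shear A L \<psi> n \<epsilon> I \<eta> J s \<circ> eps_shear A L \<psi> n \<epsilon> I \<eta> J s)
    = (tau_factor A \<psi> n \<epsilon> I \<eta> s)\<^sup>2 *
      (trace ((K c s ** W c s) ** (K c s ** W c s)) - (trace (K c s ** W c s))\<^sup>2 / real n)"
proof -
  interpret np: normal_pair "rep c J s" "K c s" "vel c s" "cov c s" by (rule normal_pair[OF c])
  have Weq: "W c s = np.W" by (simp add: W_def np.W_def)
  let ?\<tau> = "tau_factor A \<psi> n \<epsilon> I \<eta> s" and ?tr = "trace (K c s ** W c s)"
  let ?H = "K c s ** W c s - (?tr / real n) *\<^sub>R (rep c J s ** W c s)"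
  let ?S = "?\<tau> *\<^sub>R ?H" and ?V = "Nspace A L I \<eta> s" and ?\<sigma> = "eps_shear A L \<psi> n \<epsilon> I \<eta> J s"
  have pt: "\<eta> s \<in> fst c" "s \<in> I" using c by (auto simp: domD)
  have "(rep c J s ** W c s) *v vel c s = 0"
    by (simp add: matrix_vector_mul_assoc[symmetric] Weq np.Wv np.Mv)
  moreover have "(K c s ** W c s) *v vel c s = 0"
    by (simp add: Weq np.KWv)
  ultimately have Sv: "?S *v vel c s = 0"
    by (simp add: scaleR_matrix_vector_assoc[symmetric] matrix_vector_mult_diff_rdistrib)
  have "cov c s v* (rep c J s ** W c s) = 0"
    by (simp add: np.aM flip: vector_matrix_mul_assoc)
  then have aS: "cov c s v* ?S = 0"
    by (simp add: vector_matrix_bilinear Weq np.aKW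
        bounded_bilinear.scaleR_right[OF bounded_bilinear_vector_matrix_mult])
  have \<sigma>: "tcoord A c (\<eta> s) (?\<sigma> w) = ?S *v tcoord A c (\<eta> s) w" if w: "w \<in> ?V" for w
  proof -
    let ?w = "tcoord A c (\<eta> s) w"
    have Pw: "(rep c J s ** W c s) *v ?w = ?w"
      using w by (simp add: Weq np.MW matrix_vector_mult_diff_rdistrib outer_vec Nspace_iff[OF c])
    have "tcoord A c (\<eta> s) (?\<sigma> w) = G *v ?w - (?\<tau> * (?tr - p') / real n) *\<^sub>R ?w"
      unfolding eps_shear_def
      by (simp only: linear_diff[OF linear_tcoord[OF c(1) pt(1)]] linear_scale[OF linear_tcoord[OF c(1) pt(1)]]
          tcoord_B_eps[OF w] eps_expansion_eq)
    also have "G *v ?w = ?\<tau> *\<^sub>R ((K c s ** W c s) *v ?w - (p' / real n) *\<^sub>R ?w)"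
      by (simp add: matrix_bilinear scaleR_matrix_vector_assoc[symmetric] matrix_vector_mult_diff_rdistrib Pw)
    also have "?\<tau> *\<^sub>R ((K c s ** W c s) *v ?w - (p' / real n) *\<^sub>R ?w) - (?\<tau> * (?tr - p') / real n) *\<^sub>R ?w
        = ?\<tau> *\<^sub>R ((K c s ** W c s) *v ?w - (?tr / real n) *\<^sub>R ?w)"
      by (simp add: scaleR_diff_right diff_divide_distrib right_diff_distrib scaleR_diff_left)
    also have "\<dots> = ?S *v ?w"
      by (simp add: scaleR_matrix_vector_assoc[symmetric] matrix_vector_mult_diff_rdistrib Pw)
    finally show ?thesis .
  qed
  have \<sigma>V: "?\<sigma> w \<in> ?V" if "w \<in> ?V" for w
    using aS dot_lmul_matrix[of "cov c s" ?S "tcoord A c (\<eta> s) w"] by (simp add: Nspace_iff[OF c] \<sigma>[OF that])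
  have "trace_on ?V (?\<sigma> \<circ> ?\<sigma>) = trace (?S ** ?S)"
  proof (rule trace_on_Nspace[OF c])
    show "(?S ** ?S) *v vel c s = 0"
      by (simp only: matrix_vector_mul_assoc[symmetric] Sv) simp
    show "cov c s v* (?S ** ?S) = 0"
      by (simp only: vector_matrix_mul_assoc[symmetric] aS) simp
    show "tcoord A c (\<eta> s) ((?\<sigma> \<circ> ?\<sigma>) w) = (?S ** ?S) *v tcoord A c (\<eta> s) w" if "w \<in> ?V" for w
      by (simp only: o_def \<sigma>[OF \<sigma>V[OF that]] \<sigma>[OF that] matrix_vector_mul_assoc)
  qed
  also have "?S ** ?S = (?\<tau> * ?\<tau>) *\<^sub>R (?H ** ?H)"
    by (simp only: bounded_bilinear.scaleR_left[OF bounded_bilinear_matrix_matrix_mult]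
        bounded_bilinear.scaleR_right[OF bounded_bilinear_matrix_matrix_mult] scaleR_scaleR)
  also have "trace \<dots> = (?\<tau> * ?\<tau>) * (trace ((K c s ** W c s) ** (K c s ** W c s))
      - 2 * (?tr / real n) * ?tr + (?tr / real n)\<^sup>2 * (real CARD('d) - 1))"
    using np.trace_shear_square[of "?tr / real n"] by (simp only: trace_scaleR Weq)
  also have "\<dots> = ?\<tau>\<^sup>2 * (trace ((K c s ** W c s) ** (K c s ** W c s)) - ?tr\<^sup>2 / real n)"
  proof -
    have "y - 2 * (x / m) * x + (x / m)\<^sup>2 * (m + 1 - 1) = y - x\<^sup>2 / m" if "m > 0" for x y m :: real
      using that by (simp add: field_simps power2_eq_square)
    from this[of "real n"] n show ?thesis by (simp add: power2_eq_square)
  qed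
  finally show ?thesis .
qed

end

end

section \<open>The weight along geodesics\<close>

lemma smooth_on_affine:
  assumes "smooth_on S f"
  shows "smooth_on {s :: real. t + r * s \<in> S} (\<lambda>s. f (t + r * s))"
  unfolding smooth_on_def
proof
  fix s assume "s \<in> {s. t + r * s \<in> S}"
  then obtain U g where U: "open U" "t + r * s \<in> U" "\<forall>k. Ck_on k g U" "\<forall>y\<in>U \<inter> S. g y = f y"
    using assms unfolding smooth_on_def by blast
  let ?U = "(\<lambda>s. r * s + t) -` U"
  have "open ?U" using U(1) by (intro open_vimage continuous_intros)
  moreover have "Ck_on k (\<lambda>s. g (r * s + t)) ?U" for k
    by (rule Ck_on_affine_compose[where T = U])
      (use U(3) \<open>open ?U\<close> in \<open>auto intro: bounded_linear_mult_right\<close>)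
  ultimately show "\<exists>U h. open U \<and> s \<in> U \<and> (\<forall>k. Ck_on k h U) \<and>
      (\<forall>y\<in>U \<inter> {s. t + r * s \<in> S}. h y = f (t + r * y))"
    using U(2,4) by (intro exI[of _ ?U] exI[of _ "\<lambda>s. g (r * s + t)"]) (auto simp: add.commute)
qed

lemma has_vector_derivative_affine:
  assumes "(f has_vector_derivative f') (at (t + r * s) within I)"
  shows "((\<lambda>s. f (t + r * s)) has_vector_derivative r *\<^sub>R f') (at s within {s. t + r * s \<in> I})"
proof -
  have "((\<lambda>s. t + r * s) has_vector_derivative r) (at s within {s. t + r * s \<in> I})"
    by (auto intro!: derivative_eq_intros simp: has_real_derivative_iff_has_vector_derivative[symmetric])
  moreover have "(f has_vector_derivative f') (at (t + r * s) within (\<lambda>s. t + r * s) ` {s. t + r * s \<in> I})"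
    by (rule has_vector_derivative_within_subset[OF assms]) auto
  ultimately show ?thesis
    using vector_diff_chain_within[of "\<lambda>s. t + r * s" r s "{s. t + r * s \<in> I}" f f'] by (simp add: o_def)
qed

lemma proper_interval_affine:
  assumes "proper_interval I" "r > 0"
  shows "proper_interval {s. t + r * s \<in> I}"
proof -
  obtain a b where ab: "a \<in> I" "b \<in> I" "a < b" and I: "is_interval I"
    using assms unfolding proper_interval_def by blast
  have "is_interval {s. t + r * s \<in> I}"
    unfolding is_interval_1
  proof (intro ballI allI impI)
    fix x y z assume *: "x \<in> {s. t + r * s \<in> I}" "y \<in> {s. t + r * s \<in> I}" "x \<le> z \<and> z \<le> y"
    then have "t + r * x \<le> t + r * z \<and> t + r * z \<le> t + r * y" using assms(2) by auto
    then show "z \<in> {s. t + r * s \<in> I}" using * I unfolding is_interval_1 by blast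
  qed
  moreover have "(a - t) / r \<in> {s. t + r * s \<in> I}" "(b - t) / r \<in> {s. t + r * s \<in> I}" "(a - t) / r < (b - t) / r"
    using ab assms(2) by (auto simp: divide_strict_right_mono)
  ultimately show ?thesis unfolding proper_interval_def by blast
qed

text \<open>Integral curves are the pairs of position and velocity of geodesics, so derivatives
  along a geodesic become derivatives along a fixed vector field.\<close>

definition geo_field :: "(real^'d::finite \<Rightarrow> real^'d \<Rightarrow> real) \<Rightarrow> (real^'d) \<times> (real^'d) \<Rightarrow> (real^'d) \<times> (real^'d)" where
  "geo_field l q = (snd q, - 2 *\<^sub>R spray_vec l (fst q) (snd q))"

lemma (in finsler_chart) geo_field_differentiable:
  assumes "x \<in> X" "v \<noteq> 0" shows "\<exists>Z'. (geo_field l has_derivative Z') (at (x, v))"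
proof -
  have "((\<lambda>q. spray l a (fst q) (snd q)) has_derivative D (case_prod (spray l a)) (x, v)) (at (x, v))" for a
    using D_has_derivative[OF sm_differentiable[OF sm_spray assms]] by (simp add: case_prod_unfold)
  then have "((\<lambda>q. spray_vec l (fst q) (snd q)) has_derivative
      (\<lambda>h. \<chi> a. D (case_prod (spray l a)) (x, v) h)) (at (x, v))"
    by (subst has_derivative_componentwise_within)
      (auto simp: Basis_vec_def inner_axis spray_vec_def)
  moreover have "(snd has_derivative snd) (at (x, v))" by (auto intro!: derivative_eq_intros)
  ultimately have "(geo_field l has_derivative (\<lambda>h. (snd h, - 2 *\<^sub>R (\<chi> a. D (case_prod (spray l a)) (x, v) h)))) (at (x, v))"
    unfolding geo_field_def[abs_def] by (intro has_derivative_Pair has_derivative_scaleR_right)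
  then show ?thesis by blast
qed

context geodesic_curve
begin

lemma phase_has_derivative:
  assumes c: "c \<in> A" "t \<in> dom c"
  shows "((\<lambda>s. (pos c s, vel c s)) has_vector_derivative geo_field (local_rep A c L) (pos c t, vel c t)) (at t within I)"
  using has_vector_derivative_Pair[OF pos_has_derivative[OF c] vel_has_derivative[OF c]] geodesic[OF c]
  by (simp add: geo_field_def)

lemma openin_phase:
  assumes c: "c \<in> A" and V: "open V"
  shows "openin (top_of_set I) {s \<in> dom c. (pos c s, vel c s) \<in> V}"
proof -
  have "continuous_on (dom c) (\<lambda>s. (pos c s, vel c s))"
    unfolding continuous_on_eq_continuous_within
  proof
    fix s assume "s \<in> dom c"
    from has_vector_derivative_continuous[OF phase_has_derivative[OF c this]]
    show "continuous (at s within dom c) (\<lambda>s. (pos c s, vel c s))"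
      by (rule continuous_within_subset) (auto simp: domD)
  qed
  then have "openin (top_of_set (dom c)) (dom c \<inter> (\<lambda>s. (pos c s, vel c s)) -` V)"
    using V by (rule continuous_openin_preimage_gen)
  then have "openin (top_of_set I) (dom c \<inter> (\<lambda>s. (pos c s, vel c s)) -` V)"
    using openin_dom[OF c] by (rule openin_trans)
  then show ?thesis by (simp add: Int_def vimage_def)
qed

lemma tvec_vel: "c \<in> A \<Longrightarrow> t \<in> dom c \<Longrightarrow> tvec A c (\<eta> t) (vel c t) = velocity A I \<eta> t"
  using tcoord_velocity[of c t] tvec_tcoord[of c "\<eta> t"] domD(2)[of t c] by metis

lemma local_rep_phase:
  "c \<in> A \<Longrightarrow> t \<in> dom c \<Longrightarrow> local_rep A c f (pos c t) (vel c t) = f (\<eta> t) (velocity A I \<eta> t)"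
  by (simp add: pos_def local_rep_chart domD tvec_vel)

text \<open>The derivatives of the weight depend only on the initial velocity: they are iterated
  derivatives along the geodesic vector field of a smooth extension \<open>g\<close>.\<close>

lemma psi_along_derivatives:
  fixes \<psi> X and c :: "('m, 'd) chart" and t :: real
  defines "Z \<equiv> geo_field (local_rep A c L)"
  defines "q \<equiv> (pos c t, vel c t)"
  assumes fd: "\<And>s. s \<in> I \<Longrightarrow> future_directed L X (\<eta> s) (velocity A I \<eta> s)"
    and c: "c \<in> A" "t \<in> dom c" and tl: "timelike L (\<eta> t) (velocity A I \<eta> t)"
    and U: "open U" "q \<in> U" and g: "Cinf_on g U"
    and ext: "\<And>x v. (x, v) \<in> U \<Longrightarrow> x \<in> chart_image c \<Longrightarrow> v \<noteq> 0 \<Longrightarrow>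
      tvec A c (chart_inv c x) v \<in> closure (Omega L X (chart_inv c x)) \<Longrightarrow> g (x, v) = local_rep A c \<psi> x v"
  shows "(psi_along A \<psi> I \<eta> has_vector_derivative D g q (Z q)) (at t within I)"
    and "(derivI I (psi_along A \<psi> I \<eta>) has_vector_derivative D (\<lambda>q. D g q (Z q)) q (Z q)) (at t within I)"
proof -
  interpret C: finsler_chart "local_rep A c L" "chart_image c" by (rule finsler_chart[OF c(1)])
  let ?Y = "chart_image c \<times> (UNIV - {0 :: real^'d})"
  \<comment> \<open>Negativity of \<open>L\<close> is an open condition. Together with
    future-directedness it puts the velocities at nearby instants into \<open>Omega\<close>, where
    \<open>g\<close> equals the weight.\<close>
  let ?V = "U \<inter> (?Y \<inter> case_prod (local_rep A c L) -` {..<0})"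
  define S where "S = {s \<in> dom c. (pos c s, vel c s) \<in> ?V}"
  have "open (?Y \<inter> case_prod (local_rep A c L) -` {..<0})"
    by (rule continuous_open_preimage[OF Cinf_on_continuous[OF C.smooth_l] C.open_S]) simp
  then have "openin (top_of_set I) S"
    unfolding S_def by (rule openin_phase[OF c(1) open_Int[OF U(1)]])
  have dS: "s \<in> dom c" if "s \<in> S" for s using that by (simp add: S_def)
  have tS: "t \<in> S"
    using c U(2) vel_nz[OF c] pos_in[OF c(2)] local_rep_phase[OF c, of L] tl
    by (simp add: S_def q_def timelike_def)
  have psi: "g (pos c s, vel c s) = psi_along A \<psi> I \<eta> s" if s: "s \<in> S" for s
  proof -
    have ci: "chart_inv c (pos c s) = \<eta> s"
      unfolding pos_def by (rule chart_inv_chart[OF c(1) domD(2)[OF dS[OF s]]])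
    have "velocity A I \<eta> s \<in> Omega L X (\<eta> s)"
      using s local_rep_phase[OF c(1) dS[OF s], of L] fd[OF domD(1)[OF dS[OF s]]]
      by (simp add: S_def Omega_def timelike_def)
    then have "tvec A c (chart_inv c (pos c s)) (vel c s) \<in> closure (Omega L X (chart_inv c (pos c s)))"
      unfolding ci tvec_vel[OF c(1) dS[OF s]] using closure_subset by blast
    then have "g (pos c s, vel c s) = local_rep A c \<psi> (pos c s) (vel c s)"
      using s by (intro ext) (auto simp: S_def)
    then show ?thesis by (simp add: local_rep_phase[OF c(1) dS[OF s]] psi_along_def)
  qed
  have 1: "(psi_along A \<psi> I \<eta> has_vector_derivative D g (pos c s, vel c s) (Z (pos c s, vel c s))) (at s within I)"
    if s: "s \<in> S" for s
  proof -
    have "g differentiable (at (pos c s, vel c s))"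
      by (rule Cinf_on_differentiable[OF g]) (use s in \<open>simp add: S_def\<close>)
    from has_vector_derivative_compose_D[of g "\<lambda>s. (pos c s, vel c s)", OF this phase_has_derivative[OF c(1) dS[OF s]]]
    have "((\<lambda>s. g (pos c s, vel c s)) has_vector_derivative D g (pos c s, vel c s) (Z (pos c s, vel c s))) (at s within I)"
      by (simp add: Z_def)
    then show ?thesis
      using has_vector_derivative_cong_openin[OF \<open>openin (top_of_set I) S\<close> s, of "\<lambda>s. g (pos c s, vel c s)"] psi by simp
  qed
  show "(psi_along A \<psi> I \<eta> has_vector_derivative D g q (Z q)) (at t within I)"
    using 1[OF tS] by (simp add: q_def)
  obtain Z' where Z': "(Z has_derivative Z') (at q)"
    using C.geo_field_differentiable[OF pos_in[OF c(2)] vel_nz[OF c]] unfolding Z_def q_def by blast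
  have "(\<lambda>q. D g q (Z q)) differentiable (at q)"
    using has_derivative_D_compose[OF U(1) g, of "\<lambda>q. q" q UNIV, OF U(2) UNIV_I has_derivative_ident Z']
    unfolding differentiable_def by blast
  from has_vector_derivative_compose_D[of "\<lambda>q. D g q (Z q)" "\<lambda>s. (pos c s, vel c s)",
      OF this[unfolded q_def] phase_has_derivative[OF c]]
  have 2: "((\<lambda>s. D g (pos c s, vel c s) (Z (pos c s, vel c s))) has_vector_derivative
      D (\<lambda>q. D g q (Z q)) q (Z q)) (at t within I)"
    by (simp add: Z_def q_def)
  have 3: "derivI I (psi_along A \<psi> I \<eta>) s = D g (pos c s, vel c s) (Z (pos c s, vel c s))" if "s \<in> S" for s
    by (rule derivI_eqI[OF interval domD(1)[OF dS[OF that]] 1[OF that]])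
  show "(derivI I (psi_along A \<psi> I \<eta>) has_vector_derivative D (\<lambda>q. D g q (Z q)) q (Z q)) (at t within I)"
    using has_vector_derivative_cong_openin[OF \<open>openin (top_of_set I) S\<close> tS, of "derivI I (psi_along A \<psi> I \<eta>)"
        "\<lambda>s. D g (pos c s, vel c s) (Z (pos c s, vel c s))"] 3 2 by simp
qed

end

section \<open>Reparametrised geodesics and well-definedness of the derivatives of the
  weight\<close>

locale weighted_spacetime =
  fixes A :: "('m::topological_space, 'd::finite) chart set" and L :: "'m \<Rightarrow> real^'d \<Rightarrow> real" and X :: "'m \<Rightarrow> real^'d"
    and \<psi> :: "'m \<Rightarrow> real^'d \<Rightarrow> real"
  assumes weighted: "weighted_finsler_spacetime A L X \<psi>"
begin

sublocale lorentz_finsler_manifold A L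
  using weighted unfolding weighted_finsler_spacetime_def finsler_spacetime_def
  by unfold_locales auto

lemma future_directed_nonzero: "future_directed L X p v \<Longrightarrow> v \<noteq> 0"
  unfolding future_directed_def using connected_component_subset[of "closure {w. timelike L p w} - {0}" "X p"] by blast

lemma geodesic_curveI:
  assumes "causal_geodesic A L X I \<eta>" shows "geodesic_curve A L I \<eta>"
proof -
  interpret manifold_curve A L I \<eta>
    by unfold_locales (use assms in \<open>auto simp: causal_geodesic_def\<close>)
  show ?thesis
  proof
    fix c t assume c: "c \<in> A" "t \<in> dom c"
    then have "\<forall>a. derivI I (derivI I (snd c \<circ> \<eta>)) t $ a
             + 2 * spray (local_rep A c L) a (snd c (\<eta> t)) (derivI I (snd c \<circ> \<eta>) t) = 0"
      using assms unfolding causal_geodesic_def dom_def by blast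
    then have "derivI I (vel c) t $ a = - (2 * spray (local_rep A c L) a (pos c t) (vel c t))" for a
      unfolding pos_eq vel_def[symmetric] by (simp add: pos_def eq_neg_iff_add_eq_0)
    then show "derivI I (vel c) t = - 2 *\<^sub>R spray_vec (local_rep A c L) (pos c t) (vel c t)"
      by (simp add: vec_eq_iff spray_vec_def)
  next
    show "velocity A I \<eta> t \<noteq> 0" if "t \<in> I" for t
      using assms that future_directed_nonzero unfolding causal_geodesic_def by blast
  qed
qed

text \<open>The open ray through \<open>v\<close> is connected and stays in the closed cone without
  the origin, so \<open>r v\<close> lies in the component of \<open>v\<close>.\<close>

lemma future_directed_scale:
  assumes fd: "future_directed L X p v" and r: "r > 0" shows "future_directed L X p (r *\<^sub>R v)"
proof -
  let ?C = "closure {w. timelike L p w}"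
  have v: "v \<in> ?C" "v \<noteq> 0"
    using fd connected_component_subset[of "?C - {0}" "X p"] unfolding future_directed_def by auto
  have tl: "timelike L p (s *\<^sub>R w)" if "timelike L p w" "s > 0" for s w
    using that by (simp add: timelike_def L_homogeneous mult_pos_neg)
  have sC: "s *\<^sub>R v \<in> ?C" if "s > 0" for s
  proof -
    have "s *\<^sub>R v \<in> (\<lambda>w. s *\<^sub>R w) ` ?C" using v by blast
    also have "\<dots> = closure ((\<lambda>w. s *\<^sub>R w) ` {w. timelike L p w})"
      by (rule closure_scaleR)
    also have "\<dots> \<subseteq> ?C" using tl that by (intro closure_mono) auto
    finally show ?thesis .
  qed
  have "connected ((\<lambda>s. s *\<^sub>R v) ` {0<..})"
    by (intro connected_continuous_image continuous_intros convex_connected) simp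
  moreover have "(\<lambda>s. s *\<^sub>R v) ` {0<..} \<subseteq> ?C - {0}" using sC v by auto
  moreover have "v \<in> (\<lambda>s. s *\<^sub>R v) ` {0<..}" by (rule image_eqI[of _ _ 1]) auto
  moreover have "r *\<^sub>R v \<in> (\<lambda>s. s *\<^sub>R v) ` {0<..}" using r by auto
  ultimately have "connected_component (?C - {0}) v (r *\<^sub>R v)"
    by (rule connected_componentI)
  then have "r *\<^sub>R v \<in> connected_component_set (?C - {0}) (X p)"
    using fd unfolding future_directed_def by (auto intro: connected_component_trans)
  moreover have "causal L p (r *\<^sub>R v)"
    using fd r tl v(2) unfolding future_directed_def causal_def by (auto simp: L_homogeneous)
  ultimately show ?thesis by (simp add: future_directed_def)
qed

lemma local_extension:
  assumes c: "c \<in> A" and x: "x \<in> chart_image c" "v \<noteq> 0"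
    and "tvec A c (chart_inv c x) v \<in> closure (Omega L X (chart_inv c x))"
  obtains U g where "open U" "(x, v) \<in> U" "Cinf_on g U"
    "\<And>x v. (x, v) \<in> U \<Longrightarrow> x \<in> chart_image c \<Longrightarrow> v \<noteq> 0 \<Longrightarrow>
      tvec A c (chart_inv c x) v \<in> closure (Omega L X (chart_inv c x)) \<Longrightarrow> g (x, v) = local_rep A c \<psi> x v"
proof -
  let ?S = "{(x, v). x \<in> chart_image c \<and> v \<noteq> 0 \<and>
                 tvec A c (chart_inv c x) v \<in> closure (Omega L X (chart_inv c x))}"
  have "smooth_on ?S (\<lambda>(x, v). local_rep A c \<psi> x v)"
    using weighted c unfolding weighted_finsler_spacetime_def weight_def by blast
  moreover have "(x, v) \<in> ?S" using assms by simp
  ultimately obtain U g where U: "open U" "(x, v) \<in> U" "\<forall>k. Ck_on k g U"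
      "\<forall>y\<in>U \<inter> ?S. g y = (\<lambda>(x, v). local_rep A c \<psi> x v) y"
    unfolding smooth_on_def by blast
  show ?thesis
  proof (rule that[OF U(1,2)])
    show "Cinf_on g U" using U(3) by (simp add: Cinf_on_def)
    show "g (x, v) = local_rep A c \<psi> x v" if "(x, v) \<in> U" "x \<in> chart_image c" "v \<noteq> 0"
      "tvec A c (chart_inv c x) v \<in> closure (Omega L X (chart_inv c x))" for x v
      using U(4) that by auto
  qed
qed

text \<open>A constant factor in the parameter multiplies the acceleration by its square, which
  matches the degree of the spray. This provides a geodesic whose initial velocity is a prescribed
  positive multiple of the velocity of \<eta>.\<close>

lemma causal_geodesic_affine:
  assumes geo: "causal_geodesic A L X I \<eta>" and t: "t \<in> I" and r: "r > 0"
  defines "K \<equiv> {s. t + r * s \<in> I}" and "\<gamma> \<equiv> \<lambda>s. \<eta> (t + r * s)"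
  shows "causal_geodesic A L X K \<gamma>"
    and "\<And>s. s \<in> K \<Longrightarrow> velocity A K \<gamma> s = r *\<^sub>R velocity A I \<eta> (t + r * s)"
proof -
  interpret \<eta>: geodesic_curve A L I \<eta> by (rule geodesic_curveI[OF geo])
  have K: "proper_interval K" unfolding K_def by (rule proper_interval_affine[OF \<eta>.interval r])
  have dom: "t + r * s \<in> \<eta>.dom c \<longleftrightarrow> s \<in> K \<and> \<gamma> s \<in> fst c" for s c
    by (simp add: \<eta>.dom_def K_def \<gamma>_def)
  have smooth: "smooth_curve A K \<gamma>"
    unfolding smooth_curve_def
  proof (intro conjI ballI)
    have "continuous_on I \<eta>" using \<eta>.smooth_curve by (simp add: smooth_curve_def)
    then show "continuous_on K \<gamma>"
      unfolding \<gamma>_def K_def by (rule continuous_on_compose2) (auto intro!: continuous_intros)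
    fix c assume "c \<in> A"
    have "{s \<in> K. \<gamma> s \<in> fst c} = {s. t + r * s \<in> \<eta>.dom c}" using dom by auto
    moreover have "snd c \<circ> \<gamma> = (\<lambda>s. \<eta>.pos c (t + r * s))" by (auto simp: \<eta>.pos_def \<gamma>_def)
    ultimately show "smooth_on {s \<in> K. \<gamma> s \<in> fst c} (snd c \<circ> \<gamma>)"
      using smooth_on_affine[OF \<eta>.smooth_pos[OF \<open>c \<in> A\<close>]] by simp
  qed
  interpret \<gamma>: manifold_curve A L K \<gamma> by unfold_locales (rule K smooth)+
  have dom\<gamma>: "s \<in> \<gamma>.dom c \<longleftrightarrow> t + r * s \<in> \<eta>.dom c" for s c by (simp add: \<gamma>.dom_def dom)
  have pos: "\<gamma>.pos c = (\<lambda>s. \<eta>.pos c (t + r * s))" for c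
    by (intro ext, unfold \<gamma>.pos_def \<eta>.pos_def) (simp add: \<gamma>_def)
  have vel: "\<gamma>.vel c s = r *\<^sub>R \<eta>.vel c (t + r * s)" if "c \<in> A" "s \<in> \<gamma>.dom c" for c s
    unfolding \<gamma>.vel_def pos
    by (rule derivI_eqI[OF K \<gamma>.domD(1)[OF that(2)]])
      (use has_vector_derivative_affine[OF \<eta>.pos_has_derivative[OF that(1)]] that dom\<gamma> in \<open>simp add: K_def\<close>)
  have acc: "derivI K (\<gamma>.vel c) s = (r * r) *\<^sub>R derivI I (\<eta>.vel c) (t + r * s)" if c: "c \<in> A" "s \<in> \<gamma>.dom c" for c s
  proof -
    have "derivI K (\<gamma>.vel c) s = derivI K (\<lambda>s. r *\<^sub>R \<eta>.vel c (t + r * s)) s"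
      by (rule derivI_cong_openin[OF \<gamma>.openin_dom[OF c(1)] c(2)]) (rule vel[OF c(1)])
    also have "\<dots> = r *\<^sub>R (r *\<^sub>R derivI I (\<eta>.vel c) (t + r * s))"
      by (rule derivI_eqI[OF K \<gamma>.domD(1)[OF c(2)]])
        (use bounded_linear.has_vector_derivative[OF bounded_linear_scaleR_right[of r]
            has_vector_derivative_affine[where t = t and r = r and s = s, OF \<eta>.vel_has_derivative[OF c(1)]]] c dom\<gamma> in \<open>simp add: K_def\<close>)
    finally show ?thesis by simp
  qed
  show velocity: "velocity A K \<gamma> s = r *\<^sub>R velocity A I \<eta> (t + r * s)" if "s \<in> K" for s
    unfolding \<gamma>.velocity_eq \<eta>.velocity_eq
    using vel[OF chart_at(1) \<gamma>.dom_chart_at[OF that]] by (simp add: \<gamma>_def)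
  show "causal_geodesic A L X K \<gamma>"
    unfolding causal_geodesic_def
  proof (intro conjI ballI impI allI)
    fix s assume s: "s \<in> K"
    then have "future_directed L X (\<gamma> s) (velocity A I \<eta> (t + r * s))"
      using geo by (simp add: causal_geodesic_def \<gamma>_def K_def)
    then show "future_directed L X (\<gamma> s) (velocity A K \<gamma> s)"
      unfolding velocity[OF s] using r by (rule future_directed_scale)
    fix c a assume c: "c \<in> A" and "\<gamma> s \<in> fst c"
    then have d: "s \<in> \<gamma>.dom c" using s by (simp add: \<gamma>.dom_def)
    then have d': "t + r * s \<in> \<eta>.dom c" by (simp add: dom\<gamma>)
    interpret C: finsler_chart "local_rep A c L" "chart_image c" by (rule finsler_chart[OF c])
    have "spray (local_rep A c L) a (\<gamma>.pos c s) (\<gamma>.vel c s)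
        = r\<^sup>2 * spray (local_rep A c L) a (\<eta>.pos c (t + r * s)) (\<eta>.vel c (t + r * s))"
      unfolding vel[OF c d] pos
      by (rule C.homogD[OF C.homog_spray \<eta>.pos_in[OF d'] \<eta>.vel_nz[OF c d'] r])
    then show "derivI K (derivI K (snd c \<circ> \<gamma>)) s $ a
        + 2 * spray (local_rep A c L) a (snd c (\<gamma> s)) (derivI K (snd c \<circ> \<gamma>) s) = 0"
      unfolding \<gamma>.pos_eq \<gamma>.vel_def[symmetric] acc[OF c d] \<eta>.geodesic[OF c d']
      by (simp add: \<gamma>.pos_def spray_vec_def power2_eq_square)
  qed (rule K smooth)+
qed

lemma velocity_in_closure:
  assumes "causal_geodesic A L X I \<eta>" "t \<in> I" "timelike L (\<eta> t) (velocity A I \<eta> t)"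
  shows "velocity A I \<eta> t \<in> closure (Omega L X (\<eta> t))"
proof (rule subsetD[OF closure_subset])
  show "velocity A I \<eta> t \<in> Omega L X (\<eta> t)"
    using assms by (simp add: causal_geodesic_def Omega_def)
qed

text \<open>One local extension of the weight near the common velocity serves all geodesics through
  it, and \<open>psi_along_derivatives\<close> expresses both derivatives by that extension and the
  geodesic vector field.\<close>

lemma psi_derivatives_unique:
  assumes geo: "causal_geodesic A L X I \<eta>" and t: "t \<in> I" and tl: "timelike L (\<eta> t) (velocity A I \<eta> t)"
  shows "\<exists>d1 d2. \<forall>K \<gamma> s. causal_geodesic A L X K \<gamma> \<longrightarrow> s \<in> K \<longrightarrow> \<gamma> s = \<eta> t \<longrightarrow>
      velocity A K \<gamma> s = velocity A I \<eta> t \<longrightarrow>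
      (psi_along A \<psi> K \<gamma> has_vector_derivative d1) (at s within K) \<and>
      (derivI K (psi_along A \<psi> K \<gamma>) has_vector_derivative d2) (at s within K)"
proof -
  interpret \<eta>: geodesic_curve A L I \<eta> by (rule geodesic_curveI[OF geo])
  define c where "c = chart_at A (\<eta> t)"
  have c: "c \<in> A" "t \<in> \<eta>.dom c" using chart_at \<eta>.dom_chart_at[OF t] by (auto simp: c_def)
  have "chart_inv c (\<eta>.pos c t) = \<eta> t"
    unfolding \<eta>.pos_def by (rule chart_inv_chart[OF c(1) \<eta>.domD(2)[OF c(2)]])
  then have "tvec A c (chart_inv c (\<eta>.pos c t)) (\<eta>.vel c t) \<in> closure (Omega L X (chart_inv c (\<eta>.pos c t)))"
    using velocity_in_closure[OF geo t tl] \<eta>.tvec_vel[OF c] by simp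
  then obtain U g where U: "open U" "(\<eta>.pos c t, \<eta>.vel c t) \<in> U" "Cinf_on g U"
    and ext: "\<And>x v. (x, v) \<in> U \<Longrightarrow> x \<in> chart_image c \<Longrightarrow> v \<noteq> 0 \<Longrightarrow>
      tvec A c (chart_inv c x) v \<in> closure (Omega L X (chart_inv c x)) \<Longrightarrow> g (x, v) = local_rep A c \<psi> x v"
    by (rule local_extension[OF c(1) \<eta>.pos_in[OF c(2)] \<eta>.vel_nz[OF c]]) blast
  let ?q = "(\<eta>.pos c t, \<eta>.vel c t)" and ?Z = "geo_field (local_rep A c L)"
  show ?thesis
  proof (intro exI allI impI)
    fix K \<gamma> s assume \<gamma>: "causal_geodesic A L X K \<gamma>" "s \<in> K" "\<gamma> s = \<eta> t" "velocity A K \<gamma> s = velocity A I \<eta> t"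
    interpret \<gamma>: geodesic_curve A L K \<gamma> by (rule geodesic_curveI[OF \<gamma>(1)])
    have d: "s \<in> \<gamma>.dom c" using \<gamma>(2,3) c by (simp add: \<gamma>.dom_def \<eta>.dom_def)
    have q: "(\<gamma>.pos c s, \<gamma>.vel c s) = ?q"
      using \<gamma>.tcoord_velocity[OF c(1) d] \<eta>.tcoord_velocity[OF c] \<gamma> by (simp add: \<gamma>.pos_def \<eta>.pos_def)
    have fd: "future_directed L X (\<gamma> s) (velocity A K \<gamma> s)" if "s \<in> K" for s
      using \<gamma>(1) that unfolding causal_geodesic_def by blast
    have tl': "timelike L (\<gamma> s) (velocity A K \<gamma> s)" using tl \<gamma> by simp
    show "(psi_along A \<psi> K \<gamma> has_vector_derivative D g ?q (?Z ?q)) (at s within K) \<and>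
      (derivI K (psi_along A \<psi> K \<gamma>) has_vector_derivative D (\<lambda>q. D g q (?Z q)) ?q (?Z ?q)) (at s within K)"
      using \<gamma>.psi_along_derivatives[OF fd c(1) d tl' U(1) U(2)[folded q] U(3) ext] unfolding q by blast
  qed
qed

lemma psi_along_has_derivative:
  assumes "causal_geodesic A L X I \<eta>" "t \<in> I" "timelike L (\<eta> t) (velocity A I \<eta> t)"
  shows "(psi_along A \<psi> I \<eta> has_vector_derivative derivI I (psi_along A \<psi> I \<eta>) t) (at t within I)"
    and "(derivI I (psi_along A \<psi> I \<eta>) has_vector_derivative derivI I (derivI I (psi_along A \<psi> I \<eta>)) t)
      (at t within I)"
proof -
  obtain d1 d2 where d: "(psi_along A \<psi> I \<eta> has_vector_derivative d1) (at t within I) \<and>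
      (derivI I (psi_along A \<psi> I \<eta>) has_vector_derivative d2) (at t within I)"
    using psi_derivatives_unique[OF assms] assms(1,2) by blast
  have I: "proper_interval I" using assms(1) by (simp add: causal_geodesic_def)
  show "(psi_along A \<psi> I \<eta> has_vector_derivative derivI I (psi_along A \<psi> I \<eta>) t) (at t within I)"
    and "(derivI I (psi_along A \<psi> I \<eta>) has_vector_derivative derivI I (derivI I (psi_along A \<psi> I \<eta>)) t)
      (at t within I)"
    using d by (simp_all add: derivI_eqI[OF I assms(2) conjunct1[OF d]] derivI_eqI[OF I assms(2) conjunct2[OF d]])
qed

text \<open>The selected geodesic and the reparametrised \<eta> have the same initial velocity,
  hence the same derivatives of the weight; along the latter each derivative contributes one factor
  \<open>r\<close>.\<close>

lemma psi_d_eq: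
  assumes geo: "causal_geodesic A L X I \<eta>" and t: "t \<in> I"
    and all_tl: "\<And>s. s \<in> I \<Longrightarrow> timelike L (\<eta> s) (velocity A I \<eta> s)" and r: "r > 0"
  shows "psi_d1 A L X \<psi> (\<eta> t) (r *\<^sub>R velocity A I \<eta> t) = r * derivI I (psi_along A \<psi> I \<eta>) t"
    and "psi_d2 A L X \<psi> (\<eta> t) (r *\<^sub>R velocity A I \<eta> t) = r\<^sup>2 * derivI I (derivI I (psi_along A \<psi> I \<eta>)) t"
proof -
  have tl: "timelike L (\<eta> t) (velocity A I \<eta> t)" by (rule all_tl[OF t])
  define K where "K = {s. t + r * s \<in> I}"
  define \<gamma> where "\<gamma> = (\<lambda>s. \<eta> (t + r * s))"
  let ?v = "r *\<^sub>R velocity A I \<eta> t" and ?p = "psi_along A \<psi> I \<eta>"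
  have \<gamma>: "causal_geodesic A L X K \<gamma>"
    and vel: "\<And>s. s \<in> K \<Longrightarrow> velocity A K \<gamma> s = r *\<^sub>R velocity A I \<eta> (t + r * s)"
    using causal_geodesic_affine[OF geo t r] unfolding K_def \<gamma>_def by auto
  have 0: "0 \<in> K" "\<gamma> 0 = \<eta> t" "velocity A K \<gamma> 0 = ?v"
    using t vel[of 0] by (auto simp: K_def \<gamma>_def)
  have Kint: "proper_interval K" using \<gamma> by (simp add: causal_geodesic_def)
  have Iint: "proper_interval I" using geo by (simp add: causal_geodesic_def)
  have "timelike L (\<gamma> 0) (velocity A K \<gamma> 0)"
    using tl r by (simp add: 0 timelike_def L_homogeneous mult_pos_neg)
  from psi_derivatives_unique[OF \<gamma> 0(1) this] obtain d1 d2 where d0: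
    "\<forall>K' \<gamma>' s. causal_geodesic A L X K' \<gamma>' \<longrightarrow> s \<in> K' \<longrightarrow> \<gamma>' s = \<gamma> 0 \<longrightarrow>
      velocity A K' \<gamma>' s = velocity A K \<gamma> 0 \<longrightarrow>
      (psi_along A \<psi> K' \<gamma>' has_vector_derivative d1) (at s within K') \<and>
      (derivI K' (psi_along A \<psi> K' \<gamma>') has_vector_derivative d2) (at s within K')"
    by (elim exE)
  have d: "(psi_along A \<psi> K' \<gamma>' has_vector_derivative d1) (at s within K') \<and>
      (derivI K' (psi_along A \<psi> K' \<gamma>') has_vector_derivative d2) (at s within K')"
    if "causal_geodesic A L X K' \<gamma>'" "s \<in> K'" "\<gamma>' s = \<eta> t" "velocity A K' \<gamma>' s = ?v" for K' \<gamma>' s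
    using d0 that unfolding 0(2,3) by simp
  note d\<gamma> = d[OF \<gamma> 0]
  have d12: "psi_d1 A L X \<psi> (\<eta> t) ?v = d1 \<and> psi_d2 A L X \<psi> (\<eta> t) ?v = d2"
  proof -
    let ?P = "\<lambda>(K, \<gamma>). 0 \<in> K \<and> causal_geodesic A L X K \<gamma> \<and> \<gamma> 0 = \<eta> t \<and> velocity A K \<gamma> 0 = ?v"
    obtain K' \<gamma>' where g: "geodesic_from A L X (\<eta> t) ?v = (K', \<gamma>')" by fastforce
    \<comment> \<open>The reparametrised geodesic witnesses that the choice in
      \<open>geodesic_from\<close> satisfies its specification.\<close>
    have "?P (K, \<gamma>)" using \<gamma> 0 by simp
    then have "?P (geodesic_from A L X (\<eta> t) ?v)"
      unfolding geodesic_from_def by (rule someI)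
    then have P: "0 \<in> K'" "causal_geodesic A L X K' \<gamma>'" "\<gamma>' 0 = \<eta> t" "velocity A K' \<gamma>' 0 = ?v"
      unfolding g by auto
    have K': "proper_interval K'" using P(2) by (simp add: causal_geodesic_def)
    note d' = d[OF P(2,1,3,4)]
    show ?thesis
      unfolding psi_d1_def psi_d2_def g Let_def
      using derivI_eqI[OF K' P(1) conjunct1[OF d']] derivI_eqI[OF K' P(1) conjunct2[OF d']] by simp
  qed
  \<comment> \<open>Degree 0 homogeneity removes the factor \<open>r\<close> from the velocity. It
    is available on the closed future cone, and timelikeness at every instant places the velocities
    there.\<close>
  have psi: "psi_along A \<psi> K \<gamma> s = ?p (t + r * s)" if "s \<in> K" for s
  proof -
    have I: "t + r * s \<in> I" using that by (simp add: K_def)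
    have "velocity A I \<eta> (t + r * s) \<in> closure (Omega L X (\<eta> (t + r * s)))"
      by (rule velocity_in_closure[OF geo I all_tl[OF I]])
    moreover have "velocity A I \<eta> (t + r * s) \<noteq> 0"
      using geo I future_directed_nonzero unfolding causal_geodesic_def by blast
    ultimately show ?thesis
      using weighted r vel[OF that] unfolding weighted_finsler_spacetime_def weight_def psi_along_def
      by (simp add: \<gamma>_def)
  qed
  have "(?p has_vector_derivative derivI I ?p u) (at u within I)" if "u \<in> I" for u
    by (rule psi_along_has_derivative(1)[OF geo that all_tl[OF that]])
  then have "((\<lambda>s. ?p (t + r * s)) has_vector_derivative r *\<^sub>R derivI I ?p (t + r * s)) (at s within K)" if "s \<in> K" for s
    using has_vector_derivative_affine[of ?p "derivI I ?p (t + r * s)" t r s I] that by (simp add: K_def)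
  then have 1: "(psi_along A \<psi> K \<gamma> has_vector_derivative r *\<^sub>R derivI I ?p (t + r * s)) (at s within K)" if "s \<in> K" for s
    using has_vector_derivative_cong_openin[of K K s "psi_along A \<psi> K \<gamma>" "\<lambda>s. ?p (t + r * s)"] psi that by simp
  have "psi_d1 A L X \<psi> (\<eta> t) ?v = derivI K (psi_along A \<psi> K \<gamma>) 0"
    using d12 derivI_eqI[OF Kint 0(1) conjunct1[OF d\<gamma>]] by simp
  then show "psi_d1 A L X \<psi> (\<eta> t) ?v = r * derivI I ?p t"
    using derivI_eqI[OF Kint 0(1) 1[OF 0(1)]] by simp
  have "(derivI I ?p has_vector_derivative derivI I (derivI I ?p) t) (at t within I)"
    by (rule psi_along_has_derivative(2)[OF geo t tl])
  then have "((\<lambda>s. derivI I ?p (t + r * s)) has_vector_derivative r *\<^sub>R derivI I (derivI I ?p) t) (at 0 within K)"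
    using has_vector_derivative_affine[of "derivI I ?p" _ t r 0 I] by (simp add: K_def)
  from bounded_linear.has_vector_derivative[OF bounded_linear_scaleR_right this, of r]
  have "((\<lambda>s. r *\<^sub>R derivI I ?p (t + r * s)) has_vector_derivative r *\<^sub>R (r *\<^sub>R derivI I (derivI I ?p) t)) (at 0 within K)" .
  then have dd: "(derivI K (psi_along A \<psi> K \<gamma>) has_vector_derivative r *\<^sub>R (r *\<^sub>R derivI I (derivI I ?p) t)) (at 0 within K)"
    using has_vector_derivative_cong_openin[of K K 0 "derivI K (psi_along A \<psi> K \<gamma>)" "\<lambda>s. r *\<^sub>R derivI I ?p (t + r * s)"]
      derivI_eqI[OF Kint _ 1] 0(1) by simp
  have "psi_d2 A L X \<psi> (\<eta> t) ?v = derivI K (derivI K (psi_along A \<psi> K \<gamma>)) 0"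
    using d12 derivI_eqI[OF Kint 0(1) conjunct2[OF d\<gamma>]] by simp
  then show "psi_d2 A L X \<psi> (\<eta> t) ?v = r\<^sup>2 * derivI I (derivI I ?p) t"
    by (simp add: derivI_eqI[OF Kint 0(1) dd] power2_eq_square mult.assoc)
qed

end

section \<open>Scaling of the Ricci curvature and the final algebra\<close>

lemma (in lorentz_finsler_manifold) Ric_scale:
  assumes "v \<noteq> 0" "r > 0" shows "Ric A L p (r *\<^sub>R v) = r\<^sup>2 * Ric A L p v"
proof -
  interpret C: finsler_chart "local_rep A (chart_at A p) L" "chart_image (chart_at A p)"
    by (rule finsler_chart[OF chart_at(1)])
  show ?thesis
    unfolding Ric_def curv_matrix_def Let_def trace_def
    by (simp add: C.curv_homogeneous[OF chart_in_image[OF chart_at(2)] assms] sum_distrib_left)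
qed

text \<open>Dictionary: \<open>a\<close> is the factor dt/d\<tau>, \<open>x\<close> the unweighted
  expansion, \<open>p\<close> and \<open>q\<close> the first two derivatives of the weight,
  \<open>b\<close> the trace of the squared Riccati matrix, \<open>R\<close> the Ricci curvature of
  the velocity, and \<open>m\<close> stands for \<open>n\<close>. \<open>Y\<close> is the derivative
  of the \<epsilon>-expansion with respect to \<epsilon>-proper time and \<open>T\<close> the shear
  term.\<close>

lemma raychaudhuri_algebra:
  fixes a x p q b R \<epsilon> m :: real
  assumes m: "m > 0"
    and Y: "Y = a * (2 * (1 - \<epsilon>) / m * p * a * (x - p) + a * (- R - b - q))"
    and T: "T = a\<^sup>2 * (b - x\<^sup>2 / m)"
  shows raychaudhuri_algebra_0: "Y + 2 * \<epsilon> / m * (a * p) * (a * (x - p)) + (a * (x - p))\<^sup>2 / m + T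
      + (a\<^sup>2 * R + a\<^sup>2 * q - (a * p)\<^sup>2 / (0 - m)) = 0"
    and raychaudhuri_algebra_N: "\<And>N. N \<noteq> 0 \<Longrightarrow> N \<noteq> m \<Longrightarrow>
      Y + (1 - \<epsilon>\<^sup>2 * ((N - m) / N)) * ((a * (x - p))\<^sup>2 / m)
        + N * (N - m) / m * (\<epsilon> * (a * (x - p)) / N + a * p / (N - m))\<^sup>2
        + T + (a\<^sup>2 * R + a\<^sup>2 * q - (a * p)\<^sup>2 / (N - m)) = 0"
    and raychaudhuri_algebra_infinity: "Y + (1 - \<epsilon>\<^sup>2) * ((a * (x - p))\<^sup>2 / m)
        + 1 / m * (\<epsilon> * (a * (x - p)) + a * p)\<^sup>2 + T + (a\<^sup>2 * R + a\<^sup>2 * q) = 0"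
proof -
  show 0: "Y + 2 * \<epsilon> / m * (a * p) * (a * (x - p)) + (a * (x - p))\<^sup>2 / m + T
      + (a\<^sup>2 * R + a\<^sup>2 * q - (a * p)\<^sup>2 / (0 - m)) = 0"
    unfolding Y T using m by (simp add: field_simps power2_eq_square)
  show "Y + (1 - \<epsilon>\<^sup>2) * ((a * (x - p))\<^sup>2 / m)
        + 1 / m * (\<epsilon> * (a * (x - p)) + a * p)\<^sup>2 + T + (a\<^sup>2 * R + a\<^sup>2 * q) = 0"
    unfolding Y T using m by (simp add: field_simps power2_eq_square)
  fix N :: real assume N: "N \<noteq> 0" "N \<noteq> m"
  \<comment> \<open>The combination of these terms does not depend on \<open>N\<close>: expanding
    the square cancels the terms with \<epsilon> squared and leaves w squared over m. So the general
    case reduces to \<open>0\<close>, with \<open>u\<close> the \<epsilon>-expansion and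
    \<open>w\<close> the derivative of the weight.\<close>
  have "(1 - \<epsilon>\<^sup>2 * ((N - m) / N)) * (u\<^sup>2 / m) + N * (N - m) / m * (\<epsilon> * u / N + w / (N - m))\<^sup>2 - w\<^sup>2 / (N - m)
      = 2 * \<epsilon> / m * w * u + u\<^sup>2 / m - w\<^sup>2 / (0 - m)" for u w
  proof -
    define k where "k = N - m"
    have "k \<noteq> 0" "m = N - k" "N - k \<noteq> 0" using N m by (auto simp: k_def)
    then show ?thesis using N(1) unfolding k_def[symmetric]
      by (simp add: divide_simps power2_eq_square) (simp add: algebra_simps)
  qed
  from this[of "a * (x - p)" "a * p"] 0
  show "Y + (1 - \<epsilon>\<^sup>2 * ((N - m) / N)) * ((a * (x - p))\<^sup>2 / m)
        + N * (N - m) / m * (\<epsilon> * (a * (x - p)) / N + a * p / (N - m))\<^sup>2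
        + T + (a\<^sup>2 * R + a\<^sup>2 * q - (a * p)\<^sup>2 / (N - m)) = 0"
    by (simp only: algebra_simps)
qed

text \<open>The differentiability conjunct ensures that \<open>star_deriv\<close> of the expansion
  is a genuine derivative and not the value of an arbitrary choice.\<close>

theorem theorem5p6:
  fixes A :: "('m::{t2_space, second_countable_topology}, 'd::finite) chart set"
    and L \<psi> :: "'m \<Rightarrow> real^'d \<Rightarrow> real"
    and X :: "'m \<Rightarrow> real^'d"
    and n :: nat
    and I :: "real set"
    and \<eta> :: "real \<Rightarrow> 'm"
    and J :: "real \<Rightarrow> real^'d \<Rightarrow> real^'d"
    and \<epsilon> :: real
  assumes "CARD('d) = n + 1" and "n + 1 \<ge> 2"
    and "weighted_finsler_spacetime A L X \<psi>"
    and "unit_timelike_geodesic A L X I \<eta>"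
    and "lagrange_tensor_field A L I \<eta> J"
    and "nonsingular A L I \<eta> J"
  shows "\<forall>t\<in>I.
    let V = Nspace A L I \<eta> t;
        \<theta> = eps_expansion A L \<psi> n \<epsilon> I \<eta> J;
        \<theta>star = star_deriv A \<psi> n \<epsilon> I \<eta> \<theta> t;
        \<psi>star = star_deriv A \<psi> n \<epsilon> I \<eta> (psi_along A \<psi> I \<eta>) t;
        \<sigma> = eps_shear A L \<psi> n \<epsilon> I \<eta> J t;
        \<eta>star = star_velocity A \<psi> n \<epsilon> I \<eta> t
    in \<theta> differentiable (at t within I) \<and>
       (\<theta>star + 2 * \<epsilon> / real n * \<psi>star * \<theta> t + (\<theta> t)\<^sup>2 / real n + trace_on V (\<sigma> \<circ> \<sigma>)
          + Ric_N A L X \<psi> n 0 (\<eta> t) \<eta>star = 0) \<and>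
       (\<forall>N::real. N \<noteq> 0 \<and> N \<noteq> real n \<longrightarrow>
          \<theta>star + (1 - \<epsilon>\<^sup>2 * ((N - real n) / N)) * ((\<theta> t)\<^sup>2 / real n)
          + N * (N - real n) / real n * (\<epsilon> * \<theta> t / N + \<psi>star / (N - real n))\<^sup>2
          + trace_on V (\<sigma> \<circ> \<sigma>) + Ric_N A L X \<psi> n N (\<eta> t) \<eta>star = 0) \<and>
       (\<theta>star + (1 - \<epsilon>\<^sup>2) * ((\<theta> t)\<^sup>2 / real n) + 1 / real n * (\<epsilon> * \<theta> t + \<psi>star)\<^sup>2
          + trace_on V (\<sigma> \<circ> \<sigma>) + Ric_infinity A L X \<psi> (\<eta> t) \<eta>star = 0)"
proof (intro ballI)
  fix t assume t: "t \<in> I"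
  interpret weighted_spacetime A L X \<psi> by unfold_locales fact
  have geo: "causal_geodesic A L X I \<eta>" and tl: "\<And>s. s \<in> I \<Longrightarrow> timelike L (\<eta> s) (velocity A I \<eta> s)"
    using assms(4) by (auto simp: unit_timelike_geodesic_def)
  have speed: "L (\<eta> s) (velocity A I \<eta> s) = - 1 / 2" if "s \<in> I" for s
  proof -
    have "sqrt (- 2 * L (\<eta> s) (velocity A I \<eta> s)) = 1"
      using assms(4) that by (simp add: unit_timelike_geodesic_def Fnorm_def)
    then show ?thesis by simp
  qed
  interpret geodesic_curve A L I \<eta> by (rule geodesic_curveI[OF geo])
  interpret unit_geodesic A L I \<eta> by unfold_locales (rule speed)
  have jacobi_field: "jacobi_tensor_field A L I \<eta> J"
    using assms(5) by (simp add: lagrange_tensor_field_def)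
  interpret normal_field A L I \<eta> J
    by unfold_locales (use jacobi_field assms(6) in \<open>auto simp: jacobi_tensor_field_def Let_def\<close>)
  have n: "n > 0" "CARD('d) = n + 1" using assms(1,2) by auto
  define c where "c = chart_at A (\<eta> t)"
  have c: "c \<in> A" "t \<in> dom c" using chart_at dom_chart_at[OF t] by (auto simp: c_def)
  let ?p = "psi_along A \<psi> I \<eta>" and ?\<theta> = "eps_expansion A L \<psi> n \<epsilon> I \<eta> J"
  let ?\<tau> = "tau_factor A \<psi> n \<epsilon> I \<eta>" and ?\<sigma> = "eps_shear A L \<psi> n \<epsilon> I \<eta> J t"
  let ?p1 = "derivI I ?p" and ?x = "\<lambda>s. trace (K c s ** W c s)" and ?v = "velocity A I \<eta> t"
  define R where "R = Ric A L (\<eta> t) ?v"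
  define b where "b = trace ((K c t ** W c t) ** (K c t ** W c t))"
  have p1: "(?p has_vector_derivative ?p1 s) (at s within I)" if "s \<in> I" for s
    by (rule psi_along_has_derivative(1)[OF geo that tl[OF that]])
  define q where "q = derivI I ?p1 t"
  have p2: "(?p1 has_vector_derivative q) (at t within I)"
    unfolding q_def by (rule psi_along_has_derivative(2)[OF geo t tl[OF t]])
  have x': "(?x has_vector_derivative - R - b) (at t within I)"
    unfolding R_def b_def
    by (rule trace_DJ_has_derivative[OF t c_def])
      (use jacobi_field t in \<open>auto simp: jacobi_tensor_field_def Let_def\<close>)
  \<comment> \<open>The formula is needed at all instants in the domain of the fixed chart, since it
    is differentiated at \<open>t\<close>.\<close>
  have \<theta>: "?\<theta> s = ?\<tau> s * (?x s - ?p1 s)" if "s \<in> dom c" for s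
    by (rule eps_expansion_eq[OF n c(1) that p1[OF domD(1)[OF that]]])
  have "(?p has_real_derivative ?p1 t) (at t within I)"
    using p1[OF t] by (simp add: has_real_derivative_iff_has_vector_derivative)
  then have \<tau>': "(?\<tau> has_real_derivative 2 * (1 - \<epsilon>) / real n * ?p1 t * ?\<tau> t) (at t within I)"
    unfolding tau_factor_def[abs_def] using n by (auto intro!: derivative_eq_intros)
  have "((\<lambda>s. ?\<tau> s * (?x s - ?p1 s)) has_real_derivative
      2 * (1 - \<epsilon>) / real n * ?p1 t * ?\<tau> t * (?x t - ?p1 t) + (- R - b - q) * ?\<tau> t) (at t within I)"
    using x' p2 by (intro DERIV_mult \<tau>' DERIV_diff) (simp_all add: has_real_derivative_iff_has_vector_derivative)
  then have d: "(?\<theta> has_vector_derivative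
      2 * (1 - \<epsilon>) / real n * ?p1 t * ?\<tau> t * (?x t - ?p1 t) + (- R - b - q) * ?\<tau> t) (at t within I)"
    using has_vector_derivative_cong_openin[OF openin_dom[OF c(1)] c(2), of ?\<theta> "\<lambda>s. ?\<tau> s * (?x s - ?p1 s)"] \<theta>
    by (simp add: has_real_derivative_iff_has_vector_derivative)
  have diff: "?\<theta> differentiable (at t within I)"
    and d\<theta>: "derivI I ?\<theta> t = 2 * (1 - \<epsilon>) / real n * ?p1 t * ?\<tau> t * (?x t - ?p1 t) + (- R - b - q) * ?\<tau> t"
    using d derivI_eqI[OF interval t d] by (auto simp: has_vector_derivative_def differentiable_def)
  have \<tau>_pos: "?\<tau> t > 0" by (simp add: tau_factor_def)
  have shear: "trace_on (Nspace A L I \<eta> t) (?\<sigma> \<circ> ?\<sigma>) = (?\<tau> t)\<^sup>2 * (b - (?x t)\<^sup>2 / real n)"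
    unfolding b_def by (rule trace_shear_eq[OF n c p1[OF t]])
  have star: "star_deriv A \<psi> n \<epsilon> I \<eta> ?\<theta> t
      = ?\<tau> t * (2 * (1 - \<epsilon>) / real n * ?p1 t * ?\<tau> t * (?x t - ?p1 t) + ?\<tau> t * (- R - b - q))"
    by (simp add: star_deriv_def d\<theta> mult.commute)
  have psi_star: "star_deriv A \<psi> n \<epsilon> I \<eta> ?p t = ?\<tau> t * ?p1 t"
    by (simp add: star_deriv_def)
  have Ric_star: "Ric A L (\<eta> t) (star_velocity A \<psi> n \<epsilon> I \<eta> t) = (?\<tau> t)\<^sup>2 * R"
    unfolding star_velocity_def R_def by (rule Ric_scale[OF velocity_nonzero[OF t] \<tau>_pos])
  have d1: "psi_d1 A L X \<psi> (\<eta> t) (star_velocity A \<psi> n \<epsilon> I \<eta> t) = ?\<tau> t * ?p1 t"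
    and d2: "psi_d2 A L X \<psi> (\<eta> t) (star_velocity A \<psi> n \<epsilon> I \<eta> t) = (?\<tau> t)\<^sup>2 * q"
    unfolding star_velocity_def q_def
    using psi_d_eq[OF geo t tl \<tau>_pos] by auto
  note eqs = Let_def Ric_N_def Ric_infinity_def Ric_star d1 d2 psi_star \<theta>[OF c(2)]
  have n': "real n > 0" using n by simp
  show "let V = Nspace A L I \<eta> t;
        \<theta> = eps_expansion A L \<psi> n \<epsilon> I \<eta> J;
        \<theta>star = star_deriv A \<psi> n \<epsilon> I \<eta> \<theta> t;
        \<psi>star = star_deriv A \<psi> n \<epsilon> I \<eta> (psi_along A \<psi> I \<eta>) t;
        \<sigma> = eps_shear A L \<psi> n \<epsilon> I \<eta> J t;
        \<eta>star = star_velocity A \<psi> n \<epsilon> I \<eta> t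
    in \<theta> differentiable (at t within I) \<and>
       (\<theta>star + 2 * \<epsilon> / real n * \<psi>star * \<theta> t + (\<theta> t)\<^sup>2 / real n + trace_on V (\<sigma> \<circ> \<sigma>)
          + Ric_N A L X \<psi> n 0 (\<eta> t) \<eta>star = 0) \<and>
       (\<forall>N::real. N \<noteq> 0 \<and> N \<noteq> real n \<longrightarrow>
          \<theta>star + (1 - \<epsilon>\<^sup>2 * ((N - real n) / N)) * ((\<theta> t)\<^sup>2 / real n)
          + N * (N - real n) / real n * (\<epsilon> * \<theta> t / N + \<psi>star / (N - real n))\<^sup>2
          + trace_on V (\<sigma> \<circ> \<sigma>) + Ric_N A L X \<psi> n N (\<eta> t) \<eta>star = 0) \<and>
       (\<theta>star + (1 - \<epsilon>\<^sup>2) * ((\<theta> t)\<^sup>2 / real n) + 1 / real n * (\<epsilon> * \<theta> t + \<psi>star)\<^sup>2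
          + trace_on V (\<sigma> \<circ> \<sigma>) + Ric_infinity A L X \<psi> (\<eta> t) \<eta>star = 0)"
    unfolding eqs
    by (intro conjI allI impI diff raychaudhuri_algebra_0[OF n' star shear] raychaudhuri_algebra_infinity[OF n' star shear]
        raychaudhuri_algebra_N[OF n' star shear]) auto
qed

end
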